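(* Let $F,A\in\mathbb{R}^{m\times n}$, $H\in\mathbb{R}^{p\times n}$, let $Q_0,Q\in\mathbb{R}^{m\times m}$ and $R\in\mathbb{R}^{p\times p}$ be symmetric positive definite, let $\ell\in\mathbb{R}^m$, $0<t_1\in\mathbb{R}$, $I=[0,t_1]$. Let $\mathscr{S}=(A_a,B_a,C_a,D_a)$ be an LTI system associated with the dual DAE $\frac{d(F^\top q)}{dt}=A^\top q-H^\top u$, with state dimension $\hat n$, input dimension $k$ and state map $\mathcal{M}=(F^\top C_s)^+$, where $C_s$ is formed by the first $m$ rows of $C_a$, and let $C_u,D_u$ be formed by the last $p$ rows of $C_a,D_a$. Let $S=\begin{bmatrix}Q^{-1}&0\\0&R^{-1}\end{bmatrix}$ and let $P,K$ be given on $[0,t_1]$ by $$\dot P(t)=A_a^\top P(t)+P(t)A_a-K^\top(t)(D_a^\top SD_a)K(t)+C_a^\top SC_a,\qquad P(0)=C_s^\top\bar Q_0C_s,$$ $$K(t)=(D_a^\top SD_a)^{-1}(B_a^\top P(t)+D_a^\top SC_a)\ \text{ if }D_a\neq0,\qquad K(t)=0\in\mathbb{R}^{1\times\hat n}\ \text{ if }D_a=0.$$ Let $v$ and $u^*$ be defined on $I$ by $$\dot v(s)=(A_a-B_aK(t_1-s))v(s),\quad v(0)=\mathcal{M}(F^\top\ell),\qquad u^*(s)=(C_u-D_uK(t_1-s))v(s).$$ If $(F,A,H)$ is $\ell$-impulse observable, then $\widehat U(s)=u^*(t_1-s)$ is a (finite horizon) minimax observer on $I=[0,t_1]$. Moreover,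 $$\sigma(\widehat U,\ell,t_1)=\ell^\top F\mathcal{M}^\top P(t_1)\mathcal{M}F^\top\ell,$$ and $\mathcal{O}_{\widehat U}(t_1,y)=\ell^\top F\mathcal{M}^\top r(t_1)$ for $y\in L^2(I,\mathbb{R}^p)$, where $r:I\to\mathbb{R}^{\hat n}$ is absolutely continuous, $r(0)=0$ and $$\dot r(t)=(A_a-B_aK(t))^\top r(t)+(C_u-D_uK(t))^\top y(t)\quad\text{a.e.}$$
   Context: Notation. $M^+$ is the Moore-Penrose pseudoinverse of a matrix $M$; $\mathcal{I}_m$ is the $m\times m$ identity. $L^2_{loc}(I)$ denotes functions on an interval $I$ that are square integrable on every compact subinterval; $AC(I)$ denotes absolutely continuous functions (on every compact subinterval if $I=[0,+\infty)$). When $Fx$ (resp. $F^\top q$) is absolutely continuous, $Fx(t)$ (resp. $F^\top q(t)$) denotes the value at $t$ of the absolutely continuous function. An LTI system $\dot x=Ax+Bu$, $y=Cx+Du$ is identified with $(A,B,C,D)$. DAE. A solution on $I=[0,t_1]$ of the DAE $\frac{d(Fx)}{dt}=Ax+f$, $y=Hx+\eta$ is a tuple $(x,f,y,\eta)\in L^2_{loc}(I,\mathbb{R}^n)\times L^2_{loc}(I,\mathbb{R}^m)\times L^2_{loc}(I,\mathbb{R}^p)\times L^2_{loc}(I,\mathbb{R}^p)$ such that $Fx$ is absolutely continuous, $Fx(t)=Fx(0)+\int_0^t(Ax(s)+f(s))ds$ for all $t\in I$, and $y(t)=Hx(t)+\eta(t)$ a.e. on $I$. It is admissible if $(Fx(0))^\top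 Q_0Fx(0)+\int_0^{\tau}(f^\top Qf+\eta^\top R\eta)dt\le1$ for all $\tau\in I$. The set of admissible solutions on $I$ is $\mathscr{EE}(I)$. Observers. For $U,y\in L^2([0,t_1],\mathbb{R}^p)$ let $\mathcal{O}_U(t_1,y)=\int_0^{t_1}y^\top(t)U(t)dt$ and $\sigma(U,\ell,t_1):=\sup_{(x,f,y,\eta)\in\mathscr{EE}([0,t_1])}(\ell^\top Fx(t_1)-\mathcal{O}_U(t_1,y))^2$. $\widehat U\in L^2([0,t_1],\mathbb{R}^p)$ is a minimax observer on $[0,t_1]$ if $\sigma(\widehat U,\ell,t_1)=\inf_{U\in L^2([0,t_1],\mathbb{R}^p)}\sigma(U,\ell,t_1)<+\infty$. Dual DAE. For $I=[0,\tau]$, $0<\tau\in\mathbb{R}$, or $I=[0,+\infty)$, a solution on $I$ of the dual DAE $\frac{d(F^\top q)}{dt}=A^\top q-H^\top u$ is a pair $(q,u)\in L^2_{loc}(I,\mathbb{R}^m)\times L^2_{loc}(I,\mathbb{R}^p)$ such that $F^\top q$ is absolutely continuous and $F^\top q(t)=F^\top q(0)+\int_0^t(A^\top q(s)-H^\top u(s))ds$ for all $t\in I$. The set of these is $\mathcal{B}_I(F^\top,A^\top,H^\top)$, and $\mathscr{D}_\ell(I)$ is the subset of those with $F^\top q(0)=F^\top\ell$. $(F,A,H)$ is $\ell$-impulse observable if $\mathscr{D}_\ell([0,\tau])\neq\varnothing$ for some $0<\tau\in\mathbb{R}$. $\bar Q_0=F\big((F^\top)^+-\mathcal{M}_{opt}\big)^\top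 Q_0^{-1}\big((F^\top)^+-\mathcal{M}_{opt}\big)F^\top$, where $\mathcal{M}_{opt}=\Pi(\Pi Q_0^{-1}\Pi)^+\Pi Q_0^{-1}(F^\top)^+$ and $\Pi=\mathcal{I}_m-(F^\top)^+F^\top$. Associated LTI system. Let $A_a\in\mathbb{R}^{\hat n\times\hat n}$, $B_a\in\mathbb{R}^{\hat n\times k}$, $C_a\in\mathbb{R}^{(m+p)\times\hat n}$, $D_a\in\mathbb{R}^{(m+p)\times k}$ for some $\hat n,k>0$. $\mathscr{S}=(A_a,B_a,C_a,D_a)$ is associated with the dual DAE if: (1) either $k=1$ and $D_a=0$, $B_a=0$, or $D_a$ has full column rank; (2) with $C_s,D_s$ the first $m$ rows of $C_a,D_a$, $F^\top D_s=0$ and $\mathrm{rank}\,F^\top C_s=\hat n$; (3) for every interval $I=[0,\tau]$, $0<\tau\in\mathbb{R}$, or $I=[0,+\infty)$: $(q,u)\in\mathcal{B}_I(F^\top,A^\top,H^\top)$ if and only if there exists $(p,g)\in AC(I,\mathbb{R}^{\hat n})\times L^2_{loc}(I,\mathbb{R}^k)$ such that $\dot p=A_ap+B_ag$ a.e. and $\begin{bmatrix} q \\ u \end{bmatrix}=C_ap+D_ag$ a.e. The matrix $\mathcal{M}:=(F^\top C_s)^+$ is the state map of $\mathscr{S}$. *)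

theory Defs
  imports "HOL-Analysis.Analysis"
begin

definition sym_pos_def :: "real^'n^'n \<Rightarrow> bool" where
  "sym_pos_def M \<longleftrightarrow> transpose M = M \<and> (\<forall>x. x \<noteq> 0 \<longrightarrow> x \<bullet> (M *v x) > 0)"

(* Moore-Penrose pseudoinverse, by the four Penrose equations. *)
definition pinv :: "real^'n^'m \<Rightarrow> real^'m^'n" where
  "pinv M = (THE X. M ** X ** M = M \<and> X ** M ** X = X \<and>
     transpose (M ** X) = M ** X \<and> transpose (X ** M) = X ** M)"

(* A vector or matrix with m + p rows is indexed by the sum type 'm + 'p:
   Inl marks the first m rows, Inr the last p rows. *)
definition upper_rows :: "real^'c^('m::finite + 'p::finite) \<Rightarrow> real^'c^'m" where
  "upper_rows M = (\<chi> i. M $ Inl i)"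

definition lower_rows :: "real^'c^('m::finite + 'p::finite) \<Rightarrow> real^'c^'p" where
  "lower_rows M = (\<chi> i. M $ Inr i)"

definition stack :: "real^'m \<Rightarrow> real^'p \<Rightarrow> real^('m::finite + 'p::finite)" where
  "stack q u = (\<chi> i. case i of Inl a \<Rightarrow> q $ a | Inr b \<Rightarrow> u $ b)"

definition block_diag ::
  "real^'m^'m \<Rightarrow> real^'p^'p \<Rightarrow> real^('m::finite + 'p::finite)^('m + 'p)" where
  "block_diag M N = (\<chi> i j. case (i, j) of
       (Inl a, Inl b) \<Rightarrow> M $ a $ b
     | (Inr a, Inr b) \<Rightarrow> N $ a $ b
     | _ \<Rightarrow> 0)"

(* On a compact interval I this is membership in L^2(I). *)
definition L2loc :: "real set \<Rightarrow> (real \<Rightarrow> 'a::euclidean_space) \<Rightarrow> bool" where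
  "L2loc I f \<longleftrightarrow> (\<forall>a b. {a..b} \<subseteq> I \<longrightarrow>
     f \<in> borel_measurable (lebesgue_on {a..b}) \<and>
     integrable (lebesgue_on {a..b}) (\<lambda>t. (norm (f t))\<^sup>2))"

(* Absolute continuity on every compact subinterval of I; D ranges over the finite families
   of non-overlapping compact intervals. *)
definition AC_on :: "real set \<Rightarrow> (real \<Rightarrow> 'a::euclidean_space) \<Rightarrow> bool" where
  "AC_on I f \<longleftrightarrow> (\<forall>a b. {a..b} \<subseteq> I \<longrightarrow>
     (\<forall>\<epsilon>>0. \<exists>\<delta>>0. \<forall>D. D division_of \<Union>D \<and> \<Union>D \<subseteq> {a..b} \<and> (\<Sum>J\<in>D. Sup J - Inf J) < \<delta> \<longrightarrow>
        (\<Sum>J\<in>D. norm (f (Sup J) - f (Inf J))) < \<epsilon>))"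

(* Elements of L^2 are classes modulo null sets. That such a class is absolutely continuous
   means that it has an absolutely continuous representative; on a nondegenerate interval the
   representative is unique, and point values of the class are the values of ac_rep. *)
definition is_ac_rep :: "real set \<Rightarrow> (real \<Rightarrow> 'a::euclidean_space) \<Rightarrow> (real \<Rightarrow> 'a) \<Rightarrow> bool" where
  "is_ac_rep I f \<phi> \<longleftrightarrow> AC_on I \<phi> \<and> (AE t in lebesgue_on I. f t = \<phi> t)"

definition has_ac_rep :: "real set \<Rightarrow> (real \<Rightarrow> 'a::euclidean_space) \<Rightarrow> bool" where
  "has_ac_rep I f \<longleftrightarrow> (\<exists>\<phi>. is_ac_rep I f \<phi>)"

definition ac_rep :: "real set \<Rightarrow> (real \<Rightarrow> 'a::euclidean_space) \<Rightarrow> real \<Rightarrow> 'a" where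
  "ac_rep I f = (SOME \<phi>. is_ac_rep I f \<phi>)"

definition dae_sol ::
  "real^'n^'m \<Rightarrow> real^'n^'m \<Rightarrow> real^'n^'p \<Rightarrow> real \<Rightarrow>
   (real \<Rightarrow> real^'n) \<Rightarrow> (real \<Rightarrow> real^'m) \<Rightarrow> (real \<Rightarrow> real^'p) \<Rightarrow> (real \<Rightarrow> real^'p) \<Rightarrow> bool" where
  "dae_sol F A H t1 x f y \<eta> \<longleftrightarrow>
     L2loc {0..t1} x \<and> L2loc {0..t1} f \<and> L2loc {0..t1} y \<and> L2loc {0..t1} \<eta> \<and>
     has_ac_rep {0..t1} (\<lambda>t. F *v x t) \<and>
     (\<forall>t\<in>{0..t1}. ac_rep {0..t1} (\<lambda>t. F *v x t) t =
        ac_rep {0..t1} (\<lambda>t. F *v x t) 0 + (LINT s|lebesgue_on {0..t}. A *v x s + f s)) \<and>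
     (AE t in lebesgue_on {0..t1}. y t = H *v x t + \<eta> t)"

definition admissible_sols ::
  "real^'n^'m \<Rightarrow> real^'n^'m \<Rightarrow> real^'n^'p \<Rightarrow> real^'m^'m \<Rightarrow> real^'m^'m \<Rightarrow> real^'p^'p \<Rightarrow> real \<Rightarrow>
   ((real \<Rightarrow> real^'n) \<times> (real \<Rightarrow> real^'m) \<times> (real \<Rightarrow> real^'p) \<times> (real \<Rightarrow> real^'p)) set" where
  "admissible_sols F A H Q0 Q R t1 = {(x, f, y, \<eta>). dae_sol F A H t1 x f y \<eta> \<and>
     (\<forall>\<tau>\<in>{0..t1}.
        ac_rep {0..t1} (\<lambda>t. F *v x t) 0 \<bullet> (Q0 *v ac_rep {0..t1} (\<lambda>t. F *v x t) 0) +
        (LINT t|lebesgue_on {0..\<tau>}. f t \<bullet> (Q *v f t) + \<eta> t \<bullet> (R *v \<eta> t)) \<le> 1)}"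

definition observer_out ::
  "(real \<Rightarrow> real^'p) \<Rightarrow> real \<Rightarrow> (real \<Rightarrow> real^'p) \<Rightarrow> real" where
  "observer_out U t1 y = (LINT t|lebesgue_on {0..t1}. y t \<bullet> U t)"

(* The worst-case error may be infinite, hence the extended reals. *)
definition worst_error ::
  "real^'n^'m \<Rightarrow> real^'n^'m \<Rightarrow> real^'n^'p \<Rightarrow> real^'m^'m \<Rightarrow> real^'m^'m \<Rightarrow> real^'p^'p \<Rightarrow>
   (real \<Rightarrow> real^'p) \<Rightarrow> real^'m \<Rightarrow> real \<Rightarrow> ereal" where
  "worst_error F A H Q0 Q R U l t1 =
     (SUP (x, f, y, \<eta>) \<in> admissible_sols F A H Q0 Q R t1.
        ereal ((l \<bullet> ac_rep {0..t1} (\<lambda>t. F *v x t) t1 - observer_out U t1 y)\<^sup>2))"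

definition minimax_observer ::
  "real^'n^'m \<Rightarrow> real^'n^'m \<Rightarrow> real^'n^'p \<Rightarrow> real^'m^'m \<Rightarrow> real^'m^'m \<Rightarrow> real^'p^'p \<Rightarrow>
   (real \<Rightarrow> real^'p) \<Rightarrow> real^'m \<Rightarrow> real \<Rightarrow> bool" where
  "minimax_observer F A H Q0 Q R Uhat l t1 \<longleftrightarrow>
     L2loc {0..t1} Uhat \<and>
     worst_error F A H Q0 Q R Uhat l t1 =
       (INF U \<in> {U. L2loc {0..t1} U}. worst_error F A H Q0 Q R U l t1) \<and>
     worst_error F A H Q0 Q R Uhat l t1 < \<infinity>"

definition dual_sols ::
  "real set \<Rightarrow> real^'n^'m \<Rightarrow> real^'n^'m \<Rightarrow> real^'n^'p \<Rightarrow>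
   ((real \<Rightarrow> real^'m) \<times> (real \<Rightarrow> real^'p)) set" where
  "dual_sols I F A H = {(q, u). L2loc I q \<and> L2loc I u \<and>
     has_ac_rep I (\<lambda>t. transpose F *v q t) \<and>
     (\<forall>t\<in>I. ac_rep I (\<lambda>t. transpose F *v q t) t =
        ac_rep I (\<lambda>t. transpose F *v q t) 0 +
        (LINT s|lebesgue_on {0..t}. transpose A *v q s - transpose H *v u s))}"

definition dual_sols_from ::
  "real^'m \<Rightarrow> real set \<Rightarrow> real^'n^'m \<Rightarrow> real^'n^'m \<Rightarrow> real^'n^'p \<Rightarrow>
   ((real \<Rightarrow> real^'m) \<times> (real \<Rightarrow> real^'p)) set" where
  "dual_sols_from l I F A H = {(q, u) \<in> dual_sols I F A H.
     ac_rep I (\<lambda>t. transpose F *v q t) 0 = transpose F *v l}"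

definition impulse_observable ::
  "real^'m \<Rightarrow> real^'n^'m \<Rightarrow> real^'n^'m \<Rightarrow> real^'n^'p \<Rightarrow> bool" where
  "impulse_observable l F A H \<longleftrightarrow> (\<exists>\<tau>>0. dual_sols_from l {0..\<tau>} F A H \<noteq> {})"

definition ker_proj :: "real^'n^'m \<Rightarrow> real^'m^'m" where
  "ker_proj F = mat 1 - pinv (transpose F) ** transpose F"

definition M_opt :: "real^'n^'m \<Rightarrow> real^'m^'m \<Rightarrow> real^'n^'m" where
  "M_opt F Q0 = ker_proj F ** pinv (ker_proj F ** matrix_inv Q0 ** ker_proj F) **
     ker_proj F ** matrix_inv Q0 ** pinv (transpose F)"

definition Q0_bar :: "real^'n^'m \<Rightarrow> real^'m^'m \<Rightarrow> real^'m^'m" where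
  "Q0_bar F Q0 = F ** transpose (pinv (transpose F) - M_opt F Q0) ** matrix_inv Q0 **
     (pinv (transpose F) - M_opt F Q0) ** transpose F"

definition time_intervals :: "real set set" where
  "time_intervals = {{0..\<tau>} |\<tau>. 0 < \<tau>} \<union> {{0..}}"

definition associated_lti ::
  "real^'n^'m \<Rightarrow> real^'n^'m \<Rightarrow> real^'n^'p \<Rightarrow>
   real^'h^'h \<Rightarrow> real^'k^'h \<Rightarrow> real^'h^('m::finite + 'p::finite) \<Rightarrow> real^'k^('m + 'p) \<Rightarrow> bool" where
  "associated_lti F A H Aa Ba Ca Da \<longleftrightarrow>
     ((CARD('k) = 1 \<and> Da = 0 \<and> Ba = 0) \<or> rank Da = CARD('k)) \<and>
     transpose F ** upper_rows Da = 0 \<and>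
     rank (transpose F ** upper_rows Ca) = CARD('h) \<and>
     (\<forall>I \<in> time_intervals. \<forall>q u.
        (q, u) \<in> dual_sols I F A H \<longleftrightarrow>
        (\<exists>p g. AC_on I p \<and> L2loc I g \<and>
           (AE t in lebesgue_on I.
              (p has_vector_derivative (Aa *v p t + Ba *v g t)) (at t within I)) \<and>
           (AE t in lebesgue_on I. stack (q t) (u t) = Ca *v p t + Da *v g t)))"

definition state_map :: "real^'n^'m \<Rightarrow> real^'h^('m::finite + 'p::finite) \<Rightarrow> real^'n^'h" where
  "state_map F Ca = pinv (transpose F ** upper_rows Ca)"

end

theory Submission imports Defs begin

text \<open>Write \<open>T = t1\<close>, let \<open>a\<close> be the absolutely continuous representative of \<open>F x\<close>, and run a solution \<open>(q, u)\<close> of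
  the dual DAE with \<open>F^T q(0) = F^T l\<close> backwards: \<open>w(t) = q(T - t)\<close>, \<open>U(t) = u(T - t)\<close>. Integration by parts
  (\<open>primal_dual_identity\<close>) turns the estimation error of the observer \<open>U\<close> into a linear functional of the
  disturbance, namely \<open>a(0)^T e + \<integral> (f^T w - \<eta>^T U)\<close>, where \<open>e\<close> may be any vector with
  \<open>F^T e = F^T q(T)\<close>, because \<open>a(0)\<close> lies in the range of \<open>F\<close>. The best choice of \<open>e\<close> is the one described by
  \<open>Q0_bar\<close> (\<open>Q0_bar_optimal\<close>), and Cauchy-Schwarz bounds the worst-case squared error by the dual cost
  \<open>J(q, u) = q(T)^T Q0_bar q(T) + \<integral> (q^T Q^(-1) q + u^T R^(-1) u)\<close> (\<open>worst_error_le\<close>).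

  On the associated system, minimising \<open>J\<close> is a linear-quadratic control problem, which the Riccati
  equation solves with the feedback \<open>g = - K v\<close>. Only the bilinear identity \<open>riccati_pairing\<close> is needed: it
  evaluates the cost of the optimal solution as \<open>v(0)^T P(T) v(0)\<close>, and it shows that the optimal solution is
  orthogonal, in the inner product of \<open>J\<close>, to every dual solution with \<open>F^T q(0) = 0\<close>.

  The bound is sharp, and no other observer does better (\<open>worst_error_ge\<close>). A solution of the DAE with
  output \<open>y = 0\<close> gives every observer the same error, so it suffices to find such solutions whose disturbance
  approaches the extremal one \<open>(Q0^(-1) e, Q^(-1) w, - R^(-1) U)\<close>. The disturbances of zero-output solutions
  form a linear space, and by the lemma of DuBois and Reymond the vectors orthogonal to it correspond to the
  time-reversed dual solutions with \<open>F^T q(0) = 0\<close>. The extremal disturbance is orthogonal to those, hence it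
  lies in the closure of that space (\<open>L2_approx_by_subspace\<close>, \<open>state_defect_approx\<close>).

  The recursive form of the observer comes from differentiating \<open>r(t)^T v(T - t)\<close>
  (\<open>observer_state_output\<close>), and the state \<open>r\<close> exists by \<open>linear_ode_exists\<close>.\<close>

section \<open>Square-integrable functions\<close>

text \<open>Square integrability, for functions rather than for classes modulo null sets: pointwise operations
  on representatives then need no quotient, and equality in the Hilbert space is almost-everywhere
  equality.\<close>
definition sqint :: "'a measure \<Rightarrow> ('a \<Rightarrow> 'b::euclidean_space) \<Rightarrow> bool" where
  "sqint M f \<longleftrightarrow> f \<in> borel_measurable M \<and> integrable M (\<lambda>t. (norm (f t))\<^sup>2)"

lemma sqint_measurable: "sqint M f \<Longrightarrow> f \<in> borel_measurable M"
  by (simp add: sqint_def)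

lemma sqint_bound:
  assumes "g \<in> borel_measurable M" "integrable M h" "\<And>x. x \<in> space M \<Longrightarrow> (norm (g x))\<^sup>2 \<le> h x"
  shows "sqint M g"
  unfolding sqint_def
proof
  show "integrable M (\<lambda>t. (norm (g t))\<^sup>2)"
    by (rule Bochner_Integration.integrable_bound[OF assms(2)])
       (use assms in \<open>auto intro!: AE_I2 intro: order_trans[OF _ abs_ge_self]\<close>)
qed fact

lemma sqint_inner_integrable:
  assumes "sqint M f" "sqint M g"
  shows "integrable M (\<lambda>t. f t \<bullet> g t)"
proof (rule Bochner_Integration.integrable_bound)
  show "integrable M (\<lambda>t. (norm (f t))\<^sup>2 + (norm (g t))\<^sup>2)"
    using assms by (auto simp: sqint_def)
  show "(\<lambda>t. f t \<bullet> g t) \<in> borel_measurable M"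
    using assms by (auto simp: sqint_def)
  have "\<bar>a \<bullet> b\<bar> \<le> (norm a)\<^sup>2 + (norm b)\<^sup>2" for a b :: 'b
    using Cauchy_Schwarz_ineq2[of a b] sum_squares_bound[of "norm a" "norm b"]
      mult_nonneg_nonneg[OF norm_ge_zero[of a] norm_ge_zero[of b]] by linarith
  then show "AE t in M. norm (f t \<bullet> g t) \<le> norm ((norm (f t))\<^sup>2 + (norm (g t))\<^sup>2)"
    by auto
qed

lemma sqint_add:
  assumes "sqint M f" "sqint M g"
  shows "sqint M (\<lambda>t. f t + g t)"
proof (rule sqint_bound)
  show "integrable M (\<lambda>t. 2 * (norm (f t))\<^sup>2 + 2 * (norm (g t))\<^sup>2)"
    using assms by (auto simp: sqint_def)
  show "(\<lambda>t. f t + g t) \<in> borel_measurable M"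
    using assms by (auto simp: sqint_def)
  fix x
  have "(norm (f x + g x))\<^sup>2 + (norm (f x - g x))\<^sup>2 = 2 * (norm (f x))\<^sup>2 + 2 * (norm (g x))\<^sup>2"
    by (simp add: power2_norm_eq_inner algebra_simps)
  then show "(norm (f x + g x))\<^sup>2 \<le> 2 * (norm (f x))\<^sup>2 + 2 * (norm (g x))\<^sup>2"
    by (smt (verit) zero_le_power2)
qed

lemma sqint_bounded_linear:
  assumes "bounded_linear L" "sqint M f"
  shows "sqint M (\<lambda>t. L (f t))"
proof -
  interpret bounded_linear L by fact
  obtain K where K: "\<And>x. norm (L x) \<le> norm x * K" using bounded by blast
  show ?thesis
  proof (rule sqint_bound)
    show "integrable M (\<lambda>t. K\<^sup>2 * (norm (f t))\<^sup>2)"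
      using assms by (auto simp: sqint_def)
    show "(\<lambda>t. L (f t)) \<in> borel_measurable M"
      by (rule borel_measurable_continuous_on[OF linear_continuous_on[OF assms(1)] sqint_measurable[OF assms(2)]])
    fix x show "(norm (L (f x)))\<^sup>2 \<le> K\<^sup>2 * (norm (f x))\<^sup>2"
      using power_mono[OF K[of "f x"] norm_ge_zero, of 2]
      by (simp add: power_mult_distrib mult.commute)
  qed
qed

lemmas sqint_matrix = sqint_bounded_linear[OF matrix_vector_mul_bounded_linear]
lemmas sqint_scaleR = sqint_bounded_linear[OF bounded_linear_scaleR_right]
lemmas sqint_fst = sqint_bounded_linear[OF bounded_linear_fst]
lemmas sqint_snd = sqint_bounded_linear[OF bounded_linear_snd]

lemma sqint_uminus: "sqint M f \<Longrightarrow> sqint M (\<lambda>t. - f t)"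
  using sqint_scaleR[of M f "-1"] by simp

lemma sqint_diff: "sqint M f \<Longrightarrow> sqint M g \<Longrightarrow> sqint M (\<lambda>t. f t - g t)"
  using sqint_add[of M f "\<lambda>t. - g t"] sqint_uminus[of M g] by simp

lemma sqint_const: "finite_measure M \<Longrightarrow> sqint M (\<lambda>t. c)"
  by (simp add: sqint_def finite_measure.integrable_const)

lemma sqint_Pair:
  assumes "sqint M f" "sqint M g"
  shows "sqint M (\<lambda>t. (f t, g t))"
proof (rule sqint_bound)
  show "integrable M (\<lambda>t. (norm (f t))\<^sup>2 + (norm (g t))\<^sup>2)"
    using assms by (auto simp: sqint_def)
  show "(\<lambda>t. (f t, g t)) \<in> borel_measurable M"
    using assms by (auto simp: sqint_def)
qed (simp add: norm_Pair)

lemma sqint_norm: "sqint M f \<Longrightarrow> sqint M (\<lambda>t. norm (f t))"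
  by (auto simp: sqint_def)

lemma sqint_integrable_norm:
  assumes "finite_measure M" "sqint M f"
  shows "integrable M (\<lambda>t. norm (f t))"
  using sqint_inner_integrable[OF sqint_norm[OF assms(2)] sqint_const[OF assms(1), of "1::real"]]
  by simp

lemma sqint_integrable:
  assumes "finite_measure M" "sqint M f"
  shows "integrable M f"
  using sqint_integrable_norm[OF assms] integrable_norm_cancel sqint_measurable[OF assms(2)] by blast

lemma sqint_bounded_bilinear:
  fixes B :: "'b::euclidean_space \<Rightarrow> 'c::euclidean_space \<Rightarrow> 'd::euclidean_space"
  assumes B: "bounded_bilinear B" and f: "f \<in> borel_measurable M" "\<And>t. t \<in> space M \<Longrightarrow> norm (f t) \<le> C"
    and g: "sqint M g"
  shows "sqint M (\<lambda>t. B (f t) (g t))"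
proof -
  interpret bounded_bilinear B by fact
  obtain K where K: "\<And>a b. norm (B a b) \<le> norm a * norm b * K" and "K \<ge> 0"
    using nonneg_bounded by blast
  show ?thesis
  proof (rule sqint_bound)
    show "integrable M (\<lambda>t. (C * K)\<^sup>2 * (norm (g t))\<^sup>2)"
      using g by (auto simp: sqint_def)
    show "(\<lambda>t. B (f t) (g t)) \<in> borel_measurable M"
      by (rule borel_measurable_continuous_Pair[OF f(1) sqint_measurable[OF g], of B])
         (intro continuous_on continuous_intros)
    fix t assume t: "t \<in> space M"
    have "norm (B (f t) (g t)) \<le> norm (f t) * norm (g t) * K" by (rule K)
    also have "\<dots> \<le> C * norm (g t) * K"
      using f(2)[OF t] \<open>K \<ge> 0\<close> by (intro mult_right_mono) auto
    finally have "(norm (B (f t) (g t)))\<^sup>2 \<le> (C * norm (g t) * K)\<^sup>2"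
      by (intro power_mono) auto
    then show "(norm (B (f t) (g t)))\<^sup>2 \<le> (C * K)\<^sup>2 * (norm (g t))\<^sup>2"
      by (simp add: power_mult_distrib ac_simps)
  qed
qed

lemma square_diff_integrable:
  assumes "sqint M f" "sqint M g"
  shows "integrable M (\<lambda>t. (norm (f t - g t))\<^sup>2)"
  using sqint_diff[OF assms] by (simp add: sqint_def)

text \<open>The Riesz-Fischer theorem for the space of square-integrable functions. On a finite measure space
  a fast Cauchy subsequence has almost everywhere absolutely summable increments, and Fatou's
  lemma identifies its pointwise limit as the limit in mean square.\<close>
lemma L2_complete:
  fixes h :: "nat \<Rightarrow> 'a \<Rightarrow> 'b::euclidean_space"
  assumes fin: "finite_measure M" and h: "\<And>n. sqint M (h n)"
    and Cau: "\<And>e. e > 0 \<Longrightarrow> \<exists>N. \<forall>m\<ge>N. \<forall>n\<ge>N. (\<integral>t. (norm (h m t - h n t))\<^sup>2 \<partial>M) < e"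
  obtains \<rho> where "sqint M \<rho>" "(\<lambda>n. \<integral>t. (norm (h n t - \<rho> t))\<^sup>2 \<partial>M) \<longlonglongrightarrow> 0"
proof -
  interpret finite_measure M by fact
  have hm[measurable]: "h n \<in> borel_measurable M" for n using h sqint_measurable by blast
  have dint: "integrable M (\<lambda>t. (norm (h m t - h n t))\<^sup>2)" for m n
    by (intro square_diff_integrable h)
  have nn: "(\<integral>\<^sup>+t. ennreal ((norm (h m t - h n t))\<^sup>2) \<partial>M) = ennreal (\<integral>t. (norm (h m t - h n t))\<^sup>2 \<partial>M)" for m n
    by (rule nn_integral_eq_integral[OF dint]) auto
  have "\<forall>k. \<exists>N. \<forall>m\<ge>N. \<forall>n\<ge>N. (\<integral>t. (norm (h m t - h n t))\<^sup>2 \<partial>M) < (1/4)^k"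
    using Cau by (simp add: zero_less_power)
  then obtain N where N: "\<And>k m n. m \<ge> N k \<Longrightarrow> n \<ge> N k \<Longrightarrow> (\<integral>t. (norm (h m t - h n t))\<^sup>2 \<partial>M) < (1/4)^k"
    unfolding choice_iff by blast
  define r where "r k = Max (N ` {..k}) + k" for k
  have rN: "r k \<ge> N j" if "j \<le> k" for j k
    unfolding r_def using that by (intro trans_le_add1 Max_ge) auto
  have rk: "r k \<ge> k" for k unfolding r_def by simp
  define d where "d k t = norm (h (r (Suc k)) t - h (r k) t)" for k t
  have [measurable]: "d k \<in> borel_measurable M" for k unfolding d_def by measurable
  have d1: "(\<integral>\<^sup>+t. ennreal (d k t) \<partial>M) \<le> ennreal ((1/2)^k * (measure M (space M) + 1))" for k
  proof -
    have sq: "integrable M (\<lambda>t. (d k t)\<^sup>2)" unfolding d_def by (rule dint)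
    have dk: "(\<integral>t. (d k t)\<^sup>2 \<partial>M) < (1/4)^k"
      unfolding d_def by (rule N) (auto intro: rN)
    \<comment> \<open>Weighted Young inequality: the weight turns the mean-square bound \<open>4^(-k)\<close> into a summable bound in mean.\<close>
    have "2 * d k t \<le> 2^k * (d k t)\<^sup>2 + (1/2)^k" for t
    proof -
      have "0 \<le> 2^k * (d k t - (1/2)^k)\<^sup>2" by simp
      also have "\<dots> = 2^k * (d k t)\<^sup>2 - 2 * d k t * (2^k * (1/2)^k) + (2^k * (1/2)^k) * (1/2)^k"
        by (simp add: power2_eq_square algebra_simps)
      also have "2^k * (1/2)^k = (1::real)" by (simp flip: power_mult_distrib)
      finally show ?thesis by simp
    qed
    then have "d k t \<le> 2^k * (d k t)\<^sup>2 + (1/2)^k" for t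
      by (smt (verit) d_def norm_ge_zero)
    then have "(\<integral>\<^sup>+t. ennreal (d k t) \<partial>M) \<le> (\<integral>\<^sup>+t. ennreal (2^k * (d k t)\<^sup>2 + (1/2)^k) \<partial>M)"
      by (intro nn_integral_mono ennreal_leI) auto
    also have "\<dots> = ennreal (\<integral>t. 2^k * (d k t)\<^sup>2 + (1/2)^k \<partial>M)"
      using sq by (intro nn_integral_eq_integral) auto
    also have "\<dots> = ennreal (2^k * (\<integral>t. (d k t)\<^sup>2 \<partial>M) + (1/2)^k * measure M (space M))"
      using sq by (subst Bochner_Integration.integral_add) auto
    also have "\<dots> \<le> ennreal (2^k * (1/4)^k + (1/2)^k * measure M (space M))"
      by (intro ennreal_leI add_right_mono mult_left_mono)
        (use dk in auto)
    also have "\<dots> = ennreal ((1/2)^k * (measure M (space M) + 1))"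
      by (simp add: distrib_left flip: power_mult_distrib)
    finally show ?thesis .
  qed
  have "(\<integral>\<^sup>+t. (\<Sum>k. ennreal (d k t)) \<partial>M) = (\<Sum>k. \<integral>\<^sup>+t. ennreal (d k t) \<partial>M)"
    by (intro nn_integral_suminf) auto
  also have "\<dots> \<le> (\<Sum>k. ennreal ((1/2)^k * (measure M (space M) + 1)))"
    by (intro suminf_le d1) auto
  also have "\<dots> < \<infinity>"
  proof -
    have "summable (\<lambda>k. (1/2)^k * (measure M (space M) + 1) :: real)"
      by (intro summable_mult2 summable_geometric) auto
    then show ?thesis by (subst suminf_ennreal2) auto
  qed
  finally have "AE t in M. (\<Sum>k. ennreal (d k t)) \<noteq> \<infinity>"
    by (intro nn_integral_PInf_AE) auto
  then have conv: "AE t in M. convergent (\<lambda>k. h (r k) t)"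
  proof eventually_elim
    case (elim t)
    have "summable (\<lambda>k. d k t)"
      using elim by (intro summable_suminf_not_top) (auto simp: d_def)
    then have "summable (\<lambda>k. h (r (Suc k)) t - h (r k) t)"
      unfolding d_def by (rule summable_norm_cancel)
    then have "convergent (\<lambda>n. \<Sum>k<n. h (r (Suc k)) t - h (r k) t)"
      by (simp add: summable_iff_convergent)
    then have "convergent (\<lambda>n. h (r n) t - h (r 0) t)"
      using sum_lessThan_telescope[of "\<lambda>k. h (r k) t"] by simp
    then show ?case by (simp add: convergent_diff_const_right_iff)
  qed
  define \<rho> where "\<rho> t = lim (\<lambda>k. h (r k) t)" for t
  have [measurable]: "\<rho> \<in> borel_measurable M" unfolding \<rho>_def by measurable
  have Fat: "(\<integral>\<^sup>+t. ennreal ((norm (h n t - \<rho> t))\<^sup>2) \<partial>M) \<le> ennreal e"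
    if "e > 0" "\<And>m. m \<ge> K \<Longrightarrow> (\<integral>t. (norm (h n t - h m t))\<^sup>2 \<partial>M) < e" for n e K
  proof -
    have "AE t in M. ennreal ((norm (h n t - \<rho> t))\<^sup>2) = liminf (\<lambda>k. ennreal ((norm (h n t - h (r k) t))\<^sup>2))"
      using conv
    proof eventually_elim
      case (elim t)
      then have "(\<lambda>k. h (r k) t) \<longlonglongrightarrow> \<rho> t" unfolding \<rho>_def by (simp add: convergent_LIMSEQ_iff)
      then have "(\<lambda>k. ennreal ((norm (h n t - h (r k) t))\<^sup>2)) \<longlonglongrightarrow> ennreal ((norm (h n t - \<rho> t))\<^sup>2)"
        by (intro tendsto_intros)
      then show ?case using lim_imp_Liminf[OF sequentially_bot] by metis
    qed
    then have "(\<integral>\<^sup>+t. ennreal ((norm (h n t - \<rho> t))\<^sup>2) \<partial>M)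
       = (\<integral>\<^sup>+t. liminf (\<lambda>k. ennreal ((norm (h n t - h (r k) t))\<^sup>2)) \<partial>M)"
      by (rule nn_integral_cong_AE)
    also have "\<dots> \<le> liminf (\<lambda>k. \<integral>\<^sup>+t. ennreal ((norm (h n t - h (r k) t))\<^sup>2) \<partial>M)"
      by (rule nn_integral_liminf) measurable
    also have "\<dots> \<le> ennreal e"
    proof (rule Liminf_le)
      show "\<forall>\<^sub>F k in sequentially. (\<integral>\<^sup>+t. ennreal ((norm (h n t - h (r k) t))\<^sup>2) \<partial>M) \<le> ennreal e"
      proof (rule eventually_sequentiallyI[of K])
        fix k assume "k \<ge> K"
        then have "r k \<ge> K" using rk[of k] by linarith
        then show "(\<integral>\<^sup>+t. ennreal ((norm (h n t - h (r k) t))\<^sup>2) \<partial>M) \<le> ennreal e"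
          using that(2)[of "r k"] unfolding nn by (intro ennreal_leI) auto
      qed
    qed simp
    finally show ?thesis .
  qed
  have sqd: "sqint M (\<lambda>t. h n t - \<rho> t)" if "e > 0" "\<And>m. m \<ge> K \<Longrightarrow> (\<integral>t. (norm (h n t - h m t))\<^sup>2 \<partial>M) < e" for n e K
    unfolding sqint_def
  proof
    show "integrable M (\<lambda>t. (norm (h n t - \<rho> t))\<^sup>2)"
    proof (rule integrableI_bounded)
      show "(\<integral>\<^sup>+t. ennreal (norm ((norm (h n t - \<rho> t))\<^sup>2)) \<partial>M) < \<infinity>"
        using le_less_trans[OF Fat[of e K n] ennreal_less_top] that by simp
    qed measurable
  qed measurable
  obtain N1 where N1: "\<And>m n. m \<ge> N1 \<Longrightarrow> n \<ge> N1 \<Longrightarrow> (\<integral>t. (norm (h m t - h n t))\<^sup>2 \<partial>M) < 1"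
    using Cau[of 1] by auto
  have "sqint M (\<lambda>t. h N1 t - (h N1 t - \<rho> t))"
    by (intro sqint_diff h sqd[of 1 N1]) (auto intro: N1)
  then have \<rho>: "sqint M \<rho>" by simp
  moreover have "(\<lambda>n. \<integral>t. (norm (h n t - \<rho> t))\<^sup>2 \<partial>M) \<longlonglongrightarrow> 0"
  proof (rule LIMSEQ_I)
    fix e :: real assume "e > 0"
    then obtain K where K: "\<And>m n. m \<ge> K \<Longrightarrow> n \<ge> K \<Longrightarrow> (\<integral>t. (norm (h m t - h n t))\<^sup>2 \<partial>M) < e/2"
      using Cau[of "e/2"] by auto
    have "norm ((\<integral>t. (norm (h n t - \<rho> t))\<^sup>2 \<partial>M) - 0) < e" if "n \<ge> K" for n
    proof -
      have "ennreal (\<integral>t. (norm (h n t - \<rho> t))\<^sup>2 \<partial>M) \<le> ennreal (e/2)"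
        using Fat[of "e/2" K n] K that \<open>e > 0\<close>
        by (subst nn_integral_eq_integral[symmetric]) (auto intro!: square_diff_integrable h \<rho>)
      then have "(\<integral>t. (norm (h n t - \<rho> t))\<^sup>2 \<partial>M) \<le> e/2"
        using \<open>e > 0\<close> by (subst (asm) ennreal_le_iff) auto
      then show ?thesis using \<open>e > 0\<close>
        by (smt (verit) field_sum_of_halves integral_nonneg_AE AE_I2 real_norm_def zero_le_power2)
    qed
    then show "\<exists>no. \<forall>n\<ge>no. norm ((\<integral>t. (norm (h n t - \<rho> t))\<^sup>2 \<partial>M) - 0) < e" by blast
  qed
  ultimately show ?thesis by (rule that)
qed

text \<open>The residual of the orthogonal projection of \<open>h\<close> onto the closure of the subspace \<open>Y\<close>: a minimising
  sequence is Cauchy by the parallelogram law, and its limit is orthogonal to \<open>Y\<close>.\<close>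
lemma L2_orthogonal_residual:
  fixes h :: "'a \<Rightarrow> 'b::euclidean_space" and Y :: "('a \<Rightarrow> 'b) set"
  assumes fin: "finite_measure M" and h: "sqint M h" and Y: "\<And>g. g \<in> Y \<Longrightarrow> sqint M g"
    and Y0: "(\<lambda>t. 0) \<in> Y" and Yadd: "\<And>f g c. f \<in> Y \<Longrightarrow> g \<in> Y \<Longrightarrow> (\<lambda>t. f t + c *\<^sub>R g t) \<in> Y"
  obtains \<rho> where "sqint M \<rho>" "\<And>g. g \<in> Y \<Longrightarrow> (\<integral>t. \<rho> t \<bullet> g t \<partial>M) = 0"
    "\<And>e. e > 0 \<Longrightarrow> \<exists>g\<in>Y. (\<integral>t. (norm (h t - g t - \<rho> t))\<^sup>2 \<partial>M) < e"
proof -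
  define N2 where "N2 f = (\<integral>t. (norm (f t))\<^sup>2 \<partial>M)" for f :: "'a \<Rightarrow> 'b"
  have N2nn: "N2 f \<ge> 0" for f unfolding N2_def by simp
  have N2exp: "N2 (\<lambda>t. f t + c *\<^sub>R g t) = N2 f + 2 * c * (\<integral>t. f t \<bullet> g t \<partial>M) + c\<^sup>2 * N2 g"
    if "sqint M f" "sqint M g" for f g c
  proof -
    have "(norm (f t + c *\<^sub>R g t))\<^sup>2 = (norm (f t))\<^sup>2 + 2 * c * (f t \<bullet> g t) + c\<^sup>2 * (norm (g t))\<^sup>2" for t
      unfolding power2_norm_eq_inner by (simp add: algebra_simps inner_commute power2_eq_square)
    then show ?thesis
      unfolding N2_def using sqint_inner_integrable[OF that] that by (simp add: sqint_def)
  qed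
  define D where "D = (INF g\<in>Y. N2 (\<lambda>t. h t - g t))"
  have bdd: "bdd_below ((\<lambda>g. N2 (\<lambda>t. h t - g t)) ` Y)" by (intro bdd_belowI2[of _ 0] N2nn)
  have Dle: "D \<le> N2 (\<lambda>t. h t - g t)" if "g \<in> Y" for g
    unfolding D_def by (intro cINF_lower bdd that)
  have "\<exists>g\<in>Y. N2 (\<lambda>t. h t - g t) < D + 1 / (real n + 1)" for n
    using cINF_less_iff[OF _ bdd, of "D + 1 / (real n + 1)"] Y0 unfolding D_def by auto
  then obtain g where gY: "\<And>n. g n \<in> Y" and gD: "\<And>n. N2 (\<lambda>t. h t - g n t) < D + 1 / (real n + 1)"
    by metis
  have hg: "sqint M (\<lambda>t. h t - g n t)" for n by (intro sqint_diff h Y gY)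
  have est: "N2 (\<lambda>t. (h t - g m t) - (h t - g n t)) \<le> 2 * (1 / (real m + 1)) + 2 * (1 / (real n + 1))" for m n
  proof -
    have mid: "(\<lambda>t. ((\<lambda>t. 0) t + (1/2) *\<^sub>R g m t) + (1/2) *\<^sub>R g n t) \<in> Y"
      by (intro Yadd Y0 gY)
    have I: "integrable M (\<lambda>t. (norm (h t - g n t))\<^sup>2)" for n using hg by (simp add: sqint_def)
    have I2: "integrable M (\<lambda>t. (norm (h t - ((\<lambda>t. 0) t + (1/2) *\<^sub>R g m t + (1/2) *\<^sub>R g n t)))\<^sup>2)"
      using sqint_diff[OF h Y[OF mid]] by (simp add: sqint_def)
    have "(norm ((h t - g m t) - (h t - g n t)))\<^sup>2 = 2 * (norm (h t - g m t))\<^sup>2 + 2 * (norm (h t - g n t))\<^sup>2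
      - 4 * (norm (h t - ((\<lambda>t. 0) t + (1/2) *\<^sub>R g m t + (1/2) *\<^sub>R g n t)))\<^sup>2" for t
      unfolding power2_norm_eq_inner by (simp add: algebra_simps inner_commute)
    then have "N2 (\<lambda>t. (h t - g m t) - (h t - g n t)) = 2 * N2 (\<lambda>t. h t - g m t) + 2 * N2 (\<lambda>t. h t - g n t)
      - 4 * N2 (\<lambda>t. h t - ((\<lambda>t. 0) t + (1/2) *\<^sub>R g m t + (1/2) *\<^sub>R g n t))"
      unfolding N2_def using I I2 by simp
    also have "\<dots> \<le> 2 * (D + 1 / (real m + 1)) + 2 * (D + 1 / (real n + 1)) - 4 * D"
    proof -
      have "2 * a + 2 * b - 4 * c \<le> 2 * (D + p) + 2 * (D + q) - 4 * D"
        if "D \<le> c" "a < D + p" "b < D + q" for a b c p q :: real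
        using that by simp
      from this[OF Dle[OF mid] gD gD] show ?thesis .
    qed
    finally show ?thesis by simp
  qed
  obtain \<rho> where \<rho>: "sqint M \<rho>" and lim: "(\<lambda>n. \<integral>t. (norm ((h t - g n t) - \<rho> t))\<^sup>2 \<partial>M) \<longlonglongrightarrow> 0"
  proof (rule L2_complete[OF fin, of "\<lambda>n t. h t - g n t"])
    fix e :: real assume "e > 0"
    then obtain N where N: "1 / (real N + 1) < e / 4"
      using reals_Archimedean[of "e/4"] by (auto simp: inverse_eq_divide add.commute)
    have "1 / (real m + 1) < e / 4" if "m \<ge> N" for m
      using that by (intro le_less_trans[OF _ N] divide_left_mono) auto
    then have "N2 (\<lambda>t. (h t - g m t) - (h t - g n t)) < e" if "m \<ge> N" "n \<ge> N" for m n
      using order_le_less_trans[OF est[of m n], of e] that(1,2)[THEN \<open>\<And>m. m \<ge> N \<Longrightarrow> 1 / (real m + 1) < e / 4\<close>]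
      by simp
    then show "\<exists>N. \<forall>m\<ge>N. \<forall>n\<ge>N. (\<integral>t. (norm ((h t - g m t) - (h t - g n t)))\<^sup>2 \<partial>M) < e"
      unfolding N2_def by blast
  qed (use hg in auto)
  have ex: "\<exists>g\<in>Y. (\<integral>t. (norm (h t - g t - \<rho> t))\<^sup>2 \<partial>M) < e" if "e > 0" for e
    using order_tendstoD(2)[OF lim that] gY by (auto simp: eventually_sequentially)
  moreover have "(\<integral>t. \<rho> t \<bullet> f t \<partial>M) = 0" if "f \<in> Y" for f
  proof -
    let ?I = "\<lambda>n. \<integral>t. (h t - g n t) \<bullet> f t \<partial>M"
    define J where "J = (\<integral>t. \<rho> t \<bullet> f t \<partial>M)"
    have f: "sqint M f" using Y that .
    have lim0: "(\<lambda>n. 1 / (real n + 1)) \<longlonglongrightarrow> 0" using LIMSEQ_inverse_real_of_nat by (simp add: inverse_eq_divide add.commute)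
    have fin_n: "2 * c * ?I n \<le> 1 / (real n + 1) + c\<^sup>2 * N2 f" for c n
    proof -
      have "(\<lambda>t. g n t + c *\<^sub>R f t) \<in> Y" by (intro Yadd gY that)
      from Dle[OF this] have "D \<le> N2 (\<lambda>t. (h t - g n t) + (-c) *\<^sub>R f t)" by (simp add: algebra_simps)
      also have "\<dots> = N2 (\<lambda>t. h t - g n t) + 2 * (-c) * ?I n + (-c)\<^sup>2 * N2 f"
        by (rule N2exp[OF hg f])
      finally show ?thesis using gD[of n] by simp
    qed
    have dn: "2 * c * (J - ?I n) \<le> c\<^sup>2 * N2 f + N2 (\<lambda>t. (h t - g n t) - \<rho> t)" for c n
    proof -
      have "0 \<le> N2 (\<lambda>t. ((h t - g n t) - \<rho> t) + c *\<^sub>R f t)" by (rule N2nn)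
      also have "\<dots> = N2 (\<lambda>t. (h t - g n t) - \<rho> t) + 2 * c * (\<integral>t. ((h t - g n t) - \<rho> t) \<bullet> f t \<partial>M) + c\<^sup>2 * N2 f"
        by (rule N2exp[OF sqint_diff[OF hg \<rho>] f])
      also have "(\<integral>t. ((h t - g n t) - \<rho> t) \<bullet> f t \<partial>M) = ?I n - J"
        unfolding J_def using sqint_inner_integrable[OF hg f] sqint_inner_integrable[OF \<rho> f]
        by (simp add: inner_diff_left)
      finally show ?thesis by (simp add: algebra_simps)
    qed
    have key: "2 * c * J \<le> 2 * c\<^sup>2 * N2 f" for c
    proof -
      have le: "2 * c * J \<le> (1 / (real n + 1) + N2 (\<lambda>t. (h t - g n t) - \<rho> t)) + 2 * c\<^sup>2 * N2 f" for n
        using fin_n[of c n] dn[of c n] by (simp add: algebra_simps)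
      have "(\<lambda>n. (1 / (real n + 1) + N2 (\<lambda>t. (h t - g n t) - \<rho> t)) + 2 * c\<^sup>2 * N2 f) \<longlonglongrightarrow> (0 + 0) + 2 * c\<^sup>2 * N2 f"
        using lim by (intro tendsto_intros lim0) (simp add: N2_def)
      from LIMSEQ_le_const[OF this] le show ?thesis by auto
    qed
    have "J = 0"
    proof (rule ccontr)
      assume "J \<noteq> 0"
      define c where "c = J / (2 * (N2 f + 1))"
      have p: "N2 f + 1 > 0" using N2nn[of f] by linarith
      have "J = 2 * c * (N2 f + 1)" unfolding c_def using p by (simp add: field_simps)
      with key[of c] have "4 * c\<^sup>2 * (N2 f + 1) \<le> 2 * c\<^sup>2 * N2 f" by (simp add: power2_eq_square ac_simps)
      then have "2 * c\<^sup>2 * (N2 f + 2) \<le> 0" by (simp add: algebra_simps)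
      moreover have "c \<noteq> 0" using \<open>J \<noteq> 0\<close> p by (simp add: c_def)
      moreover have "N2 f + 2 > 0" using p by linarith
      ultimately show False by (smt (verit) mult_pos_pos zero_less_power2)
    qed
    then show ?thesis by (simp add: J_def)
  qed
  ultimately show ?thesis using that[OF \<rho>] by blast
qed

text \<open>A vector that is orthogonal to the orthogonal complement of \<open>Y\<close> lies in the closure of \<open>Y\<close>.\<close>
lemma L2_approx_by_subspace:
  fixes h :: "'a \<Rightarrow> 'b::euclidean_space" and Y :: "('a \<Rightarrow> 'b) set"
  assumes fin: "finite_measure M" and h: "sqint M h" and Y: "\<And>g. g \<in> Y \<Longrightarrow> sqint M g"
    and Y0: "(\<lambda>t. 0) \<in> Y" and Yadd: "\<And>f g c. f \<in> Y \<Longrightarrow> g \<in> Y \<Longrightarrow> (\<lambda>t. f t + c *\<^sub>R g t) \<in> Y"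
    and perp: "\<And>\<rho>. sqint M \<rho> \<Longrightarrow> (\<And>g. g \<in> Y \<Longrightarrow> (\<integral>t. \<rho> t \<bullet> g t \<partial>M) = 0) \<Longrightarrow> (\<integral>t. \<rho> t \<bullet> h t \<partial>M) = 0"
    and e: "e > 0"
  shows "\<exists>g\<in>Y. (\<integral>t. (norm (h t - g t))\<^sup>2 \<partial>M) < e"
proof -
  obtain \<rho> where \<rho>: "sqint M \<rho>" and orth: "\<And>g. g \<in> Y \<Longrightarrow> (\<integral>t. \<rho> t \<bullet> g t \<partial>M) = 0"
    and app: "\<And>e. e > 0 \<Longrightarrow> \<exists>g\<in>Y. (\<integral>t. (norm (h t - g t - \<rho> t))\<^sup>2 \<partial>M) < e"
    using L2_orthogonal_residual[of M h Y] fin h Y Y0 Yadd by blast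
  obtain g where g: "g \<in> Y" and le: "(\<integral>t. (norm (h t - g t - \<rho> t))\<^sup>2 \<partial>M) < e"
    using app[OF e] by blast
  have sd: "sqint M (\<lambda>t. h t - g t)" using sqint_diff[OF h Y[OF g]] .
  note I = sqint_inner_integrable
  have z: "(\<integral>t. \<rho> t \<bullet> (h t - g t) \<partial>M) = 0"
    using perp[OF \<rho> orth] orth[OF g] I[OF \<rho> h] I[OF \<rho> Y[OF g]] by (simp add: inner_diff_right)
  have "(norm (h t - g t))\<^sup>2 = (norm (h t - g t - \<rho> t))\<^sup>2 + 2 * (\<rho> t \<bullet> (h t - g t)) - (norm (\<rho> t))\<^sup>2" for t
    unfolding power2_norm_eq_inner by (simp add: algebra_simps inner_commute)
  then have "(\<integral>t. (norm (h t - g t))\<^sup>2 \<partial>M)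
    = (\<integral>t. (norm (h t - g t - \<rho> t))\<^sup>2 \<partial>M) + 2 * (\<integral>t. \<rho> t \<bullet> (h t - g t) \<partial>M) - (\<integral>t. (norm (\<rho> t))\<^sup>2 \<partial>M)"
    using square_diff_integrable[OF sd \<rho>] I[OF \<rho> sd] \<rho> by (simp add: sqint_def)
  then have "(\<integral>t. (norm (h t - g t))\<^sup>2 \<partial>M) \<le> (\<integral>t. (norm (h t - g t - \<rho> t))\<^sup>2 \<partial>M)"
    using z by simp
  then show ?thesis using g le by (intro bexI[of _ g]) linarith+
qed

section \<open>Square integrability on compact intervals\<close>

abbreviation leb :: "real \<Rightarrow> real measure" where
  "leb T \<equiv> lebesgue_on {0..T}"

lemma finite_measure_Icc: "finite_measure (lebesgue_on {a..b::real})"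
  by (intro finite_measure_lebesgue_on) auto

lemma AE_Icc_iff_negligible:
  "(AE t in lebesgue_on {a..b::real}. P t) \<longleftrightarrow> (\<exists>N. negligible N \<and> (\<forall>t\<in>{a..b}-N. P t))"
proof -
  have "(AE t in lebesgue_on {a..b}. P t) \<longleftrightarrow> (AE t in lebesgue. t \<in> {a..b} \<longrightarrow> P t)"
    by (simp add: AE_restrict_space_iff)
  also have "\<dots> \<longleftrightarrow> (\<exists>N. negligible N \<and> (\<forall>t\<in>{a..b}-N. P t))"
    unfolding eventually_ae_filter_negligible by (intro ex_cong1) auto
  finally show ?thesis .
qed

lemma sqint_Icc_integral:
  assumes "sqint (lebesgue_on {a..b::real}) f"
  shows "f integrable_on {a..b}" "(\<lambda>t. norm (f t)) integrable_on {a..b}" "(\<lambda>t. (norm (f t))\<^sup>2) integrable_on {a..b}"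
    "(LINT s|lebesgue_on {a..b}. f s) = integral {a..b} f"
  using sqint_integrable[OF finite_measure_Icc assms] sqint_integrable_norm[OF finite_measure_Icc assms] assms
  by (auto intro!: integrable_on_lebesgue_on lebesgue_integral_eq_integral simp: sqint_def)

lemma sqint_Icc_subset:
  fixes f :: "real \<Rightarrow> 'b::euclidean_space"
  assumes f: "sqint (lebesgue_on {a..b}) f" and sub: "{c..d} \<subseteq> {a..b}"
  shows "sqint (lebesgue_on {c..d}) f"
  unfolding sqint_def
proof
  show "f \<in> borel_measurable (lebesgue_on {c..d})"
    by (rule measurable_restrict_mono[OF sqint_measurable[OF f] sub])
  show "integrable (lebesgue_on {c..d}) (\<lambda>t. (norm (f t))\<^sup>2)"
    by (rule integrable_subinterval[OF _ sub]) (use f in \<open>auto simp: sqint_def\<close>)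
qed

lemma L2loc_Icc_iff: "L2loc {a..b} f \<longleftrightarrow> sqint (lebesgue_on {a..b}) f"
  using sqint_Icc_subset[of a b f] unfolding L2loc_def sqint_def by blast

lemma sqint_continuous_on:
  fixes f :: "real \<Rightarrow> 'b::euclidean_space"
  assumes "continuous_on {a..b} f"
  shows "sqint (lebesgue_on {a..b}) f"
  unfolding sqint_def
proof
  show "f \<in> borel_measurable (lebesgue_on {a..b})"
    using assms by (intro continuous_imp_measurable_on_sets_lebesgue) auto
  show "integrable (lebesgue_on {a..b}) (\<lambda>t. (norm (f t))\<^sup>2)"
    using assms by (intro continuous_imp_integrable_real continuous_intros)
qed

lemma sqint_continuous_bilinear:
  fixes B :: "'b::euclidean_space \<Rightarrow> 'c::euclidean_space \<Rightarrow> 'd::euclidean_space"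
  assumes B: "bounded_bilinear B" and f: "continuous_on {a..b} f"
    and g: "sqint (lebesgue_on {a..b::real}) g"
  shows "sqint (lebesgue_on {a..b}) (\<lambda>t. B (f t) (g t))"
proof -
  obtain C where "\<And>t. t \<in> {a..b} \<Longrightarrow> norm (f t) \<le> C"
    using compact_imp_bounded[OF compact_continuous_image[OF f compact_Icc]]
    unfolding bounded_iff by blast
  then show ?thesis
    using sqint_measurable[OF sqint_continuous_on[OF f]]
    by (intro sqint_bounded_bilinear[OF B _ _ g]) auto
qed

lemma sqint_cong:
  assumes "sqint M f" "\<And>t. t \<in> space M \<Longrightarrow> f t = g t"
  shows "sqint M g"
proof -
  have "g \<in> borel_measurable M"
    using measurable_cong[of M f g borel] assms sqint_measurable[OF assms(1)] by blast
  moreover have "integrable M (\<lambda>t. (norm (f t))\<^sup>2) \<longleftrightarrow> integrable M (\<lambda>t. (norm (g t))\<^sup>2)"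
    by (rule Bochner_Integration.integrable_cong) (auto simp: assms(2))
  ultimately show ?thesis using assms(1) by (simp add: sqint_def)
qed

lemma lebesgue_on_reflect_measurable:
  fixes f :: "real \<Rightarrow> 'b::euclidean_space"
  assumes "f \<in> borel_measurable (leb T)"
  shows "(\<lambda>t. f (T - t)) \<in> borel_measurable (leb T)"
proof -
  have 1: "(\<lambda>x. indicator {0..T} x *\<^sub>R f x) \<in> borel_measurable lebesgue"
    using assms by (simp add: borel_measurable_restrict_space_iff)
  have "(\<lambda>x::real. T + (\<Sum>j\<in>Basis. ((-1) * (x \<bullet> j)) *\<^sub>R j)) \<in> lebesgue \<rightarrow>\<^sub>M lebesgue"
    by (rule lebesgue_affine_measurable) auto
  then have "(\<lambda>x::real. T - x) \<in> lebesgue \<rightarrow>\<^sub>M lebesgue" by simp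
  from measurable_compose[OF this 1]
  have "(\<lambda>x. indicator {0..T} (T - x) *\<^sub>R f (T - x)) \<in> borel_measurable lebesgue" .
  also have "(\<lambda>x. indicator {0..T} (T - x) *\<^sub>R f (T - x)) = (\<lambda>x. indicator {0..T} x *\<^sub>R f (T - x))"
    by (auto simp: indicator_def fun_eq_iff)
  finally show ?thesis by (simp add: borel_measurable_restrict_space_iff)
qed

lemma has_integral_reflect_Icc:
  fixes f :: "real \<Rightarrow> 'b::banach"
  assumes "(f has_integral I) {T - b..T - a}" 
  shows "((\<lambda>t. f (T - t)) has_integral I) {a..b}"
proof -
  have "((\<lambda>x. f ((-1) *\<^sub>R x + T)) has_integral (1 / (\<bar>-1\<bar> ^ DIM(real))) *\<^sub>R I) ((\<lambda>x. (1 / -1) *\<^sub>R x + - ((1 / -1) *\<^sub>R T)) ` cbox (T - b) (T - a))"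
    using assms by (intro has_integral_affinity) auto
  moreover have "(\<lambda>x. (1 / -1) *\<^sub>R x + - ((1 / -1) *\<^sub>R T)) ` cbox (T - b) (T - a) = {a..b}"
    by (force simp: image_iff intro!: bexI[of _ "T - _"])
  ultimately show ?thesis by (simp add: algebra_simps)
qed

lemma integral_reflect_Icc:
  fixes f :: "real \<Rightarrow> 'b::banach"
  shows "integral {a..b} (\<lambda>t. f (T - t)) = integral {T - b..T - a} f"
proof (cases "f integrable_on {T - b..T - a}")
  case True
  then show ?thesis
    using has_integral_reflect_Icc[of f] by (metis integrable_integral integral_unique)
next
  case False
  have "\<not> (\<lambda>t. f (T - t)) integrable_on {a..b}"
  proof
    assume "(\<lambda>t. f (T - t)) integrable_on {a..b}"
    then have "((\<lambda>t. f (T - t)) has_integral integral {a..b} (\<lambda>t. f (T - t))) {T - (T - a)..T - (T - b)}"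
      by (simp add: integrable_integral)
    then have "((\<lambda>t. f (T - (T - t))) has_integral integral {a..b} (\<lambda>t. f (T - t))) {T - b..T - a}"
      by (rule has_integral_reflect_Icc)
    with False show False by auto
  qed
  with False show ?thesis by (simp add: not_integrable_integral)
qed

lemma sqint_reflect:
  fixes f :: "real \<Rightarrow> 'b::euclidean_space"
  assumes f: "sqint (leb T) f"
  shows "sqint (leb T) (\<lambda>t. f (T - t))"
  unfolding sqint_def
proof
  show m: "(\<lambda>t. f (T - t)) \<in> borel_measurable (leb T)"
    by (rule lebesgue_on_reflect_measurable[OF sqint_measurable[OF f]])
  have "(\<lambda>t. (norm (f (T - t)))\<^sup>2) integrable_on {0..T}"
    using has_integral_reflect_Icc[of "\<lambda>t. (norm (f t))\<^sup>2" _ T T 0] sqint_Icc_integral(3)[OF f]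
    by (auto simp: integrable_on_def)
  then have "(\<lambda>t. (norm (f (T - t)))\<^sup>2) absolutely_integrable_on {0..T}"
    by (intro nonnegative_absolutely_integrable_1) auto
  then show "integrable (leb T) (\<lambda>t. (norm (f (T - t)))\<^sup>2)"
    by (intro absolutely_integrable_imp_integrable) auto
qed

lemma negligible_reflect:
  fixes N :: "real set"
  assumes "negligible N"
  shows "negligible {t. T - t \<in> N}"
  unfolding negligible_def
proof (intro allI)
  fix a b :: real
  have "(indicat_real N has_integral 0) {T - b..T - a}"
    using assms unfolding negligible_def by (metis box_real(2))
  from has_integral_reflect_Icc[OF this]
  show "(indicat_real {t. T - t \<in> N} has_integral 0) (cbox a b)"
    by (simp add: indicator_def[abs_def])
qed

lemma AE_reflect:
  assumes "AE t in leb T. P t"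
  shows "AE t in lebesgue_on {0..T::real}. P (T - t)"
proof -
  obtain N where N: "negligible N" "\<And>t. t \<in> {0..T} - N \<Longrightarrow> P t"
    using assms unfolding AE_Icc_iff_negligible by blast
  have "negligible {t. T - t \<in> N}" by (rule negligible_reflect[OF N(1)])
  moreover have "P (T - t)" if "t \<in> {0..T} - {t. T - t \<in> N}" for t
    using that by (intro N(2)) auto
  ultimately show ?thesis unfolding AE_Icc_iff_negligible by blast
qed

lemma LINT_reflect:
  fixes f :: "real \<Rightarrow> real"
  assumes "integrable (leb T) f" "integrable (leb T) (\<lambda>t. f (T - t))"
  shows "(LINT t|leb T. f (T - t)) = (LINT t|leb T. f t)"
  using lebesgue_integral_eq_integral[OF assms(1)] lebesgue_integral_eq_integral[OF assms(2)]
    integral_reflect_Icc[of 0 T f T] by simp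

section \<open>Primitives of square-integrable functions\<close>

text \<open>\<open>f\<close> is a primitive on \<open>{0..T}\<close> of the square-integrable \<open>g\<close>; equivalently, \<open>f\<close> is absolutely continuous
  there with derivative \<open>g\<close> almost everywhere (\<open>AC_on_primitive\<close>, \<open>primitive_AC\<close>,
  \<open>primitive_has_derivative_AE\<close>). The integral form is the one in which solutions of the two DAEs
  are given, and the derivative form is the one that differentiates products.\<close>
definition primitive :: "real \<Rightarrow> (real \<Rightarrow> 'b::euclidean_space) \<Rightarrow> (real \<Rightarrow> 'b) \<Rightarrow> bool" where
  "primitive T f g \<longleftrightarrow> sqint (leb T) g \<and>
     (\<forall>t\<in>{0..T}. f t = f 0 + (LINT s|lebesgue_on {0..t}. g s))"

lemma primitive_sqint: "primitive T f g \<Longrightarrow> sqint (leb T) g"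
  by (simp add: primitive_def)

lemma primitive_increment:
  assumes p: "primitive T f g" and st: "0 \<le> s" "s \<le> t" "t \<le> T"
  shows "f t - f s = integral {s..t} g"
proof -
  have g: "sqint (leb T) g" using p by (rule primitive_sqint)
  have eq: "f u = f 0 + integral {0..u} g" if "u \<in> {0..T}" for u
  proof -
    have "{0..u} \<subseteq> {0..T}" using that by auto
    from sqint_Icc_integral(4)[OF sqint_Icc_subset[OF g this]]
    show ?thesis using p that unfolding primitive_def by metis
  qed
  have "integral {0..s} g + integral {s..t} g = integral {0..t} g"
    using st by (intro Henstock_Kurzweil_Integration.integral_combine
        sqint_Icc_integral(1)[OF sqint_Icc_subset[OF g]]) auto
  then show ?thesis using eq[of s] eq[of t] st by (simp add: algebra_simps)
qed

lemma primitiveI: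
  assumes "sqint (leb T) g" "\<And>t. t \<in> {0..T} \<Longrightarrow> f t = f 0 + integral {0..t} g"
  shows "primitive T f g"
  unfolding primitive_def
proof (intro conjI ballI assms(1))
  fix t assume "t \<in> {0..T}"
  then have "{0..t} \<subseteq> {0..T}" by auto
  from sqint_Icc_integral(4)[OF sqint_Icc_subset[OF assms(1) this]] assms(2)[OF \<open>t \<in> {0..T}\<close>]
  show "f t = f 0 + (LINT s|lebesgue_on {0..t}. g s)"
    by metis
qed

lemma primitive_AC:
  assumes p: "primitive T f g"
  shows "AC_on {0..T} f"
  unfolding AC_on_def
proof (intro allI impI)
  fix a b \<epsilon> :: real assume ab: "{a..b} \<subseteq> {0..T}" and e: "\<epsilon> > 0"
  have g: "sqint (leb T) g" using p by (rule primitive_sqint)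
  define K where "K = integral {0..T} (\<lambda>t. (norm (g t))\<^sup>2)"
  have K: "K \<ge> 0" unfolding K_def by (intro integral_nonneg sqint_Icc_integral g) auto
  define c where "c = \<epsilon> / (2 * (K + 1))"
  have c: "c > 0" "c * K < \<epsilon> / 2"
  proof -
    show "c > 0" using e K by (simp add: c_def)
    have "c * K < c * (K + 1)" using \<open>c > 0\<close> by simp
    also have "\<dots> = \<epsilon> / 2" using K by (simp add: c_def field_simps)
    finally show "c * K < \<epsilon> / 2" .
  qed
  show "\<exists>\<delta>>0. \<forall>D. D division_of \<Union>D \<and> \<Union>D \<subseteq> {a..b} \<and> (\<Sum>J\<in>D. Sup J - Inf J) < \<delta> \<longrightarrow>
        (\<Sum>J\<in>D. norm (f (Sup J) - f (Inf J))) < \<epsilon>"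
  proof (intro exI[of _ "c * \<epsilon> * 2"] conjI allI impI)
    show "c * \<epsilon> * 2 > 0" using c e by simp
    fix D assume D: "D division_of \<Union>D \<and> \<Union>D \<subseteq> {a..b} \<and> (\<Sum>J\<in>D. Sup J - Inf J) < c * \<epsilon> * 2"
    then have Ddiv: "D division_of \<Union>D" by blast
    have J: "\<exists>u v. J = {u..v} \<and> u \<le> v \<and> 0 \<le> u \<and> v \<le> T" if JD: "J \<in> D" for J
    proof -
      obtain u v where uv: "J = {u..v}" using division_ofD(4)[OF Ddiv JD] by (metis box_real(2))
      moreover have "u \<le> v" using division_ofD(3)[OF Ddiv JD] uv by auto
      moreover have "{u..v} \<subseteq> {0..T}" using D JD ab uv by blast
      ultimately show ?thesis by auto
    qed
    have gJ: "(\<lambda>t. (norm (g t))\<^sup>2) integrable_on J" if "J \<in> D" for J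
    proof -
      from J[OF that] obtain u v where "J = {u..v}" "{u..v} \<subseteq> {0..T}" by auto
      then show ?thesis using sqint_Icc_integral(3)[OF sqint_Icc_subset[OF g]] by auto
    qed
    have one: "norm (f (Sup J) - f (Inf J)) \<le> c * integral J (\<lambda>t. (norm (g t))\<^sup>2) + 1 / (4 * c) * (Sup J - Inf J)"
      if JD: "J \<in> D" for J
    proof -
      obtain u v where uv: "J = {u..v}" "u \<le> v" "0 \<le> u" "v \<le> T" using J[OF JD] by blast
      note gg = sqint_Icc_integral[OF sqint_Icc_subset[OF g, of u v]]
      have sub: "{u..v} \<subseteq> {0..T}" using uv by auto
      \<comment> \<open>Young's inequality bounds an increment of \<open>f\<close> by the mean-square mass and the length of the interval.\<close>
      have pw: "norm (g t) \<le> c * (norm (g t))\<^sup>2 + 1 / (4 * c)" for t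
      proof -
        have "0 \<le> c * (norm (g t) - 1 / (2 * c))\<^sup>2" using c by simp
        also have "\<dots> = c * (norm (g t))\<^sup>2 - norm (g t) + 1 / (4 * c)"
          using c by (simp add: power2_eq_square field_simps)
        finally show ?thesis by simp
      qed
      have "f v - f u = integral {u..v} g" by (rule primitive_increment[OF p uv(3,2,4)])
      also have "norm \<dots> \<le> integral {u..v} (\<lambda>t. c * (norm (g t))\<^sup>2 + 1 / (4 * c))"
        by (rule integral_norm_bound_integral[OF gg(1)[OF sub] _ pw])
           (intro Henstock_Kurzweil_Integration.integrable_add integrable_on_mult_right gg(3)[OF sub] integrable_const_ivl)
      also have "\<dots> = c * integral {u..v} (\<lambda>t. (norm (g t))\<^sup>2) + 1 / (4 * c) * (v - u)"
        using gg(3)[OF sub] uv(2) by (subst Henstock_Kurzweil_Integration.integral_add) (auto intro!: integrable_on_mult_right)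
      finally show ?thesis using uv(1,2) by simp
    qed
    have "(\<Sum>J\<in>D. norm (f (Sup J) - f (Inf J))) \<le> (\<Sum>J\<in>D. c * integral J (\<lambda>t. (norm (g t))\<^sup>2) + 1 / (4 * c) * (Sup J - Inf J))"
      by (intro sum_mono one)
    also have "\<dots> = c * integral (\<Union>D) (\<lambda>t. (norm (g t))\<^sup>2) + 1 / (4 * c) * (\<Sum>J\<in>D. Sup J - Inf J)"
      using integral_combine_division_bottomup[OF Ddiv gJ]
      by (simp add: sum.distrib sum_distrib_left del: One_nat_def)
    also have "\<dots> \<le> c * K + 1 / (4 * c) * (c * \<epsilon> * 2)"
    proof (intro add_mono mult_left_mono)
      show "integral (\<Union>D) (\<lambda>t. (norm (g t))\<^sup>2) \<le> K"
        unfolding K_def using D ab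
        by (intro integral_subset_le integrable_combine_division[OF Ddiv gJ] sqint_Icc_integral(3)[OF g]) auto
    qed (use D c in auto)
    also have "1 / (4 * c) * (c * \<epsilon> * 2) = \<epsilon> / 2" using c by simp
    also have "c * K + \<epsilon> / 2 < \<epsilon>" using c by simp
    finally show "(\<Sum>J\<in>D. norm (f (Sup J) - f (Inf J))) < \<epsilon>" .
  qed
qed

lemma AC_on_continuous_on:
  assumes "AC_on {a..b::real} f"
  shows "continuous_on {a..b} f"
  unfolding continuous_on_iff
proof (intro ballI allI impI)
  fix x e :: real assume x: "x \<in> {a..b}" and e: "0 < e"
  obtain \<delta> where "\<delta> > 0" and \<delta>: "\<And>D. D division_of \<Union>D \<Longrightarrow> \<Union>D \<subseteq> {a..b} \<Longrightarrow> (\<Sum>J\<in>D. Sup J - Inf J) < \<delta> \<Longrightarrow>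
      (\<Sum>J\<in>D. norm (f (Sup J) - f (Inf J))) < e"
    using assms[unfolded AC_on_def, rule_format, OF subset_refl e] by blast
  have "dist (f y) (f z) < e" if "y \<in> {a..b}" "z \<in> {a..b}" "dist y z < \<delta>" "y \<le> z" for y z
  proof -
    have "{cbox y z} division_of (cbox y z)" using that(4) by (intro division_of_self) auto
    then have "{{y..z}} division_of \<Union>{{y..z}}" by simp
    from \<delta>[OF this] that show ?thesis by (auto simp: dist_norm norm_minus_commute)
  qed
  then have "dist (f y) (f x) < e" if "y \<in> {a..b}" "dist y x < \<delta>" for y
    using that x by (cases "y \<le> x") (auto simp: dist_commute, metis dist_commute)
  then show "\<exists>d>0. \<forall>y\<in>{a..b}. dist y x < d \<longrightarrow> dist (f y) (f x) < e"
    using \<open>\<delta> > 0\<close> by blast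
qed

text \<open>The fundamental theorem of calculus for absolutely continuous functions, proved with the gauge
  integral. At points where \<open>f\<close> is differentiable, a fine interval contributes little to the error, as in
  the classical proof. The remaining points form a null set; tagged intervals there lie in an open set of
  small measure, so absolute continuity bounds the sum of the increments of \<open>f\<close> over them.\<close>
lemma AC_on_fundamental_theorem:
  fixes f :: "real \<Rightarrow> 'b::euclidean_space"
  assumes ab: "a \<le> b" and AC: "AC_on {a..b} f"
    and deriv: "AE t in lebesgue_on {a..b}. (f has_vector_derivative g t) (at t within {a..b})"
  shows "(g has_integral f b - f a) {a..b}"
proof -
  obtain N where N: "negligible N"
    and dN: "\<And>t. t \<in> {a..b} - N \<Longrightarrow> (f has_vector_derivative g t) (at t within {a..b})"
    using deriv unfolding AE_Icc_iff_negligible by blast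
  define g' where "g' t = (if t \<in> N then 0 else g t)" for t
  have "(g' has_integral f b - f a) {a..b}"
    unfolding has_integral_real
  proof (intro allI impI)
    fix e :: real assume e: "e > 0"
    define c where "c = e / (2 * (b - a + 1))"
    have c: "c > 0" "c * (b - a) < e / 2"
    proof -
      show "c > 0" using e ab by (simp add: c_def)
      have "c * (b - a) < c * (b - a + 1)" using \<open>c > 0\<close> by simp
      also have "\<dots> = e / 2" using ab by (simp add: c_def field_simps)
      finally show "c * (b - a) < e / 2" .
    qed
    have "e / 2 > 0" using e by simp
    from AC[unfolded AC_on_def, rule_format, OF subset_refl this]
    obtain \<delta> where "\<delta> > 0" and \<delta>: "\<And>D. D division_of \<Union>D \<Longrightarrow> \<Union>D \<subseteq> {a..b} \<Longrightarrow> (\<Sum>J\<in>D. Sup J - Inf J) < \<delta> \<Longrightarrow>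
        (\<Sum>J\<in>D. norm (f (Sup J) - f (Inf J))) < e / 2"
      by blast
    obtain U where U: "open U" "N \<subseteq> U" "U \<in> lmeasurable" "measure lebesgue U < \<delta>"
    proof -
      have "N \<in> sets lebesgue" using N by (rule negligible_imp_sets)
      from sets_lebesgue_outer_open[OF this \<open>\<delta> > 0\<close>]
      obtain U where U: "open U" "N \<subseteq> U" "U - N \<in> lmeasurable" "emeasure lebesgue (U - N) < ennreal \<delta>"
        by blast
      have nn: "negligible ((U - N) - U \<union> (U - (U - N)))"
        by (rule negligible_subset[OF N]) auto
      have Um: "U \<in> lmeasurable"
        using lmeasurable_negligible_symdiff[OF U(3) nn] .
      have "measure lebesgue U = measure lebesgue (U - N)"
        by (rule measure_negligible_symdiff[OF U(3) nn])
      also have "\<dots> < \<delta>"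
        using U(3,4) \<open>\<delta> > 0\<close> by (simp add: emeasure_eq_measure2 ennreal_less_iff)
      finally show ?thesis using that U Um by blast
    qed
    have "\<forall>x. \<exists>d>0. (x \<in> N \<longrightarrow> ball x d \<subseteq> U) \<and> (x \<in> {a..b} - N \<longrightarrow>
        (\<forall>y\<in>{a..b}. norm (y - x) < d \<longrightarrow> norm (f y - f x - (y - x) *\<^sub>R g x) \<le> c * norm (y - x)))"
    proof
      fix x
      consider "x \<in> N" | "x \<in> {a..b} - N" | "x \<notin> N" "x \<notin> {a..b}" by blast
      then show "\<exists>d>0. (x \<in> N \<longrightarrow> ball x d \<subseteq> U) \<and> (x \<in> {a..b} - N \<longrightarrow>
        (\<forall>y\<in>{a..b}. norm (y - x) < d \<longrightarrow> norm (f y - f x - (y - x) *\<^sub>R g x) \<le> c * norm (y - x)))"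
      proof cases
        case 1
        then have "x \<in> U" using U(2) by blast
        then obtain d where "d > 0" "ball x d \<subseteq> U" using U(1) open_contains_ball by blast
        then show ?thesis using 1 by blast
      next
        case 2
        from dN[OF 2] c(1) 2 show ?thesis
          unfolding has_vector_derivative_def has_derivative_within_alt by blast
      next
        case 3
        then show ?thesis by (intro exI[of _ 1]) auto
      qed
    qed
    then obtain d where d0: "\<And>x. d x > 0" and dU: "\<And>x. x \<in> N \<Longrightarrow> ball x (d x) \<subseteq> U"
      and dd: "\<And>x y. \<lbrakk>x \<in> {a..b} - N; y \<in> {a..b}; norm (y - x) < d x\<rbrakk>
                        \<Longrightarrow> norm (f y - f x - (y - x) *\<^sub>R g x) \<le> c * norm (y - x)"
      by metis
    show "\<exists>\<gamma>. gauge \<gamma> \<and> (\<forall>p. p tagged_division_of {a..b} \<and> \<gamma> fine p \<longrightarrow>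
        norm ((\<Sum>(x, k)\<in>p. measure lborel k *\<^sub>R g' x) - (f b - f a)) < e)"
    proof (intro exI[of _ "\<lambda>x. ball x (d x)"] conjI allI impI)
      show "gauge (\<lambda>x. ball x (d x))" using d0 by (intro gauge_ball_dependent) auto
      fix p assume p: "p tagged_division_of {a..b} \<and> (\<lambda>x. ball x (d x)) fine p"
      then have ptag: "p tagged_division_of {a..b}" and finep: "(\<lambda>x. ball x (d x)) fine p" by auto
      have finp: "finite p" using ptag by blast
      have fba: "f b - f a = (\<Sum>(x,K)\<in>p. f (Sup K) - f (Inf K))" "b - a = (\<Sum>(x,K)\<in>p. Sup K - Inf K)"
        using additive_tagged_division_1[OF ab, of p f] additive_tagged_division_1[OF ab, of p "\<lambda>x. x"] ptag by auto
      define pN where "pN = {(x,K) \<in> p. x \<in> N}"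
      have sub: "pN \<subseteq> p" by (auto simp: pN_def)
      have shape: "\<exists>u v. K = {u..v} \<and> u \<le> v \<and> x \<in> K \<and> {u..v} \<subseteq> {a..b}" if xK: "(x,K) \<in> p" for x K
      proof -
        have "x \<in> K" "K \<subseteq> {a..b}" using ptag xK by blast+
        moreover obtain u v where "K = cbox u v" using ptag xK by blast
        ultimately show ?thesis by (intro exI[of _ u] exI[of _ v]) auto
      qed
      have good: "norm (measure lborel K *\<^sub>R g' x - (f (Sup K) - f (Inf K))) \<le> c * (Sup K - Inf K)"
        if xK: "(x, K) \<in> p - pN" for x K
      proof -
        obtain u v where k: "K = {u..v}" "u \<le> v" "x \<in> K" "{u..v} \<subseteq> {a..b}" using shape xK by blast
        have xN: "x \<notin> N" "x \<in> {a..b}" using xK k by (auto simp: pN_def)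
        have "K \<subseteq> ball x (d x)" using finep xK by (auto simp: fine_def)
        then have bu: "norm (u - x) < d x" and bv: "norm (v - x) < d x"
          using subsetD[of K "ball x (d x)" u] subsetD[of K "ball x (d x)" v] k
          by (auto simp: dist_real_def abs_minus_commute)
        have "norm ((v - u) *\<^sub>R g x - (f v - f u)) = norm ((f u - f x - (u - x) *\<^sub>R g x) - (f v - f x - (v - x) *\<^sub>R g x))"
          by (simp add: algebra_simps)
        also have "\<dots> \<le> norm (f u - f x - (u - x) *\<^sub>R g x) + norm (f v - f x - (v - x) *\<^sub>R g x)"
          by (rule norm_triangle_ineq4)
        also have "\<dots> \<le> c * norm (u - x) + c * norm (v - x)"
          using xN k bu bv by (intro add_mono dd) auto
        also have "\<dots> = c * (v - u)" using k by (auto simp: algebra_simps)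
        finally show ?thesis using k(1,2) xN by (simp add: g'_def)
      qed
      have bad: "(\<Sum>(x,K)\<in>pN. norm (f (Sup K) - f (Inf K))) < e / 2"
      proof -
        have pp: "pN tagged_partial_division_of {a..b}"
          using tagged_partial_division_subset[OF _ sub] ptag by (auto simp: tagged_division_of_def)
        have div: "snd ` pN division_of \<Union>(snd ` pN)"
          by (rule partial_division_of_tagged_division[OF pp])
        have tag: "pN tagged_division_of \<Union>(snd ` pN)"
          by (rule tagged_partial_division_of_Union_self[OF pp])
        have shapeD: "\<exists>u v. J = {u..v} \<and> u \<le> v \<and> {u..v} \<subseteq> {a..b} \<and> {u..v} \<subseteq> U" if JD: "J \<in> snd ` pN" for J
        proof -
          obtain x where x: "(x, J) \<in> pN" using JD by auto
          obtain u v where k: "J = {u..v}" "u \<le> v" "{u..v} \<subseteq> {a..b}" using shape x sub by blast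
          have "J \<subseteq> ball x (d x)" using finep x sub by (auto simp: fine_def)
          also have "\<dots> \<subseteq> U" using dU x by (auto simp: pN_def)
          finally show ?thesis using k by blast
        qed
        have eq: "(\<Sum>(x,K)\<in>pN. norm (f (Sup K) - f (Inf K))) = (\<Sum>J\<in>snd ` pN. norm (f (Sup J) - f (Inf J)))"
        proof -
          \<comment> \<open>\<open>Sup {}\<close> and \<open>Inf {}\<close> are unspecified, so the empty interval is given the value 0 explicitly.\<close>
          define \<phi> where "\<phi> J = (if J = {} then 0 else norm (f (Sup J) - f (Inf J)))" for J
          have "(\<Sum>(x,K)\<in>pN. \<phi> K) = (\<Sum>J\<in>snd ` pN. \<phi> J)"
          proof (rule sum.over_tagged_division_lemma[OF tag])
            fix u v :: real assume "box u v = {}"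
            then show "\<phi> (cbox u v) = 0" by (cases "u = v") (auto simp: \<phi>_def)
          qed
          moreover have "\<phi> J = norm (f (Sup J) - f (Inf J))" if "J \<in> snd ` pN" for J
            using shapeD[OF that] by (auto simp: \<phi>_def)
          ultimately show ?thesis by (force simp: split_def intro: sum.cong)
        qed
        have "(\<Sum>J\<in>snd ` pN. Sup J - Inf J) = (\<Sum>J\<in>snd ` pN. measure lborel J)"
          using shapeD by (intro sum.cong) force+
        also have "\<dots> = measure lebesgue (\<Union>(snd ` pN))"
        proof -
          have "measure lborel J = measure lebesgue J" if "J \<in> snd ` pN" for J
            using shapeD[OF that] by auto
          then show ?thesis using content_division[OF div] by simp
        qed
        also have "\<dots> \<le> measure lebesgue U"
          using shapeD U(3) fmeasurableD[OF lmeasurable_division[OF div]]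
          by (intro measure_mono_fmeasurable) blast+
        also have "\<dots> < \<delta>" by fact
        finally show ?thesis
          unfolding eq using shapeD by (intro \<delta> div) force+
      qed
      have bad0: "norm (measure lborel K *\<^sub>R g' x - (f (Sup K) - f (Inf K))) = norm (f (Sup K) - f (Inf K))"
        if "(x,K) \<in> pN" for x K
        using that by (simp add: pN_def g'_def norm_minus_commute)
      have "(\<Sum>(x, k)\<in>p. measure lborel k *\<^sub>R g' x) - (f b - f a)
          = (\<Sum>(x, K)\<in>p. measure lborel K *\<^sub>R g' x - (f (Sup K) - f (Inf K)))"
        unfolding fba by (simp add: split_def sum_subtractf)
      also have "\<dots> = (\<Sum>(x, K)\<in>p - pN. measure lborel K *\<^sub>R g' x - (f (Sup K) - f (Inf K)))
          + (\<Sum>(x, K)\<in>pN. measure lborel K *\<^sub>R g' x - (f (Sup K) - f (Inf K)))"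
        by (rule sum.subset_diff[OF sub finp])
      also have "norm \<dots> \<le> (\<Sum>(x,K)\<in>p - pN. c * (Sup K - Inf K)) + (\<Sum>(x,K)\<in>pN. norm (f (Sup K) - f (Inf K)))"
        by (intro order_trans[OF norm_triangle_ineq] add_mono sum_norm_le) (auto simp: bad0 intro: good)
      also have "(\<Sum>(x,K)\<in>p - pN. c * (Sup K - Inf K)) \<le> (\<Sum>(x,K)\<in>p. c * (Sup K - Inf K))"
        using shape c(1) finp by (intro sum_mono2) force+
      also have "(\<Sum>(x,K)\<in>p. c * (Sup K - Inf K)) = c * (b - a)"
        unfolding fba by (simp add: split_def sum_distrib_left)
      finally show "norm ((\<Sum>(x, k)\<in>p. measure lborel k *\<^sub>R g' x) - (f b - f a)) < e"
        using bad c(2) by linarith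
    qed
  qed
  then show ?thesis
    by (rule has_integral_spike[OF N, rotated]) (simp add: g'_def)
qed

lemma integral_right_difference_quotient:
  fixes g :: "real \<Rightarrow> 'b::euclidean_space"
  assumes "\<And>a b. g integrable_on {a..b}"
  shows "\<exists>N. negligible N \<and> (\<forall>x. x \<notin> N \<longrightarrow> (\<forall>e>0. \<exists>d>0. \<forall>h. 0 < h \<and> h < d \<longrightarrow>
     norm (integral {x..x + h} g - h *\<^sub>R g x) \<le> e * h))"
proof -
  obtain N where N: "negligible N" "\<And>x e. \<lbrakk>x \<notin> N; 0 < e\<rbrakk> \<Longrightarrow> \<exists>d>0. \<forall>h. 0 < h \<and> h < d \<longrightarrow>
      norm (integral (cbox x (x + h *\<^sub>R One)) g /\<^sub>R h ^ DIM(real) - g x) < e"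
    using integrable_ccontinuous_explicit[of g] assms by (metis box_real(2))
  have "norm (integral {x..x + h} g - h *\<^sub>R g x) \<le> e * h"
    if "norm (integral (cbox x (x + h *\<^sub>R One)) g /\<^sub>R h ^ DIM(real) - g x) < e" "0 < h" for x h e
  proof -
    have "norm (integral {x..x + h} g - h *\<^sub>R g x) = norm (h *\<^sub>R (integral {x..x + h} g /\<^sub>R h - g x))"
      using that(2) by (simp add: algebra_simps)
    also have "\<dots> = h * norm (integral {x..x + h} g /\<^sub>R h - g x)" using that(2) by simp
    also have "\<dots> \<le> h * e" using that by (intro mult_left_mono) auto
    finally show ?thesis by (simp add: mult.commute)
  qed
  with N show ?thesis by metis
qed

text \<open>Lebesgue's differentiation theorem on the line. The left difference quotients are the right ones of
  the reflected function.\<close>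
lemma primitive_has_derivative_AE:
  fixes g :: "real \<Rightarrow> 'b::euclidean_space"
  assumes p: "primitive T f g"
  shows "AE t in leb T. (f has_vector_derivative g t) (at t within {0..T})"
proof -
  define g0 where "g0 t = (if t \<in> {0..T} then g t else 0)" for t
  have "g integrable_on {0..T}" by (intro sqint_Icc_integral primitive_sqint[OF p])
  then have "g0 integrable_on UNIV" unfolding g0_def by (subst integrable_restrict_UNIV)
  then have int: "g0 integrable_on {a..b}" for a b
    using integrable_on_subcbox[of g0 UNIV a b] by simp
  have intr: "(\<lambda>t. g0 (- t)) integrable_on {a..b}" for a b
    using has_integral_reflect_Icc[of g0 _ 0 b a] int[of "-b" "-a"] by (auto simp: integrable_on_def)
  obtain N1 where N1: "negligible N1" and d1: "\<And>x e. x \<notin> N1 \<Longrightarrow> 0 < e \<Longrightarrow> \<exists>d>0. \<forall>h. 0 < h \<and> h < d \<longrightarrow>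
     norm (integral {x..x + h} g0 - h *\<^sub>R g0 x) \<le> e * h"
    using integral_right_difference_quotient[OF int] by blast
  obtain N2 where N2: "negligible N2" and d2: "\<And>x e. x \<notin> N2 \<Longrightarrow> 0 < e \<Longrightarrow> \<exists>d>0. \<forall>h. 0 < h \<and> h < d \<longrightarrow>
     norm (integral {x..x + h} (\<lambda>t. g0 (- t)) - h *\<^sub>R g0 (- x)) \<le> e * h"
    using integral_right_difference_quotient[OF intr] by blast
  have N3: "negligible {t. - t \<in> N2}" using negligible_reflect[OF N2, of 0] by simp
  have inc: "f y - f x = integral {x..y} g0" if "0 \<le> x" "x \<le> y" "y \<le> T" for x y
    unfolding primitive_increment[OF p that] using that
    by (intro integral_cong) (auto simp: g0_def)
  have "(f has_vector_derivative g x) (at x within {0..T})"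
    if xT: "x \<in> {0..T}" and xN: "x \<notin> N1 \<union> {t. - t \<in> N2}" for x
    unfolding has_vector_derivative_def has_derivative_within_alt
  proof (intro conjI allI impI bounded_linear_scaleR_left)
    fix e :: real assume e: "0 < e"
    obtain \<delta>1 where \<delta>1: "\<delta>1 > 0" "\<And>h. 0 < h \<Longrightarrow> h < \<delta>1 \<Longrightarrow> norm (integral {x..x + h} g0 - h *\<^sub>R g0 x) \<le> e * h"
      using d1[of x e] xN e by blast
    obtain \<delta>2 where \<delta>2: "\<delta>2 > 0" "\<And>h. 0 < h \<Longrightarrow> h < \<delta>2 \<Longrightarrow> norm (integral {- x..- x + h} (\<lambda>t. g0 (- t)) - h *\<^sub>R g0 x) \<le> e * h"
      using d2[of "-x" e] xN e by auto
    have "norm (f y - f x - (y - x) *\<^sub>R g x) \<le> e * norm (y - x)"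
      if y: "y \<in> {0..T}" "norm (y - x) < min \<delta>1 \<delta>2" for y
    proof -
      consider "y = x" | "x < y" | "y < x" by linarith
      then show ?thesis
      proof cases
        case 1 then show ?thesis by simp
      next
        case 2
        then have "f y - f x = integral {x..x + (y - x)} g0" using inc[of x y] xT y by simp
        moreover have "norm (integral {x..x + (y - x)} g0 - (y - x) *\<^sub>R g0 x) \<le> e * (y - x)"
          using 2 y by (intro \<delta>1) auto
        ultimately show ?thesis using 2 xT by (simp add: g0_def)
      next
        case 3
        then have "f x - f y = integral {y..x} g0" using inc[of y x] xT y by simp
        also have "\<dots> = integral {- x..- x + (x - y)} (\<lambda>t. g0 (- t))"
          using integral_reflect_Icc[of "-x" "-x + (x - y)" g0 0] by simp
        finally have "norm (f x - f y - (x - y) *\<^sub>R g0 x) \<le> e * (x - y)"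
          using \<delta>2(2)[of "x - y"] 3 y by simp
        moreover have "f y - f x - (y - x) *\<^sub>R g x = - (f x - f y - (x - y) *\<^sub>R g0 x)"
          using xT by (simp add: g0_def algebra_simps)
        ultimately have "norm (f y - f x - (y - x) *\<^sub>R g x) \<le> e * (x - y)" by (metis norm_minus_cancel)
        then show ?thesis using 3 by (simp add: abs_minus_commute)
      qed
    qed
    then show "\<exists>d>0. \<forall>y\<in>{0..T}. norm (y - x) < d \<longrightarrow> norm (f y - f x - (y - x) *\<^sub>R g x) \<le> e * norm (y - x)"
      using \<delta>1(1) \<delta>2(1) by (intro exI[of _ "min \<delta>1 \<delta>2"]) auto
  qed
  then show ?thesis
    unfolding AE_Icc_iff_negligible using negligible_Un[OF N1 N3] by blast
qed

lemma AC_on_subset: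
  assumes "AC_on I f" "J \<subseteq> I"
  shows "AC_on J f"
  unfolding AC_on_def
proof (intro allI impI)
  fix a b \<epsilon> :: real assume "{a..b} \<subseteq> J" "\<epsilon> > 0"
  with assms(2) have "{a..b} \<subseteq> I" "\<epsilon> > 0" by auto
  from assms(1)[unfolded AC_on_def, rule_format, OF this]
  show "\<exists>\<delta>>0. \<forall>D. D division_of \<Union>D \<and> \<Union>D \<subseteq> {a..b} \<and> (\<Sum>J\<in>D. Sup J - Inf J) < \<delta> \<longrightarrow>
      (\<Sum>J\<in>D. norm (f (Sup J) - f (Inf J))) < \<epsilon>" by blast
qed

lemma AC_on_primitive:
  fixes f :: "real \<Rightarrow> 'b::euclidean_space"
  assumes AC: "AC_on {0..T} f" and g: "sqint (leb T) g"
    and deriv: "AE t in leb T. (f has_vector_derivative g t) (at t within {0..T})"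
  shows "primitive T f g"
proof (rule primitiveI[OF g])
  fix t assume t: "t \<in> {0..T}"
  have AC': "AC_on {0..t} f" by (rule AC_on_subset[OF AC]) (use t in auto)
  have "AE s in lebesgue_on {0..t}. (f has_vector_derivative g s) (at s within {0..t})"
    using deriv t unfolding AE_Icc_iff_negligible
    by (auto intro!: has_vector_derivative_within_subset[of f _ _ "{0..T}" "{0..t}"])
  from AC_on_fundamental_theorem[OF _ AC' this] t
  show "f t = f 0 + integral {0..t} g" by (auto simp: integral_unique)
qed

lemma primitive_unique:
  assumes T: "0 < T" and "primitive T f g" "primitive T f h"
  shows "AE t in leb T. g t = h t"
  using primitive_has_derivative_AE[OF assms(2)] primitive_has_derivative_AE[OF assms(3)]
proof (elim AE_mp, intro AE_I2 impI)
  fix t assume t: "t \<in> space (leb T)"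
    and d: "(f has_vector_derivative g t) (at t within {0..T})" "(f has_vector_derivative h t) (at t within {0..T})"
  have "at t within {0..T} \<noteq> bot" using t T at_within_Icc_at[of 0 t T]
    by (simp add: trivial_limit_within islimpt_Icc)
  from vector_derivative_unique_within[OF this d] show "g t = h t" .
qed

lemma C1_primitive:
  fixes f :: "real \<Rightarrow> 'b::euclidean_space"
  assumes "\<And>t. t \<in> {0..T} \<Longrightarrow> (f has_vector_derivative g t) (at t within {0..T})" "continuous_on {0..T} g"
  shows "primitive T f g"
proof (rule primitiveI)
  show "sqint (leb T) g" by (intro sqint_continuous_on assms)
  fix t assume t: "t \<in> {0..T}"
  have "(g has_integral f t - f 0) {0..t}"
    using t by (intro fundamental_theorem_of_calculus)
      (auto intro: has_vector_derivative_within_subset[OF assms(1)])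
  then show "f t = f 0 + integral {0..t} g" by (simp add: integral_unique)
qed

lemma AC_on_bilinear:
  fixes f :: "real \<Rightarrow> 'b::euclidean_space" and g :: "real \<Rightarrow> 'c::euclidean_space"
    and B :: "'b \<Rightarrow> 'c \<Rightarrow> 'd::euclidean_space"
  assumes B: "bounded_bilinear B" and f: "AC_on {0..T} f" and g: "AC_on {0..T} g"
  shows "AC_on {0..T} (\<lambda>t. B (f t) (g t))"
  unfolding AC_on_def
proof (intro allI impI)
  interpret bounded_bilinear B by fact
  fix a b e :: real assume ab: "{a..b} \<subseteq> {0..T}" and e: "e > 0"
  obtain K where K: "\<And>x y. norm (B x y) \<le> norm x * norm y * K" and "K > 0" using pos_bounded by blast
  have bd: "\<exists>C>0. \<forall>t\<in>{0..T}. norm (h t) \<le> C" if "continuous_on {0..T} h" for h :: "real \<Rightarrow> 'e::real_normed_vector"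
    using compact_imp_bounded[OF compact_continuous_image[OF that compact_Icc]]
    unfolding bounded_pos by auto
  obtain Cf where Cf: "Cf > 0" "\<And>t. t \<in> {0..T} \<Longrightarrow> norm (f t) \<le> Cf" using bd[OF AC_on_continuous_on[OF f]] by blast
  obtain Cg where Cg: "Cg > 0" "\<And>t. t \<in> {0..T} \<Longrightarrow> norm (g t) \<le> Cg" using bd[OF AC_on_continuous_on[OF g]] by blast
  have "e / (2 * (Cg * K)) > 0" "e / (2 * (Cf * K)) > 0" using e Cf Cg \<open>K > 0\<close> by auto
  from f[unfolded AC_on_def, rule_format, OF ab this(1)] g[unfolded AC_on_def, rule_format, OF ab this(2)]
  obtain \<delta>f \<delta>g where \<delta>: "\<delta>f > 0" "\<delta>g > 0"
    and df: "\<And>D. D division_of \<Union>D \<and> \<Union>D \<subseteq> {a..b} \<and> (\<Sum>J\<in>D. Sup J - Inf J) < \<delta>f \<Longrightarrow>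
        (\<Sum>J\<in>D. norm (f (Sup J) - f (Inf J))) < e / (2 * (Cg * K))"
    and dg: "\<And>D. D division_of \<Union>D \<and> \<Union>D \<subseteq> {a..b} \<and> (\<Sum>J\<in>D. Sup J - Inf J) < \<delta>g \<Longrightarrow>
        (\<Sum>J\<in>D. norm (g (Sup J) - g (Inf J))) < e / (2 * (Cf * K))"
    by blast
  show "\<exists>\<delta>>0. \<forall>D. D division_of \<Union>D \<and> \<Union>D \<subseteq> {a..b} \<and> (\<Sum>J\<in>D. Sup J - Inf J) < \<delta> \<longrightarrow>
        (\<Sum>J\<in>D. norm (B (f (Sup J)) (g (Sup J)) - B (f (Inf J)) (g (Inf J)))) < e"
  proof (intro exI[of _ "min \<delta>f \<delta>g"] conjI allI impI)
    show "min \<delta>f \<delta>g > 0" using \<delta> by simp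
    fix D assume D: "D division_of \<Union>D \<and> \<Union>D \<subseteq> {a..b} \<and> (\<Sum>J\<in>D. Sup J - Inf J) < min \<delta>f \<delta>g"
    have one: "norm (B (f (Sup J)) (g (Sup J)) - B (f (Inf J)) (g (Inf J)))
        \<le> (Cg * K) * norm (f (Sup J) - f (Inf J)) + (Cf * K) * norm (g (Sup J) - g (Inf J))"
      if JD: "J \<in> D" for J
    proof -
      obtain u v where uv: "J = {u..v}" using D JD division_ofD(4)[of D "\<Union>D" J] by (metis box_real(2))
      moreover have "J \<noteq> {}" using D JD division_ofD(3)[of D "\<Union>D" J] by blast
      moreover have "J \<subseteq> {0..T}" using D JD ab by blast
      ultimately have io: "Inf J \<in> {0..T}" "Sup J \<in> {0..T}" by auto
      have "B (f (Sup J)) (g (Sup J)) - B (f (Inf J)) (g (Inf J))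
        = B (f (Sup J) - f (Inf J)) (g (Sup J)) + B (f (Inf J)) (g (Sup J) - g (Inf J))"
        by (simp add: diff_left diff_right)
      also have "norm \<dots> \<le> norm (f (Sup J) - f (Inf J)) * norm (g (Sup J)) * K + norm (f (Inf J)) * norm (g (Sup J) - g (Inf J)) * K"
        by (intro order_trans[OF norm_triangle_ineq] add_mono K)
      also have "\<dots> \<le> norm (f (Sup J) - f (Inf J)) * Cg * K + Cf * norm (g (Sup J) - g (Inf J)) * K"
        using \<open>K > 0\<close> Cf Cg io by (intro add_mono mult_right_mono mult_left_mono) auto
      finally show ?thesis by (simp add: algebra_simps)
    qed
    have "(\<Sum>J\<in>D. norm (B (f (Sup J)) (g (Sup J)) - B (f (Inf J)) (g (Inf J))))
      \<le> (Cg * K) * (\<Sum>J\<in>D. norm (f (Sup J) - f (Inf J))) + (Cf * K) * (\<Sum>J\<in>D. norm (g (Sup J) - g (Inf J)))"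
      unfolding sum_distrib_left sum.distrib[symmetric] by (intro sum_mono one)
    also have "\<dots> < (Cg * K) * (e / (2 * (Cg * K))) + (Cf * K) * (e / (2 * (Cf * K)))"
      using df dg D \<open>K > 0\<close> Cf Cg by (intro add_strict_mono mult_strict_left_mono) auto
    also have "\<dots> = e" using \<open>K > 0\<close> Cf Cg by simp
    finally show "(\<Sum>J\<in>D. norm (B (f (Sup J)) (g (Sup J)) - B (f (Inf J)) (g (Inf J)))) < e" .
  qed
qed

lemma primitive_continuous_on: "primitive T f g \<Longrightarrow> continuous_on {0..T} f"
  by (intro AC_on_continuous_on primitive_AC)

text \<open>The product rule; combined with \<open>primitive_LINT\<close> below it is integration by parts.\<close>
lemma primitive_bilinear:
  fixes f :: "real \<Rightarrow> 'b::euclidean_space" and g :: "real \<Rightarrow> 'c::euclidean_space"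
    and B :: "'b \<Rightarrow> 'c \<Rightarrow> 'd::euclidean_space"
  assumes B: "bounded_bilinear B" and f: "primitive T f f'" and g: "primitive T g g'"
  shows "primitive T (\<lambda>t. B (f t) (g t)) (\<lambda>t. B (f t) (g' t) + B (f' t) (g t))"
proof (rule AC_on_primitive)
  show "AC_on {0..T} (\<lambda>t. B (f t) (g t))"
    by (rule AC_on_bilinear[OF B primitive_AC[OF f] primitive_AC[OF g]])
  have "sqint (leb T) (\<lambda>t. B (f t) (g' t))"
    by (rule sqint_continuous_bilinear[OF B primitive_continuous_on[OF f] primitive_sqint[OF g]])
  moreover have "sqint (leb T) (\<lambda>t. B (f' t) (g t))"
    by (rule sqint_continuous_bilinear[OF bounded_bilinear.flip[OF B]
          primitive_continuous_on[OF g] primitive_sqint[OF f]])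
  ultimately show "sqint (leb T) (\<lambda>t. B (f t) (g' t) + B (f' t) (g t))"
    by (rule sqint_add)
  show "AE t in leb T. ((\<lambda>t. B (f t) (g t)) has_vector_derivative B (f t) (g' t) + B (f' t) (g t)) (at t within {0..T})"
    using primitive_has_derivative_AE[OF f] primitive_has_derivative_AE[OF g]
    by eventually_elim (rule bounded_bilinear.has_vector_derivative[OF B])
qed

lemma primitive_linear:
  fixes L :: "'b::euclidean_space \<Rightarrow> 'c::euclidean_space"
  assumes L: "bounded_linear L" and f: "primitive T f f'"
  shows "primitive T (\<lambda>t. L (f t)) (\<lambda>t. L (f' t))"
proof (rule primitiveI)
  note f' = primitive_sqint[OF f]
  show "sqint (leb T) (\<lambda>t. L (f' t))" by (rule sqint_bounded_linear[OF L f'])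
  fix t assume t: "t \<in> {0..T}"
  have sub: "{0..t} \<subseteq> {0..T}" using t by auto
  have "L (f t) = L (f 0 + integral {0..t} f')"
    using primitive_increment[OF f, of 0 t] t by (simp add: algebra_simps)
  also have "\<dots> = L (f 0) + integral {0..t} (\<lambda>s. L (f' s))"
    using integral_linear[OF sqint_Icc_integral(1)[OF sqint_Icc_subset[OF f' sub]] L]
    by (simp add: linear_add[OF bounded_linear.linear[OF L]] o_def)
  finally show "L (f t) = L (f 0) + integral {0..t} (\<lambda>s. L (f' s))" .
qed

lemma primitive_reflect:
  assumes f: "primitive T f f'"
  shows "primitive T (\<lambda>t. f (T - t)) (\<lambda>t. - f' (T - t))"
proof (rule primitiveI)
  show "sqint (leb T) (\<lambda>t. - f' (T - t))"
    by (intro sqint_uminus sqint_reflect primitive_sqint[OF f])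
  fix t assume t: "t \<in> {0..T}"
  have "f T - f (T - t) = integral {T - t..T} f'"
    using t by (intro primitive_increment[OF f]) auto
  also have "\<dots> = integral {0..t} (\<lambda>s. f' (T - s))"
    using integral_reflect_Icc[of 0 t f' T] by simp
  finally show "f (T - t) = f (T - 0) + integral {0..t} (\<lambda>s. - f' (T - s))"
    by (simp add: algebra_simps)
qed

lemma continuous_on_AE_eq:
  fixes f g :: "real \<Rightarrow> 'b::real_normed_vector"
  assumes T: "0 < T" and f: "continuous_on {0..T} f" and g: "continuous_on {0..T} g"
    and ae: "AE t in leb T. f t = g t" and t: "t \<in> {0..T}"
  shows "f t = g t"
proof -
  obtain N where N: "negligible N" "\<And>t. t \<in> {0..T} - N \<Longrightarrow> f t = g t"
    using ae unfolding AE_Icc_iff_negligible by blast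
  have dense: "{0..T} \<subseteq> closure ({0..T} - N)"
  proof -
    have "{0<..<T} \<subseteq> closure ({0..T} - N)"
    proof (rule ccontr)
      assume "\<not> {0<..<T} \<subseteq> closure ({0..T} - N)"
      then obtain x where x: "x \<in> {0<..<T} - closure ({0..T} - N)" by blast
      have "open ({0<..<T} - closure ({0..T} - N))" by (intro open_Diff) auto
      moreover have "{0<..<T} - closure ({0..T} - N) \<subseteq> N"
      proof
        fix y assume y: "y \<in> {0<..<T} - closure ({0..T} - N)"
        then have "y \<notin> {0..T} - N" using closure_subset[of "{0..T} - N"] by blast
        then show "y \<in> N" using y by auto
      qed
      ultimately show False
        using open_not_negligible x N(1) negligible_subset by blast
    qed
    then have "closure {0<..<T} \<subseteq> closure ({0..T} - N)" by (intro closure_minimal) auto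
    then show ?thesis using T by simp
  qed
  have "\<exists>x. (\<forall>n. x n \<in> {0..T} - N) \<and> x \<longlonglongrightarrow> t"
    using dense t closure_sequential by blast
  then obtain x where x: "\<And>n. x n \<in> {0..T} - N" "x \<longlonglongrightarrow> t" by blast
  have "(\<lambda>n. f (x n)) \<longlonglongrightarrow> f t" "(\<lambda>n. g (x n)) \<longlonglongrightarrow> g t"
    using f g x t by (auto intro!: continuous_on_tendsto_compose[of "{0..T}"])
  moreover have "(\<lambda>n. f (x n)) = (\<lambda>n. g (x n))" using N(2) x(1) by auto
  ultimately show ?thesis using LIMSEQ_unique by metis
qed

text \<open>The absolutely continuous representative is unique on a nondegenerate interval, so \<open>ac_rep\<close> can be
  computed from any representative.\<close>
lemma ac_rep_eq:
  assumes T: "0 < T" and r: "is_ac_rep {0..T} f \<phi>" and t: "t \<in> {0..T}"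
  shows "ac_rep {0..T} f t = \<phi> t"
proof -
  have *: "is_ac_rep {0..T} f (ac_rep {0..T} f)"
    unfolding ac_rep_def by (rule someI[of _ \<phi>]) (rule r)
  show ?thesis
  proof (rule continuous_on_AE_eq[OF T _ _ _ t])
    show "continuous_on {0..T} (ac_rep {0..T} f)" "continuous_on {0..T} \<phi>"
      using * r by (auto simp: is_ac_rep_def intro: AC_on_continuous_on)
    have "AE t in leb T. f t = \<phi> t" "AE t in leb T. f t = ac_rep {0..T} f t"
      using * r by (auto simp: is_ac_rep_def)
    then show "AE t in leb T. ac_rep {0..T} f t = \<phi> t" by eventually_elim simp
  qed
qed

lemma ac_rep_is_ac_rep:
  assumes "has_ac_rep I f"
  shows "is_ac_rep I f (ac_rep I f)"
  using assms unfolding has_ac_rep_def ac_rep_def by (metis someI_ex)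

section \<open>Moore-Penrose inverses and positive definite matrices\<close>

(* Transposed matrices are kept as such instead of being turned into row-vector products. *)
declare transpose_matrix_vector [simp del]

lemma inner_mult_transpose: "x \<bullet> (A *v y) = (transpose A *v x) \<bullet> y" for A :: "real^'n^'m"
  by (simp add: dot_lmul_matrix transpose_matrix_vector)

lemma inner_transpose_mult: "x \<bullet> (transpose A *v y) = (A *v x) \<bullet> y" for A :: "real^'n^'m"
  using inner_mult_transpose[of x "transpose A" y] by simp

lemma transpose_eqI:
  fixes A :: "real^'n^'m"
  assumes "\<And>x y. (A *v x) \<bullet> y = x \<bullet> (B *v y)"
  shows "transpose A = B"
  unfolding matrix_eq
  by (metis assms inner_transpose_mult vector_eq_ldot)

lemma bilinear_matrix_vector: "bounded_bilinear ((*v) :: real^'n^'m \<Rightarrow> _)"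
  unfolding bilinear_conv_bounded_bilinear[symmetric] bilinear_def
  by (auto intro!: linearI simp: matrix_vector_right_distrib matrix_vector_mult_add_rdistrib
      matrix_vector_mult_scaleR scaleR_matrix_vector_assoc)

lemma bilinear_matrix_mult: "bounded_bilinear ((**) :: real^'n^'m \<Rightarrow> real^'k^'n \<Rightarrow> _)"
  unfolding bilinear_conv_bounded_bilinear[symmetric] bilinear_def
  by (auto intro!: linearI simp: matrix_matrix_mult_def vec_eq_iff sum.distrib sum_distrib_left algebra_simps)

lemmas matrix_mult_diff_right = bounded_bilinear.diff_right[OF bilinear_matrix_mult]
lemmas matrix_mult_diff_left = bounded_bilinear.diff_left[OF bilinear_matrix_mult]
lemmas matrix_mult_zero_left = bounded_bilinear.zero_left[OF bilinear_matrix_mult]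

text \<open>\<open>X y\<close> is the least-squares solution of minimal norm: the unique solution of the normal equations
  that lies in the row space of \<open>M\<close>.\<close>
lemma pinv_exists:
  fixes M :: "real^'n^'m"
  shows "\<exists>X. M ** X ** M = M \<and> X ** M ** X = X \<and>
     transpose (M ** X) = M ** X \<and> transpose (X ** M) = X ** M"
proof -
  let ?R = "range (\<lambda>y. transpose M *v y)"
  have subR: "subspace ?R"
    by (metis linear_subspace_image matrix_vector_mul_linear subspace_UNIV)
  have normal0: "M *v d = 0" if "transpose M *v (M *v d) = 0" for d
  proof -
    have "(M *v d) \<bullet> (M *v d) = d \<bullet> (transpose M *v (M *v d))" by (simp add: inner_transpose_mult)
    then show ?thesis using that by simp
  qed
  have uniq0: "d = 0" if dR: "d \<in> ?R" and Md: "M *v d = 0" for d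
  proof -
    from dR obtain y where y: "d = transpose M *v y" by blast
    have "d \<bullet> d = d \<bullet> (transpose M *v y)" by (simp only: y)
    also have "\<dots> = (M *v d) \<bullet> y" by (rule inner_transpose_mult)
    finally show ?thesis by (simp add: Md)
  qed
  have uniq: "x = x'" if "x \<in> ?R" "x' \<in> ?R" "transpose M *v (M *v x) = transpose M *v (M *v x')" for x x'
  proof -
    have "x - x' = 0"
    proof (rule uniq0[OF subspace_diff[OF subR that(1,2)] normal0])
      show "transpose M *v (M *v (x - x')) = 0"
        by (simp only: matrix_vector_mult_diff_distrib that(3)) simp
    qed
    then show ?thesis by simp
  qed
  have ex: "\<exists>x\<in>?R. transpose M *v (M *v x) = transpose M *v y" for y
  proof -
    have subM: "subspace (range (\<lambda>x. M *v x))"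
      by (metis linear_subspace_image matrix_vector_mul_linear subspace_UNIV)
    obtain y1 y2 where y: "y1 \<in> span (range (\<lambda>x. M *v x))" "\<And>w. w \<in> span (range (\<lambda>x. M *v x)) \<Longrightarrow> orthogonal y2 w" "y = y1 + y2"
      using orthogonal_subspace_decomp_exists[of "range (\<lambda>x. M *v x)" y] by blast
    then obtain x0 where x0: "y1 = M *v x0" by (metis imageE span_eq_iff subM)
    have y2: "transpose M *v y2 = 0"
    proof -
      have "(M *v (transpose M *v y2)) \<bullet> y2 = 0"
        using y(2)[OF span_base[OF rangeI], of "transpose M *v y2"] by (simp add: orthogonal_def inner_commute)
      then have "(transpose M *v y2) \<bullet> (transpose M *v y2) = 0" by (simp only: inner_transpose_mult)
      then show ?thesis by simp
    qed
    obtain x1 x2 where x: "x1 \<in> span ?R" "\<And>w. w \<in> span ?R \<Longrightarrow> orthogonal x2 w" "x0 = x1 + x2"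
      using orthogonal_subspace_decomp_exists[of ?R x0] by blast
    have "M *v x2 = 0"
    proof -
      have "x2 \<bullet> (transpose M *v (M *v x2)) = 0"
        using x(2)[OF span_base[OF rangeI], of "M *v x2"] by (simp add: orthogonal_def)
      then show ?thesis by (simp add: inner_transpose_mult)
    qed
    then have "transpose M *v (M *v x1) = transpose M *v y"
      using y(3) x0 x(3) y2 by (simp add: matrix_vector_right_distrib)
    then show ?thesis using x(1) by (metis span_eq_iff[THEN iffD2, OF subR])
  qed
  then obtain X where XR: "\<And>y. X y \<in> ?R" and XN: "\<And>y. transpose M *v (M *v X y) = transpose M *v y"
    by metis
  have "linear X"
  proof (rule linearI)
    show "X (a + b) = X a + X b" for a b
      by (rule uniq[OF XR subspace_add[OF subR XR XR]]) (simp add: XN matrix_vector_right_distrib)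
    show "X (c *\<^sub>R a) = c *\<^sub>R X a" for c a
      by (rule uniq[OF XR subspace_scale[OF subR XR]]) (simp add: XN matrix_vector_mult_scaleR)
  qed
  then have mX: "matrix X *v y = X y" for y by (simp add: matrix_works linear_matrix_vector_mul_eq)
  have MXM: "M *v X (M *v x) = M *v x" for x
  proof -
    have "M *v (X (M *v x) - x) = 0"
      by (rule normal0) (simp add: XN matrix_vector_mult_diff_distrib)
    then show ?thesis by (simp add: matrix_vector_mult_diff_distrib)
  qed
  have sym1: "(M *v X y) \<bullet> z = (M *v X y) \<bullet> (M *v X z)" for y z
    by (metis XN inner_commute inner_transpose_mult)
  have sym2: "X (M *v x) \<bullet> z = X (M *v x) \<bullet> X (M *v z)" for x z
  proof -
    obtain y where "X (M *v x) = transpose M *v y" using XR by blast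
    then show ?thesis by (metis MXM inner_commute inner_transpose_mult)
  qed
  show ?thesis
  proof (intro exI[of _ "matrix X"] conjI)
    show "M ** matrix X ** M = M"
      by (simp add: matrix_eq mX MXM flip: matrix_vector_mul_assoc)
    show "matrix X ** M ** matrix X = matrix X"
      unfolding matrix_eq by (auto simp: mX simp flip: matrix_vector_mul_assoc intro: uniq[OF XR XR] simp: XN)
    show "transpose (M ** matrix X) = M ** matrix X"
      by (rule transpose_eqI) (simp add: mX flip: matrix_vector_mul_assoc, metis sym1 inner_commute)
    show "transpose (matrix X ** M) = matrix X ** M"
      by (rule transpose_eqI) (simp add: mX flip: matrix_vector_mul_assoc, metis sym2 inner_commute)
  qed
qed

lemma pinv_unique:
  fixes M :: "real^'n^'m"
  assumes X: "M ** X ** M = M" "X ** M ** X = X" "transpose (M ** X) = M ** X" "transpose (X ** M) = X ** M"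
    and Y: "M ** Y ** M = M" "Y ** M ** Y = Y" "transpose (M ** Y) = M ** Y" "transpose (Y ** M) = Y ** M"
  shows "X = Y"
proof -
  have "M ** X = (M ** Y) ** (M ** X)" by (metis Y(1) matrix_mul_assoc)
  also have "\<dots> = transpose ((M ** X) ** (M ** Y))" by (metis X(3) Y(3) matrix_transpose_mul)
  also have "\<dots> = transpose (M ** Y)" by (metis X(1) matrix_mul_assoc)
  finally have MX: "M ** X = M ** Y" using Y(3) by simp
  have "X ** M = (X ** M) ** (Y ** M)" by (metis Y(1) matrix_mul_assoc)
  also have "\<dots> = transpose ((Y ** M) ** (X ** M))" by (metis X(4) Y(4) matrix_transpose_mul)
  also have "\<dots> = transpose (Y ** M)" by (metis X(1) matrix_mul_assoc)
  finally have XM: "X ** M = Y ** M" using Y(4) by simp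
  show ?thesis by (metis MX XM X(2) Y(2) matrix_mul_assoc)
qed

lemma pinv_penrose:
  fixes M :: "real^'n^'m"
  shows "M ** pinv M ** M = M" "pinv M ** M ** pinv M = pinv M"
    "transpose (M ** pinv M) = M ** pinv M" "transpose (pinv M ** M) = pinv M ** M"
proof -
  have "\<exists>!X. M ** X ** M = M \<and> X ** M ** X = X \<and>
     transpose (M ** X) = M ** X \<and> transpose (X ** M) = X ** M"
    using pinv_exists[of M] pinv_unique[of M] by blast
  from theI'[OF this]
  show "M ** pinv M ** M = M" "pinv M ** M ** pinv M = pinv M"
    "transpose (M ** pinv M) = M ** pinv M" "transpose (pinv M ** M) = pinv M ** M"
    unfolding pinv_def by blast+
qed

lemma pinv_left_inverse:
  fixes G :: "real^'h^'n"
  assumes "rank G = CARD('h)"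
  shows "pinv G *v (G *v p) = p"
proof -
  have "inj ((*v) G)" using assms full_rank_injective by blast
  moreover have "G *v (pinv G *v (G *v p)) = G *v p"
    using pinv_penrose(1)[of G] by (simp add: matrix_vector_mul_assoc matrix_mul_assoc)
  ultimately show ?thesis by (meson injD)
qed

lemma matrix_inv_works:
  fixes A :: "real^'n^'n"
  assumes "\<And>x. A *v x = 0 \<Longrightarrow> x = 0"
  shows "A ** matrix_inv A = mat 1" "matrix_inv A ** A = mat 1"
proof -
  have "invertible A"
    using assms matrix_left_invertible_ker[of A] invertible_left_inverse by blast
  then have "\<exists>B. A ** B = mat 1 \<and> B ** A = mat 1" by (simp add: invertible_def)
  from someI_ex[OF this] show "A ** matrix_inv A = mat 1" "matrix_inv A ** A = mat 1"
    unfolding matrix_inv_def by auto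
qed

lemma sym_pos_def_inv_vec:
  assumes "sym_pos_def A"
  shows "A *v (matrix_inv A *v x) = x" "matrix_inv A *v (A *v x) = x"
proof -
  have "x = 0" if "A *v x = 0" for x using assms that unfolding sym_pos_def_def by force
  from matrix_inv_works[OF this]
  show "A *v (matrix_inv A *v x) = x" "matrix_inv A *v (A *v x) = x"
    by (simp_all add: matrix_vector_mul_assoc)
qed

lemma sym_pos_def_transpose: "sym_pos_def A \<Longrightarrow> transpose A = A"
  by (simp add: sym_pos_def_def)

lemma sym_pos_def_inner_commute: "sym_pos_def A \<Longrightarrow> (A *v x) \<bullet> y = x \<bullet> (A *v y)"
  by (metis inner_mult_transpose sym_pos_def_transpose)

lemma sym_pos_def_nonneg: "sym_pos_def A \<Longrightarrow> 0 \<le> x \<bullet> (A *v x)"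
  by (cases "x = 0") (auto simp: sym_pos_def_def less_imp_le)

lemma sym_pos_def_matrix_inv:
  assumes A: "sym_pos_def A"
  shows "sym_pos_def (matrix_inv A)"
proof -
  have "transpose (matrix_inv A) = matrix_inv A"
  proof (rule transpose_eqI)
    fix x y
    have "(matrix_inv A *v x) \<bullet> y = (matrix_inv A *v x) \<bullet> (A *v (matrix_inv A *v y))"
      by (simp add: sym_pos_def_inv_vec[OF A])
    also have "\<dots> = (A *v (matrix_inv A *v x)) \<bullet> (matrix_inv A *v y)"
      by (rule sym_pos_def_inner_commute[OF A, symmetric])
    also have "\<dots> = x \<bullet> (matrix_inv A *v y)"
      by (simp only: sym_pos_def_inv_vec[OF A])
    finally show "(matrix_inv A *v x) \<bullet> y = x \<bullet> (matrix_inv A *v y)" .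
  qed
  moreover have "x \<bullet> (matrix_inv A *v x) > 0" if "x \<noteq> 0" for x
  proof -
    have "matrix_inv A *v x \<noteq> 0" using that sym_pos_def_inv_vec(1)[OF A, of x] by force
    then have "(matrix_inv A *v x) \<bullet> (A *v (matrix_inv A *v x)) > 0" using A by (auto simp: sym_pos_def_def)
    then show ?thesis by (simp add: sym_pos_def_inv_vec[OF A] inner_commute)
  qed
  ultimately show ?thesis by (simp add: sym_pos_def_def)
qed

lemma ker_proj_props:
  fixes F :: "real^'n^'m"
  shows "transpose (ker_proj F) = ker_proj F" "transpose F ** ker_proj F = 0"
    "ker_proj F *v x = x - pinv (transpose F) *v (transpose F *v x)"
proof -
  show "ker_proj F *v x = x - pinv (transpose F) *v (transpose F *v x)" for x
    by (simp add: ker_proj_def matrix_vector_mult_diff_rdistrib matrix_vector_mul_assoc)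
  show "transpose (ker_proj F) = ker_proj F"
    unfolding ker_proj_def using pinv_penrose(4)[of "transpose F"]
    by (simp add: transpose_def vec_eq_iff mat_def)
  show "transpose F ** ker_proj F = 0"
    unfolding ker_proj_def using pinv_penrose(1)[of "transpose F"]
    by (simp add: matrix_mult_diff_right matrix_mul_assoc)
qed

lemma ker_proj_zero_range:
  fixes F :: "real^'n^'m"
  assumes "ker_proj F *v x = 0"
  shows "x \<in> range (\<lambda>y. F *v y)"
proof -
  have "x = (pinv (transpose F) ** transpose F) *v x"
    using assms by (simp add: ker_proj_props matrix_vector_mul_assoc)
  also have "\<dots> = transpose (pinv (transpose F) ** transpose F) *v x"
    by (simp add: pinv_penrose)
  also have "\<dots> = F *v (transpose (pinv (transpose F)) *v x)"
    by (simp add: matrix_transpose_mul matrix_vector_mul_assoc)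
  finally show ?thesis by blast
qed

lemma range_inner_pinv:
  fixes F :: "real^'n^'m"
  assumes "x \<in> range (\<lambda>y. F *v y)"
  shows "x \<bullet> (pinv (transpose F) *v (transpose F *v q)) = x \<bullet> q"
proof -
  obtain y where x: "x = F *v y" using assms by blast
  have "(F *v y) \<bullet> (pinv (transpose F) *v (transpose F *v q)) = y \<bullet> ((transpose F ** pinv (transpose F) ** transpose F) *v q)"
    by (simp add: inner_transpose_mult flip: matrix_vector_mul_assoc)
  also have "\<dots> = (F *v y) \<bullet> q"
    by (simp add: pinv_penrose inner_transpose_mult)
  finally show ?thesis by (simp add: x)
qed

text \<open>Among all vectors in \<open>q + ker F^T\<close>, the vector \<open>E q\<close> minimises the quadratic form of \<open>Q0^(-1)\<close>, and
  \<open>Q0_bar\<close> is the minimal value as a quadratic form in \<open>q\<close>. Optimality appears as the second claim: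
  \<open>Q0^(-1) (E q)\<close> is orthogonal to \<open>ker F^T\<close>, that is, it lies in the range of \<open>F\<close>.\<close>
lemma Q0_bar_optimal:
  fixes F :: "real^'n^'m"
  assumes Q0: "sym_pos_def Q0"
  defines "E \<equiv> (pinv (transpose F) - M_opt F Q0) ** transpose F"
  shows "transpose F ** E = transpose F"
    and "matrix_inv Q0 *v (E *v q) \<in> range (\<lambda>y. F *v y)"
    and "x \<bullet> (Q0_bar F Q0 *v y) = (E *v x) \<bullet> (matrix_inv Q0 *v (E *v y))"
proof -
  let ?P = "ker_proj F" and ?S = "matrix_inv Q0" and ?N = "pinv (transpose F)"
  note S = sym_pos_def_matrix_inv[OF Q0]
  have M: "M_opt F Q0 = ?P ** (pinv (?P ** ?S ** ?P) ** ?P ** ?S ** ?N)"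
    unfolding M_opt_def by (simp add: matrix_mul_assoc)
  have "transpose F ** M_opt F Q0 = 0"
    unfolding M by (simp add: matrix_mul_assoc ker_proj_props matrix_mult_zero_left)
  then have "transpose F ** E = transpose F ** ?N ** transpose F"
    unfolding E_def by (simp add: matrix_mul_assoc matrix_mult_diff_right)
  then show "transpose F ** E = transpose F" by (simp add: pinv_penrose)
  show "x \<bullet> (Q0_bar F Q0 *v y) = (E *v x) \<bullet> (?S *v (E *v y))"
  proof -
    have "Q0_bar F Q0 = transpose E ** ?S ** E"
      unfolding Q0_bar_def E_def by (simp add: matrix_transpose_mul matrix_mul_assoc)
    then show ?thesis
      by (simp add: inner_transpose_mult flip: matrix_vector_mul_assoc)
  qed
  define N where "N = ?P ** ?S ** ?P"
  have Nsym: "transpose N = N"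
    unfolding N_def by (simp add: matrix_transpose_mul ker_proj_props sym_pos_def_transpose[OF S] matrix_mul_assoc)
  have Nker: "?P *v x = 0" if "N *v x = 0" for x
  proof -
    have "(?P *v x) \<bullet> (?S *v (?P *v x)) = x \<bullet> (N *v x)"
      unfolding N_def by (metis inner_mult_transpose ker_proj_props(1) matrix_vector_mul_assoc)
    then show ?thesis using that S unfolding sym_pos_def_def by (metis inner_zero_right less_irrefl)
  qed
  \<comment> \<open>\<open>N\<close> and \<open>ker_proj F\<close> have the same kernel, hence the same range, so \<open>N N^+\<close> fixes the range of \<open>ker_proj F\<close>.\<close>
  have PN: "N *v (pinv N *v (?P *v w)) = ?P *v w" for w
  proof -
    have PP: "?P *v (?P *v w) = ?P *v w" for w
    proof -
      have "?P *v (?P *v w) = ?P *v w - ?N *v ((transpose F ** ?P) *v w)"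
        by (subst ker_proj_props(3)) (simp add: matrix_vector_mul_assoc)
      then show ?thesis by (simp add: ker_proj_props)
    qed
    define u where "u = ?P *v w - N *v (pinv N *v (?P *v w))"
    have "?P *v u = u"
      unfolding u_def N_def by (simp add: matrix_vector_mult_diff_distrib PP flip: matrix_vector_mul_assoc)
    moreover have "N *v u = 0"
    proof -
      have "N ** (N ** pinv N) = N"
        using arg_cong[OF pinv_penrose(1)[of N], of transpose] pinv_penrose(3)[of N]
        by (simp add: matrix_transpose_mul Nsym)
      then have "N *v (N *v (pinv N *v x)) = N *v x" for x
        by (simp add: matrix_vector_mul_assoc)
      then show ?thesis unfolding u_def by (simp add: matrix_vector_mult_diff_distrib)
    qed
    ultimately have "u = 0" using Nker by force
    then show ?thesis unfolding u_def by simp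
  qed
  show "?S *v (E *v q) \<in> range (\<lambda>y. F *v y)"
  proof (rule ker_proj_zero_range)
    define a where "a = ?N *v (transpose F *v q)"
    have "E *v q = a - ?P *v (pinv N *v (?P *v (?S *v a)))"
      unfolding E_def a_def M N_def by (simp add: matrix_vector_mult_diff_rdistrib flip: matrix_vector_mul_assoc)
    then have "?P *v (?S *v (E *v q)) = ?P *v (?S *v a) - N *v (pinv N *v (?P *v (?S *v a)))"
      unfolding N_def by (simp add: matrix_vector_mult_diff_distrib flip: matrix_vector_mul_assoc)
    then show "?P *v (?S *v (E *v q)) = 0" using PN by simp
  qed
qed

lemma bounded_linear_transpose: "bounded_linear (transpose :: real^'n^'m \<Rightarrow> _)"
  unfolding linear_conv_bounded_linear[symmetric]
  by (auto intro!: linearI simp: transpose_def vec_eq_iff)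

section \<open>Linear differential equations with square-integrable forcing\<close>

text \<open>Existence of Caratheodory solutions by Banach's fixed point theorem. The unknown is
  \<open>\<rho> t = exp (- L t) r t\<close> with \<open>L = 2 C\<close>, for which the integral operator contracts by the factor
  \<open>C / L = 1/2\<close> on the whole interval at once. Functions on \<open>{0..T}\<close> are extended to the line by clamping
  the argument, so that the complete space of bounded continuous functions applies.\<close>
lemma linear_ode_exists:
  fixes G :: "real \<Rightarrow> real^'h^'h" and h :: "real \<Rightarrow> real^'h"
  assumes T: "0 < T" and G: "continuous_on {0..T} G" and h: "sqint (leb T) h"
  obtains r where "r 0 = 0" "primitive T r (\<lambda>t. G t *v r t + h t)"
proof -
  obtain C where C: "C > 0" "\<And>t x. t \<in> {0..T} \<Longrightarrow> norm (G t *v x) \<le> C * norm x"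
  proof -
    obtain B where B: "B > 0" "\<And>t. t \<in> {0..T} \<Longrightarrow> norm (G t) \<le> B"
      using compact_imp_bounded[OF compact_continuous_image[OF G compact_Icc]]
      unfolding bounded_pos by auto
    obtain K where K: "K > 0" "\<And>(A::real^'h^'h) x. norm (A *v x) \<le> norm A * norm x * K"
      using bounded_bilinear.pos_bounded[OF bilinear_matrix_vector] by metis
    have "norm (G t *v x) \<le> (B * K) * norm x" if "t \<in> {0..T}" for t x
    proof -
      have "norm (G t *v x) \<le> norm (G t) * norm x * K" by (rule K)
      also have "\<dots> \<le> B * norm x * K" using B(2)[OF that] K(1) by (intro mult_right_mono) auto
      finally show ?thesis by (simp add: ac_simps)
    qed
    then show ?thesis using that[of "B * K"] B K by simp
  qed
  define L where "L = 2 * C"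
  have L: "L > 0" using C by (simp add: L_def)
  define cl where "cl t = max 0 (min T t)" for t
  have cl: "cl t \<in> {0..T}" for t using T by (auto simp: cl_def)
  have cl_id: "cl t = t" if "t \<in> {0..T}" for t using that by (auto simp: cl_def)
  define k where "k \<rho> s = exp (L * s) *\<^sub>R (G s *v apply_bcontfun \<rho> s) + h s" for \<rho> :: "real \<Rightarrow>\<^sub>C (real^'h)" and s
  define \<Psi> where "\<Psi> \<rho> t = exp (- (L * cl t)) *\<^sub>R integral {0..cl t} (k \<rho>)" for \<rho> t
  have contG: "continuous_on {0..T} (\<lambda>s. exp (L * s) *\<^sub>R (G s *v apply_bcontfun \<rho> s))" for \<rho> :: "real \<Rightarrow>\<^sub>C (real^'h)"
    by (intro continuous_intros bounded_bilinear.continuous_on[OF bilinear_matrix_vector] G continuous_on_apply_bcontfun)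
  have ksq: "sqint (leb T) (k \<rho>)" for \<rho>
    unfolding k_def by (rule sqint_add[OF sqint_continuous_on[OF contG] h])
  have kint: "k \<rho> integrable_on {0..T}" for \<rho> by (rule sqint_Icc_integral(1)[OF ksq])
  have \<Psi>b: "\<Psi> \<rho> \<in> bcontfun" for \<rho>
  proof -
    have c0: "continuous_on {0..T} (\<lambda>t. exp (- (L * t)) *\<^sub>R integral {0..t} (k \<rho>))"
      by (intro continuous_intros indefinite_integral_continuous_1 kint)
    have ccl: "continuous_on UNIV cl" unfolding cl_def by (intro continuous_intros)
    have "continuous_on UNIV ((\<lambda>t. exp (- (L * t)) *\<^sub>R integral {0..t} (k \<rho>)) \<circ> cl)"
      by (rule continuous_on_compose[OF ccl continuous_on_subset[OF c0]]) (use cl in blast)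
    moreover have "bounded (range (\<Psi> \<rho>))"
      using compact_imp_bounded[OF compact_continuous_image[OF c0 compact_Icc]]
      by (rule bounded_subset) (use cl in \<open>auto simp: \<Psi>_def\<close>)
    ultimately show ?thesis by (simp add: bcontfun_def \<Psi>_def[abs_def] o_def)
  qed
  define \<Phi> where "\<Phi> \<rho> = Bcontfun (\<Psi> \<rho>)" for \<rho>
  have \<Phi>: "apply_bcontfun (\<Phi> \<rho>) = \<Psi> \<rho>" for \<rho>
    unfolding \<Phi>_def by (rule Bcontfun_inverse[OF \<Psi>b])
  have "\<exists>!\<rho>. \<Phi> \<rho> = \<rho>"
  proof (rule banach_fix_type[of "1/2"])
    show "\<forall>x y. dist (\<Phi> x) (\<Phi> y) \<le> 1/2 * dist x y"
    proof (intro allI dist_bound)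
      fix x y :: "real \<Rightarrow>\<^sub>C (real^'h)" and t0 :: real
      define t where "t = cl t0"
      have t: "0 \<le> t" "t \<le> T" using cl[of t0] by (auto simp: t_def)
      define d where "d = dist x y"
      have kd: "k x integrable_on {0..t}" "k y integrable_on {0..t}"
        using integrable_on_subinterval[OF kint] t by auto
      have expint: "((\<lambda>s. exp (L * s) * (C * d)) has_integral (exp (L * t) - 1) * (C * d) / L) {0..t}"
      proof -
        have "((\<lambda>s. exp (L * s) * (C * d)) has_integral (exp (L * t) * (C * d) / L - exp (L * 0) * (C * d) / L)) {0..t}"
          using L t by (intro fundamental_theorem_of_calculus)
            (auto intro!: derivative_eq_intros simp flip: has_real_derivative_iff_has_vector_derivative)
        then show ?thesis by (simp add: algebra_simps diff_divide_distrib)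
      qed
      have "norm (k x s - k y s) \<le> exp (L * s) * (C * d)" if "s \<in> {0..t}" for s
      proof -
        have "k x s - k y s = exp (L * s) *\<^sub>R (G s *v (x s - y s))"
          by (simp add: k_def matrix_vector_mult_diff_distrib scaleR_diff_right)
        also have "norm \<dots> \<le> exp (L * s) * (C * norm (x s - y s))"
          using C(2)[of s "x s - y s"] that t by simp
        also have "\<dots> \<le> exp (L * s) * (C * d)"
          using C(1) dist_bounded[of x s y] by (intro mult_left_mono) (auto simp: d_def dist_norm)
        finally show ?thesis .
      qed
      then have nb: "norm (integral {0..t} (\<lambda>s. k x s - k y s)) \<le> integral {0..t} (\<lambda>s. exp (L * s) * (C * d))"
        using expint by (intro integral_norm_bound_integral integrable_diff kd) (auto simp: integrable_on_def)
      have "dist (\<Phi> x t0) (\<Phi> y t0) = norm (\<Psi> x t0 - \<Psi> y t0)" by (simp add: \<Phi> dist_norm)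
      also have "\<Psi> x t0 - \<Psi> y t0 = exp (- (L * t)) *\<^sub>R integral {0..t} (\<lambda>s. k x s - k y s)"
        unfolding \<Psi>_def t_def[symmetric] using kd
        by (simp add: Henstock_Kurzweil_Integration.integral_diff scaleR_diff_right)
      also have "norm \<dots> \<le> exp (- (L * t)) * ((exp (L * t) - 1) * (C * d) / L)"
        using nb[unfolded integral_unique[OF expint]]
        by (simp only: norm_scaleR abs_exp_cancel) (intro mult_left_mono, auto)
      also have "\<dots> = (1 - exp (- (L * t))) * (d / 2)"
        using C(1) by (simp add: L_def exp_minus field_simps)
      also have "\<dots> \<le> 1 * (d / 2)"
        by (intro mult_right_mono) (auto simp: d_def)
      finally show "dist (\<Phi> x t0) (\<Phi> y t0) \<le> 1/2 * dist x y" by (simp add: d_def)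
    qed
  qed auto
  then obtain \<rho> where \<rho>: "\<Phi> \<rho> = \<rho>" by blast
  define r where "r t = exp (L * t) *\<^sub>R apply_bcontfun \<rho> t" for t
  have r: "r t = integral {0..t} (k \<rho>)" if "t \<in> {0..T}" for t
  proof -
    have "apply_bcontfun \<rho> t = \<Psi> \<rho> t" using \<rho> \<Phi> by metis
    then show ?thesis unfolding r_def \<Psi>_def cl_id[OF that] by (simp add: exp_minus)
  qed
  have kr: "k \<rho> s = G s *v r s + h s" for s
    unfolding k_def r_def by (simp add: matrix_vector_mult_scaleR)
  have r0: "r 0 = 0" using r[of 0] T by simp
  moreover have "primitive T r (\<lambda>t. G t *v r t + h t)"
    using ksq[of \<rho>] r r0 by (intro primitiveI) (auto simp: kr[abs_def])
  ultimately show ?thesis by (rule that)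
qed

lemma primitive_LINT:
  assumes "primitive T f g" "0 \<le> T"
  shows "f T - f 0 = (LINT t|leb T. g t)"
  using assms unfolding primitive_def by (metis add_diff_cancel_left' atLeastAtMost_iff order_refl)

lemma primitive_add_scaleR:
  fixes f g :: "real \<Rightarrow> 'b::euclidean_space"
  assumes f: "primitive T f f'" and g: "primitive T g g'"
  shows "primitive T (\<lambda>t. f t + c *\<^sub>R g t) (\<lambda>t. f' t + c *\<^sub>R g' t)"
proof (rule primitiveI)
  note sq = primitive_sqint[OF f] sqint_scaleR[OF primitive_sqint[OF g], of c]
  show "sqint (leb T) (\<lambda>t. f' t + c *\<^sub>R g' t)" by (rule sqint_add[OF sq])
  fix t assume t: "t \<in> {0..T}"
  then have sub: "{0..t} \<subseteq> {0..T}" by auto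
  have "integral {0..t} (\<lambda>t. f' t + c *\<^sub>R g' t) = integral {0..t} f' + c *\<^sub>R integral {0..t} g'"
    using sqint_Icc_integral(1)[OF sqint_Icc_subset[OF sq(1) sub]]
      sqint_Icc_integral(1)[OF sqint_Icc_subset[OF sq(2) sub]]
    by (simp add: Henstock_Kurzweil_Integration.integral_add)
  then show "f t + c *\<^sub>R g t = f 0 + c *\<^sub>R g 0 + integral {0..t} (\<lambda>t. f' t + c *\<^sub>R g' t)"
    using primitive_increment[OF f, of 0 t] primitive_increment[OF g, of 0 t] t
    by (simp add: algebra_simps)
qed

lemma primitive_indefinite:
  assumes "sqint (leb T) g"
  shows "primitive T (\<lambda>t. c + integral {0..t} g) g"
  by (rule primitiveI[OF assms]) simp

section \<open>Duality between the DAE and the dual DAE\<close>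

lemma is_ac_rep_primitive:
  assumes "primitive T a g" "AE t in leb T. f t = a t"
  shows "is_ac_rep {0..T} f a"
  using assms primitive_AC by (simp add: is_ac_rep_def)

lemma dae_sol_iff:
  assumes T: "0 < T"
  shows "dae_sol F A H T x f y \<eta> \<longleftrightarrow>
     sqint (leb T) x \<and> sqint (leb T) f \<and>
     sqint (leb T) y \<and> sqint (leb T) \<eta> \<and>
     (\<exists>a. primitive T a (\<lambda>t. A *v x t + f t) \<and> (AE t in leb T. F *v x t = a t)) \<and>
     (AE t in leb T. y t = H *v x t + \<eta> t)" (is "?L \<longleftrightarrow> ?R")
proof
  assume L: ?L
  then have sq: "sqint (leb T) x" "sqint (leb T) f"
    by (auto simp: dae_sol_def L2loc_Icc_iff)
  let ?a = "ac_rep {0..T} (\<lambda>t. F *v x t)"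
  have "is_ac_rep {0..T} (\<lambda>t. F *v x t) ?a" using L unfolding dae_sol_def by (blast intro: ac_rep_is_ac_rep)
  moreover have "primitive T ?a (\<lambda>t. A *v x t + f t)"
    unfolding primitive_def
  proof
    show "sqint (leb T) (\<lambda>t. A *v x t + f t)" by (rule sqint_add[OF sqint_matrix[OF sq(1)] sq(2)])
  qed (use L in \<open>unfold dae_sol_def, blast\<close>)
  ultimately show ?R using L unfolding dae_sol_def is_ac_rep_def L2loc_Icc_iff by blast
next
  assume R: ?R
  then obtain a where a: "primitive T a (\<lambda>t. A *v x t + f t)" "AE t in leb T. F *v x t = a t"
    by blast
  note rep = is_ac_rep_primitive[OF a]
  show ?L unfolding dae_sol_def L2loc_Icc_iff
  proof (intro conjI ballI)
    show "has_ac_rep {0..T} (\<lambda>t. F *v x t)" using rep by (auto simp: has_ac_rep_def)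
    fix t assume t: "t \<in> {0..T}"
    show "ac_rep {0..T} (\<lambda>t. F *v x t) t =
        ac_rep {0..T} (\<lambda>t. F *v x t) 0 + (LINT s|lebesgue_on {0..t}. A *v x s + f s)"
    proof -
      have "a t = a 0 + (LINT s|lebesgue_on {0..t}. A *v x s + f s)"
        using a(1) t unfolding primitive_def by blast
      then show ?thesis using ac_rep_eq[OF T rep t] ac_rep_eq[OF T rep, of 0] T by simp
    qed
  qed (use R in auto)
qed

lemma dual_sols_iff:
  assumes T: "0 < T"
  shows "(q, u) \<in> dual_sols {0..T} F A H \<longleftrightarrow>
     sqint (leb T) q \<and> sqint (leb T) u \<and>
     (\<exists>b. primitive T b (\<lambda>t. transpose A *v q t - transpose H *v u t) \<and>
        (AE t in leb T. transpose F *v q t = b t))" (is "?L \<longleftrightarrow> ?R")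
proof
  assume L: ?L
  then have sq: "sqint (leb T) q" "sqint (leb T) u"
    by (auto simp: dual_sols_def L2loc_Icc_iff)
  let ?b = "ac_rep {0..T} (\<lambda>t. transpose F *v q t)"
  have "is_ac_rep {0..T} (\<lambda>t. transpose F *v q t) ?b" using L unfolding dual_sols_def by (blast intro: ac_rep_is_ac_rep)
  moreover have "primitive T ?b (\<lambda>t. transpose A *v q t - transpose H *v u t)"
    unfolding primitive_def
  proof
    show "sqint (leb T) (\<lambda>t. transpose A *v q t - transpose H *v u t)"
      by (rule sqint_diff[OF sqint_matrix[OF sq(1)] sqint_matrix[OF sq(2)]])
  qed (use L in \<open>unfold dual_sols_def, blast\<close>)
  ultimately show ?R using sq unfolding is_ac_rep_def by blast
next
  assume R: ?R
  then obtain b where b: "primitive T b (\<lambda>t. transpose A *v q t - transpose H *v u t)"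
      "AE t in leb T. transpose F *v q t = b t"
    by blast
  note rep = is_ac_rep_primitive[OF b]
  have "ac_rep {0..T} (\<lambda>t. transpose F *v q t) t =
        ac_rep {0..T} (\<lambda>t. transpose F *v q t) 0 + (LINT s|lebesgue_on {0..t}. transpose A *v q s - transpose H *v u s)"
    if t: "t \<in> {0..T}" for t
  proof -
    have "b t = b 0 + (LINT s|lebesgue_on {0..t}. transpose A *v q s - transpose H *v u s)"
      using b(1) t unfolding primitive_def by blast
    then show ?thesis using ac_rep_eq[OF T rep t] ac_rep_eq[OF T rep, of 0] T by simp
  qed
  moreover have "has_ac_rep {0..T} (\<lambda>t. transpose F *v q t)" using rep unfolding has_ac_rep_def by blast
  ultimately show ?L using R unfolding dual_sols_def L2loc_Icc_iff by blast
qed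

text \<open>Both the absolutely continuous representative of \<open>F x\<close> and its derivative take values in the range
  of \<open>F\<close>, because \<open>ker_proj F\<close> annihilates them.\<close>
lemma primitive_range:
  fixes F :: "real^'n^'m"
  assumes T: "0 < T" and a: "primitive T a g" and x: "AE t in leb T. F *v x t = a t"
  shows "t \<in> {0..T} \<Longrightarrow> a t \<in> range (\<lambda>y. F *v y)" "AE t in leb T. g t \<in> range (\<lambda>y. F *v y)"
proof -
  have PF: "ker_proj F *v (F *v y) = 0" for y
  proof -
    have "transpose (ker_proj F ** F) = 0"
      by (simp only: matrix_transpose_mul ker_proj_props(1,2))
    then have "ker_proj F ** F = transpose 0" by (metis transpose_transpose)
    also have "\<dots> = 0" by (simp add: transpose_def vec_eq_iff)
    finally show ?thesis by (simp add: matrix_vector_mul_assoc)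
  qed
  have pr: "primitive T (\<lambda>t. ker_proj F *v a t) (\<lambda>t. ker_proj F *v g t)"
    by (rule primitive_linear[OF matrix_vector_mul_bounded_linear a])
  have ae0: "AE t in leb T. ker_proj F *v a t = 0"
    using x by eventually_elim (metis PF)
  have zero: "ker_proj F *v a t = 0" if "t \<in> {0..T}" for t
    by (rule continuous_on_AE_eq[OF T primitive_continuous_on[OF pr] continuous_on_const ae0 that])
  then show "a t \<in> range (\<lambda>y. F *v y)" if "t \<in> {0..T}" for t
    using that by (intro ker_proj_zero_range) auto
  have "primitive T (\<lambda>t. ker_proj F *v a t) (\<lambda>t. 0)"
    using zero T by (intro primitiveI sqint_const finite_measure_Icc) auto
  from primitive_unique[OF T pr this]
  show "AE t in leb T. g t \<in> range (\<lambda>y. F *v y)"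
    by eventually_elim (rule ker_proj_zero_range)
qed

text \<open>Integration by parts of \<open>F x\<close> against the dual state in reversed time. Neither \<open>x\<close> nor \<open>q\<close> needs to be
  differentiable: the product is formed from the representatives \<open>a\<close> of \<open>F x\<close> and \<open>b\<close> of \<open>F^T q\<close>, with the
  pseudoinverse restoring the pairing of \<open>x\<close> with \<open>q\<close>.\<close>
lemma primal_dual_identity:
  fixes F A :: "real^'n^'m" and H :: "real^'n^'p"
  assumes T: "0 < T"
    and x: "sqint (leb T) x" and f: "sqint (leb T) f"
    and a: "primitive T a (\<lambda>t. A *v x t + f t)" "AE t in leb T. F *v x t = a t"
    and q: "sqint (leb T) q" and u: "sqint (leb T) u"
    and b: "primitive T b (\<lambda>t. transpose A *v q t - transpose H *v u t)"
      "AE t in leb T. transpose F *v q t = b t"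
  shows "a T \<bullet> (pinv (transpose F) *v b 0) - a 0 \<bullet> (pinv (transpose F) *v b T)
    = (LINT t|leb T. f t \<bullet> q (T - t) + (H *v x t) \<bullet> u (T - t))"
proof -
  let ?N = "pinv (transpose F)"
  define g where "g t = transpose A *v q t - transpose H *v u t" for t
  define B where "B x y = x \<bullet> (?N *v y)" for x :: "real^'m" and y :: "real^'n"
  have B: "bounded_bilinear B"
    unfolding B_def
    using bounded_bilinear.comp[OF bounded_bilinear_inner bounded_linear_ident matrix_vector_mul_bounded_linear[of ?N]]
    by simp
  have br: "primitive T (\<lambda>t. b (T - t)) (\<lambda>t. - g (T - t))"
    using primitive_reflect[OF b(1)] by (simp add: g_def)
  note pr = primitive_bilinear[OF B a(1) br]
  have gr: "AE t in leb T. g (T - t) \<in> range (\<lambda>y. transpose F *v y)"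
    using primitive_range(2)[OF T b] unfolding g_def by (rule AE_reflect)
  have qr: "AE t in leb T. transpose F *v q (T - t) = b (T - t)"
    using b(2) by (rule AE_reflect)
  have "AE t in leb T. B (a t) (- g (T - t)) + B (A *v x t + f t) (b (T - t))
       = f t \<bullet> q (T - t) + (H *v x t) \<bullet> u (T - t)"
    using a(2) qr gr primitive_range(2)[OF T a]
  proof eventually_elim
    case (elim t)
    obtain c where c: "g (T - t) = transpose F *v c" using elim(3) by blast
    have "(F *v x t) \<bullet> (?N *v (transpose F *v c)) = x t \<bullet> g (T - t)"
      by (subst range_inner_pinv) (auto simp: c inner_transpose_mult)
    then have "B (a t) (- g (T - t)) = - (x t \<bullet> g (T - t))"
      unfolding B_def c elim(1)[symmetric] by (metis c inner_minus_right vec.neg)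
    moreover have "B (A *v x t + f t) (b (T - t)) = (A *v x t + f t) \<bullet> q (T - t)"
      unfolding B_def elim(2)[symmetric] by (rule range_inner_pinv[OF elim(4)])
    ultimately show ?case
      by (simp add: g_def inner_diff_right inner_transpose_mult inner_add_left)
  qed
  moreover have "integrable (leb T) (\<lambda>t. f t \<bullet> q (T - t) + (H *v x t) \<bullet> u (T - t))"
    by (rule Bochner_Integration.integrable_add[OF sqint_inner_integrable[OF f sqint_reflect[OF q]]
        sqint_inner_integrable[OF sqint_matrix[OF x] sqint_reflect[OF u]]])
  ultimately have "(LINT t|leb T. B (a t) (- g (T - t)) + B (A *v x t + f t) (b (T - t)))
      = (LINT t|leb T. f t \<bullet> q (T - t) + (H *v x t) \<bullet> u (T - t))"
    using sqint_measurable[OF primitive_sqint[OF pr]]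
    by (intro integral_cong_AE) auto
  then show ?thesis
    using primitive_LINT[OF pr] T by (simp add: B_def)
qed

section \<open>Bounds for the worst-case error\<close>

lemma quadratic_form_Cauchy_Schwarz:
  fixes W :: "'b::euclidean_space \<Rightarrow> 'b"
  assumes W: "bounded_linear W" and sym: "\<And>x y. x \<bullet> W y = y \<bullet> W x" and pos: "\<And>x. 0 \<le> x \<bullet> W x"
    and g: "sqint M g" and h: "sqint M h"
  shows "(\<integral>t. g t \<bullet> W (h t) \<partial>M)\<^sup>2 \<le> (\<integral>t. g t \<bullet> W (g t) \<partial>M) * (\<integral>t. h t \<bullet> W (h t) \<partial>M)"
proof -
  note I = sqint_inner_integrable sqint_bounded_linear[OF W]
  define A B C where "A = (\<integral>t. g t \<bullet> W (g t) \<partial>M)" and "B = (\<integral>t. g t \<bullet> W (h t) \<partial>M)"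
    and "C = (\<integral>t. h t \<bullet> W (h t) \<partial>M)"
  have quad: "0 \<le> A + 2 * s * B + s\<^sup>2 * C" for s
  proof -
    have pw: "(g t + s *\<^sub>R h t) \<bullet> W (g t + s *\<^sub>R h t) = g t \<bullet> W (g t) + 2 * s * (g t \<bullet> W (h t)) + s\<^sup>2 * (h t \<bullet> W (h t))" for t
      using sym[of "h t" "g t"]
      by (simp add: linear_add[OF bounded_linear.linear[OF W]] linear_scale[OF bounded_linear.linear[OF W]]
          inner_add_left inner_add_right power2_eq_square algebra_simps)
    have "0 \<le> (\<integral>t. (g t + s *\<^sub>R h t) \<bullet> W (g t + s *\<^sub>R h t) \<partial>M)"
      by (intro integral_nonneg_AE AE_I2 pos)
    also have "\<dots> = (\<integral>t. g t \<bullet> W (g t) + 2 * s * (g t \<bullet> W (h t)) + s\<^sup>2 * (h t \<bullet> W (h t)) \<partial>M)"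
      by (simp only: pw)
    also have "(\<integral>t. g t \<bullet> W (g t) + 2 * s * (g t \<bullet> W (h t)) + s\<^sup>2 * (h t \<bullet> W (h t)) \<partial>M)
      = A + 2 * s * B + s\<^sup>2 * C"
      unfolding A_def B_def C_def using I(1)[OF g I(2)[OF g]] I(1)[OF g I(2)[OF h]] I(1)[OF h I(2)[OF h]] by simp
    finally show ?thesis .
  qed
  have AC: "A \<ge> 0" "C \<ge> 0" unfolding A_def C_def by (intro integral_nonneg_AE AE_I2 pos)+
  have "B\<^sup>2 \<le> A * C"
  proof (cases "C = 0")
    case True
    have "B = 0"
    proof (rule ccontr)
      assume "B \<noteq> 0"
      with quad[of "- (A + 1) / (2 * B)"] True show False by (simp add: field_simps)
    qed
    then show ?thesis using AC by simp
  next
    case False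
    then have "C > 0" using AC by simp
    have "0 \<le> (A + 2 * (- B / C) * B + (- B / C)\<^sup>2 * C) * C" using quad[of "- B / C"] AC by simp
    also have "\<dots> = A * C - B\<^sup>2" using \<open>C > 0\<close> by (simp add: power2_eq_square field_simps)
    finally show ?thesis by simp
  qed
  then show ?thesis by (simp add: A_def B_def C_def)
qed

text \<open>The weights of the initial value, the state disturbance and the output disturbance, as one linear map
  on triples. Its integrated quadratic form is the energy bounded by 1 for admissible solutions.\<close>
definition weight :: "real^'m^'m \<Rightarrow> real^'m^'m \<Rightarrow> real^'p^'p \<Rightarrow> (real^'m) \<times> (real^'m) \<times> (real^'p) \<Rightarrow> (real^'m) \<times> (real^'m) \<times> (real^'p)" where
  "weight Q0 Q R h = (Q0 *v fst h, Q *v fst (snd h), R *v snd (snd h))"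

lemma bounded_linear_weight: "bounded_linear (weight Q0 Q R)"
  unfolding weight_def
  by (intro bounded_linear_Pair bounded_linear_compose[OF matrix_vector_mul_bounded_linear]
      bounded_linear_compose[OF bounded_linear_fst] bounded_linear_compose[OF bounded_linear_snd]
      bounded_linear_fst bounded_linear_snd)

lemma weight_sym_pos:
  assumes "sym_pos_def Q0" "sym_pos_def Q" "sym_pos_def R"
  shows "x \<bullet> weight Q0 Q R y = y \<bullet> weight Q0 Q R x" "0 \<le> x \<bullet> weight Q0 Q R x"
proof -
  show "x \<bullet> weight Q0 Q R y = y \<bullet> weight Q0 Q R x"
    using sym_pos_def_inner_commute[OF assms(1), of "fst y" "fst x"] sym_pos_def_inner_commute[OF assms(2), of "fst (snd y)" "fst (snd x)"]
      sym_pos_def_inner_commute[OF assms(3), of "snd (snd y)" "snd (snd x)"]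
    by (simp add: weight_def inner_prod_def inner_commute)
  show "0 \<le> x \<bullet> weight Q0 Q R x"
    using sym_pos_def_nonneg[OF assms(1)] sym_pos_def_nonneg[OF assms(2)] sym_pos_def_nonneg[OF assms(3)]
    by (simp add: weight_def inner_prod_def)
qed

text \<open>A disturbance (initial value \<open>a\<close>, state disturbance \<open>f\<close>, output disturbance \<open>\<eta>\<close>) as a single function on
  \<open>{0..T}\<close>. The initial value becomes a constant function, scaled so that it is counted once after
  integration over an interval of length \<open>T\<close>.\<close>
definition triple :: "real \<Rightarrow> real^'m \<Rightarrow> (real \<Rightarrow> real^'m) \<Rightarrow> (real \<Rightarrow> real^'p) \<Rightarrow> real \<Rightarrow> (real^'m) \<times> (real^'m) \<times> (real^'p)" where
  "triple T a f \<eta> t = ((1 / sqrt T) *\<^sub>R a, f t, \<eta> t)"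

lemma triple_sqint:
  assumes "sqint (leb T) f" "sqint (leb T) \<eta>"
  shows "sqint (leb T) (triple T a f \<eta>)"
  using sqint_Pair[OF sqint_const[OF finite_measure_Icc, of 0 T "(1 / sqrt T) *\<^sub>R a"] sqint_Pair[OF assms]]
  by (simp add: triple_def[abs_def])

lemma LINT_triple_weight:
  assumes T: "0 < T" and sq: "sqint (leb T) f" "sqint (leb T) \<eta>"
    "sqint (leb T) f'" "sqint (leb T) \<eta>'"
  shows "(LINT t|leb T. triple T a f \<eta> t \<bullet> weight Q0 Q R (triple T a' f' \<eta>' t))
    = a \<bullet> (Q0 *v a') + (LINT t|leb T. f t \<bullet> (Q *v f' t) + \<eta> t \<bullet> (R *v \<eta>' t))"
proof -
  have "triple T a f \<eta> t \<bullet> weight Q0 Q R (triple T a' f' \<eta>' t)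
    = (a \<bullet> (Q0 *v a')) / T + (f t \<bullet> (Q *v f' t) + \<eta> t \<bullet> (R *v \<eta>' t))" for t
    using T by (simp add: triple_def weight_def inner_prod_def matrix_vector_mult_scaleR)
  moreover have "integrable (leb T) (\<lambda>t. f t \<bullet> (Q *v f' t) + \<eta> t \<bullet> (R *v \<eta>' t))"
    by (rule Bochner_Integration.integrable_add[OF sqint_inner_integrable[OF sq(1) sqint_matrix[OF sq(3)]]
        sqint_inner_integrable[OF sq(2) sqint_matrix[OF sq(4)]]])
  moreover have "(LINT t|leb T. (a \<bullet> (Q0 *v a')) / T) = a \<bullet> (Q0 *v a')"
    using T by (simp add: measure_restrict_space)
  ultimately show ?thesis
    by (simp add: Bochner_Integration.integral_add finite_measure.integrable_const[OF finite_measure_Icc])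
qed

text \<open>If the estimation error of \<open>U\<close> is the weighted inner product of the disturbance with
  \<open>(z, Q^(-1) w, - R^(-1) U)\<close>, then Cauchy-Schwarz bounds its square on the unit ellipsoid by the squared
  length \<open>J\<close> of that vector.\<close>
lemma worst_error_le:
  fixes F A :: "real^'n^'m" and H :: "real^'n^'p"
  assumes T: "0 < T" and pd: "sym_pos_def Q0" "sym_pos_def Q" "sym_pos_def R"
    and w: "sqint (leb T) w" and U: "sqint (leb T) U"
    and J: "J = z \<bullet> (Q0 *v z) + (LINT t|leb T. w t \<bullet> (matrix_inv Q *v w t) + U t \<bullet> (matrix_inv R *v U t))"
    and err: "\<And>x f y \<eta>. dae_sol F A H T x f y \<eta> \<Longrightarrow>
      l \<bullet> ac_rep {0..T} (\<lambda>t. F *v x t) T - observer_out U T y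
      = ac_rep {0..T} (\<lambda>t. F *v x t) 0 \<bullet> (Q0 *v z) + (LINT t|leb T. f t \<bullet> w t - \<eta> t \<bullet> U t)"
  shows "worst_error F A H Q0 Q R U l T \<le> ereal J"
proof -
  have "(l \<bullet> ac_rep {0..T} (\<lambda>t. F *v x t) T - observer_out U T y)\<^sup>2 \<le> J"
    if adm: "(x, f, y, \<eta>) \<in> admissible_sols F A H Q0 Q R T" for x f y \<eta>
  proof -
    let ?a = "ac_rep {0..T} (\<lambda>t. F *v x t)"
    let ?hs = "triple T z (\<lambda>t. matrix_inv Q *v w t) (\<lambda>t. - (matrix_inv R *v U t))"
    let ?h = "triple T (?a 0) f \<eta>"
    have sol: "dae_sol F A H T x f y \<eta>"
      and cost: "?a 0 \<bullet> (Q0 *v ?a 0) + (LINT t|leb T. f t \<bullet> (Q *v f t) + \<eta> t \<bullet> (R *v \<eta> t)) \<le> 1"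
      using adm T by (auto simp: admissible_sols_def)
    have sq: "sqint (leb T) f" "sqint (leb T) \<eta>"
      using sol by (auto simp: dae_sol_iff[OF T])
    have sq': "sqint (leb T) (\<lambda>t. matrix_inv Q *v w t)" "sqint (leb T) (\<lambda>t. - (matrix_inv R *v U t))"
      by (rule sqint_matrix[OF w] sqint_uminus[OF sqint_matrix[OF U]])+
    have 1: "(LINT t|leb T. ?h t \<bullet> weight Q0 Q R (?hs t)) = l \<bullet> ?a T - observer_out U T y"
      unfolding LINT_triple_weight[OF T sq sq'] err[OF sol] vec.neg
      by (simp add: sym_pos_def_inv_vec pd)
    have 2: "(LINT t|leb T. ?h t \<bullet> weight Q0 Q R (?h t)) \<le> 1"
      unfolding LINT_triple_weight[OF T sq sq] by (rule cost)
    have 3: "(LINT t|leb T. ?hs t \<bullet> weight Q0 Q R (?hs t)) = J"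
      unfolding LINT_triple_weight[OF T sq' sq'] J vec.neg
      by (simp add: sym_pos_def_inv_vec pd inner_commute)
    have "(l \<bullet> ?a T - observer_out U T y)\<^sup>2 \<le> (LINT t|leb T. ?h t \<bullet> weight Q0 Q R (?h t)) * J"
      using quadratic_form_Cauchy_Schwarz[OF bounded_linear_weight weight_sym_pos[OF pd]
          triple_sqint[OF sq] triple_sqint[OF sq'], of "?a 0" z] unfolding 1 3 .
    also have "\<dots> \<le> 1 * J"
    proof (rule mult_right_mono[OF 2])
      show "0 \<le> J" unfolding 3[symmetric] by (intro integral_nonneg_AE AE_I2 weight_sym_pos[OF pd])
    qed
    finally show ?thesis by simp
  qed
  then show ?thesis
    unfolding worst_error_def by (intro SUP_least) (auto simp del: ereal_power)
qed

text \<open>The disturbance that makes a state \<open>x\<close> with derivative \<open>\<xi>\<close> a solution of the DAE with output \<open>y = 0\<close>. Any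
  linear observer returns 0 on that output.\<close>
definition state_defect ::
  "real^'n^'m \<Rightarrow> real^'n^'m \<Rightarrow> real^'n^'p \<Rightarrow> real \<Rightarrow> (real \<Rightarrow> real^'n) \<Rightarrow> (real \<Rightarrow> real^'n) \<Rightarrow> real \<Rightarrow> (real^'m) \<times> (real^'m) \<times> (real^'p)" where
  "state_defect F A H T x \<xi> = triple T (F *v x 0) (\<lambda>t. F *v \<xi> t - A *v x t) (\<lambda>t. - (H *v x t))"

lemma state_defect_sqint:
  assumes "primitive T x \<xi>"
  shows "sqint (leb T) x" "sqint (leb T) (\<lambda>t. F *v \<xi> t - A *v x t)"
    "sqint (leb T) (\<lambda>t. - (H *v x t))"
    "sqint (leb T) (state_defect F A H T x \<xi>)"
proof -
  show x: "sqint (leb T) x"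
    by (rule sqint_continuous_on[OF primitive_continuous_on[OF assms]])
  show f: "sqint (leb T) (\<lambda>t. F *v \<xi> t - A *v x t)"
    by (rule sqint_diff[OF sqint_matrix[OF primitive_sqint[OF assms]] sqint_matrix[OF x]])
  show h: "sqint (leb T) (\<lambda>t. - (H *v x t))"
    by (rule sqint_uminus[OF sqint_matrix[OF x]])
  show "sqint (leb T) (state_defect F A H T x \<xi>)"
    unfolding state_defect_def by (rule triple_sqint[OF f h])
qed

text \<open>The lemma of DuBois and Reymond: a functional of \<open>x\<close> and its derivative that vanishes for all \<open>x\<close>
  determines a differential equation with boundary values. Testing with derivatives that are merely
  square-integrable makes the difference \<open>w - G\<close> itself an admissible test function.\<close>
lemma dubois_reymond:
  fixes c0 :: "real^'n"
  assumes T: "0 < T" and w: "sqint (leb T) w" and \<gamma>: "sqint (leb T) \<gamma>"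
    and van: "\<And>x \<xi>. primitive T x \<xi> \<Longrightarrow>
      c0 \<bullet> x 0 + (LINT t|leb T. w t \<bullet> \<xi> t + \<gamma> t \<bullet> x t) = 0"
  obtains G where "primitive T G \<gamma>" "AE t in leb T. w t = G t" "G 0 = c0" "G T = 0"
proof -
  define G where "G t = c0 + integral {0..t} \<gamma>" for t
  have G: "primitive T G \<gamma>" unfolding G_def by (rule primitive_indefinite[OF \<gamma>])
  have G0: "G 0 = c0" by (simp add: G_def)
  note Gsq = sqint_continuous_on[OF primitive_continuous_on[OF G]]
  have key: "(LINT t|leb T. (w t - G t) \<bullet> \<xi> t) + G T \<bullet> x T = 0"
    if x: "primitive T x \<xi>" for x \<xi>
  proof -
    note xi = primitive_sqint[OF x] and xs = sqint_continuous_on[OF primitive_continuous_on[OF x]]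
    note I = sqint_inner_integrable
    have "G T \<bullet> x T - G 0 \<bullet> x 0 = (LINT t|leb T. G t \<bullet> \<xi> t + \<gamma> t \<bullet> x t)"
      using primitive_LINT[OF primitive_bilinear[OF bounded_bilinear_inner G x]] T by simp
    then show ?thesis
      using van[OF x] G0 I[OF w xi] I[OF Gsq xi] I[OF \<gamma> xs] by (simp add: inner_diff_left)
  qed
  have wG: "sqint (leb T) (\<lambda>t. w t - G t)" by (rule sqint_diff[OF w Gsq])
  \<comment> \<open>The test function has derivative \<open>w - G\<close> and vanishes at \<open>T\<close>.\<close>
  define x where "x t = - integral {0..T} (\<lambda>t. w t - G t) + integral {0..t} (\<lambda>t. w t - G t)" for t
  have "primitive T x (\<lambda>t. w t - G t)" unfolding x_def by (rule primitive_indefinite[OF wG])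
  from key[OF this] have "(LINT t|leb T. (w t - G t) \<bullet> (w t - G t)) = 0" by (simp add: x_def)
  then have "AE t in leb T. (w t - G t) \<bullet> (w t - G t) = 0"
    using sqint_inner_integrable[OF wG wG] by (subst (asm) integral_nonneg_eq_0_iff_AE) auto
  then have ae: "AE t in leb T. w t = G t" by eventually_elim simp
  have "primitive T (\<lambda>t. G T) (\<lambda>t. 0)"
    by (intro primitiveI sqint_const finite_measure_Icc) simp
  from key[OF this] have "G T = 0" by simp
  with G ae G0 show ?thesis by (rule that)
qed

text \<open>The disturbances of solutions with zero output come arbitrarily close to \<open>(z, w, - U)\<close>, provided that
  this vector is orthogonal to all dual solutions with \<open>F^T q(0) = 0\<close>: by the lemma of DuBois and Reymond,
  what is orthogonal to the zero-output disturbances is, in reversed time, such a dual solution.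
  The vector need not itself be such a disturbance, since for DAEs of higher index the set of these
  disturbances need not be closed.\<close>
lemma state_defect_approx:
  fixes F A :: "real^'n^'m" and H :: "real^'n^'p"
  assumes T: "0 < T"
    and w: "sqint (leb T) w" and U: "sqint (leb T) U"
    and orth: "\<And>q u b c. \<lbrakk>sqint (leb T) q; sqint (leb T) u;
        primitive T b (\<lambda>t. transpose A *v q t - transpose H *v u t);
        AE t in leb T. transpose F *v q t = b t; b 0 = 0; b T = transpose F *v c\<rbrakk> \<Longrightarrow>
        z \<bullet> c + (LINT t|leb T. q t \<bullet> w (T - t) + u t \<bullet> U (T - t)) = 0"
    and e: "0 < e"
  shows "\<exists>x \<xi>. primitive T x \<xi> \<and>
    (LINT t|leb T. (norm (triple T z w (\<lambda>t. - U t) t - state_defect F A H T x \<xi> t))\<^sup>2) < e"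
proof -
  let ?M = "leb T"
  define Y where "Y = {state_defect F A H T x \<xi> | x \<xi>. primitive T x \<xi>}"
  let ?hs = "triple T z w (\<lambda>t. - U t)"
  have "\<exists>g\<in>Y. (\<integral>t. (norm (?hs t - g t))\<^sup>2 \<partial>?M) < e"
  proof (rule L2_approx_by_subspace[OF finite_measure_Icc triple_sqint[OF w sqint_uminus[OF U]] _ _ _ _ e])
    show "sqint ?M g" if "g \<in> Y" for g
      using that state_defect_sqint(4) by (auto simp: Y_def)
    have "primitive T (\<lambda>t. 0 :: real^'n) (\<lambda>t. 0)"
      by (intro primitiveI sqint_const finite_measure_Icc) simp
    moreover have "(\<lambda>t. 0) = state_defect F A H T (\<lambda>t. 0) (\<lambda>t. 0)"
      by (simp add: state_defect_def triple_def fun_eq_iff zero_prod_def)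
    ultimately show "(\<lambda>t. 0) \<in> Y" unfolding Y_def by blast
    show "(\<lambda>t. f t + c *\<^sub>R g t) \<in> Y" if fY: "f \<in> Y" and gY: "g \<in> Y" for f g c
    proof -
      obtain x \<xi> where f: "f = state_defect F A H T x \<xi>" "primitive T x \<xi>" using fY by (auto simp: Y_def)
      obtain x' \<xi>' where g: "g = state_defect F A H T x' \<xi>'" "primitive T x' \<xi>'" using gY by (auto simp: Y_def)
      have "(\<lambda>t. f t + c *\<^sub>R g t) = state_defect F A H T (\<lambda>t. x t + c *\<^sub>R x' t) (\<lambda>t. \<xi> t + c *\<^sub>R \<xi>' t)"
        by (simp add: f g state_defect_def triple_def fun_eq_iff matrix_vector_right_distrib
            matrix_vector_mult_scaleR algebra_simps)
      then show ?thesis unfolding Y_def using primitive_add_scaleR[OF f(2) g(2)] by blast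
    qed
    fix \<rho> :: "real \<Rightarrow> (real^'m) \<times> (real^'m) \<times> (real^'p)"
    assume \<rho>: "sqint ?M \<rho>" and perp: "\<And>g. g \<in> Y \<Longrightarrow> (\<integral>t. \<rho> t \<bullet> g t \<partial>?M) = 0"
    define r1 where "r1 t = fst (\<rho> t)" for t
    define r2 where "r2 t = fst (snd (\<rho> t))" for t
    define r3 where "r3 t = snd (snd (\<rho> t))" for t
    have r: "sqint ?M r1" "sqint ?M r2" "sqint ?M r3"
      unfolding r1_def r2_def r3_def using \<rho> by (auto intro: sqint_fst sqint_snd)
    define c where "c = (1 / sqrt T) *\<^sub>R (LINT t|?M. r1 t)"
    note I = sqint_inner_integrable
    have \<rho>tr: "(\<integral>t. \<rho> t \<bullet> triple T a f \<eta> t \<partial>?M) = c \<bullet> a + (LINT t|?M. r2 t \<bullet> f t + r3 t \<bullet> \<eta> t)"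
      if f: "sqint ?M f" and \<eta>: "sqint ?M \<eta>" for a f \<eta>
    proof -
      have "\<rho> t \<bullet> triple T a f \<eta> t = (1 / sqrt T) * (r1 t \<bullet> a) + (r2 t \<bullet> f t + r3 t \<bullet> \<eta> t)" for t
        by (simp add: inner_prod_def triple_def r1_def r2_def r3_def)
      moreover have "integrable ?M (\<lambda>t. r1 t \<bullet> a)"
        by (rule I[OF r(1) sqint_const[OF finite_measure_Icc]])
      moreover have "(LINT t|?M. r1 t \<bullet> a) = (LINT t|?M. r1 t) \<bullet> a"
        using sqint_integrable[OF finite_measure_Icc r(1)] by simp
      ultimately show ?thesis using I[OF r(2) f] I[OF r(3) \<eta>] by (simp add: c_def)
    qed
    define \<gamma> where "\<gamma> t = - (transpose A *v r2 t) - transpose H *v r3 t" for t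
    have \<gamma>: "sqint ?M \<gamma>"
      unfolding \<gamma>_def by (rule sqint_diff[OF sqint_uminus[OF sqint_matrix[OF r(2)]] sqint_matrix[OF r(3)]])
    have van: "(transpose F *v c) \<bullet> x 0 + (LINT t|?M. (transpose F *v r2 t) \<bullet> \<xi> t + \<gamma> t \<bullet> x t) = 0"
      if x: "primitive T x \<xi>" for x \<xi>
    proof -
      have "state_defect F A H T x \<xi> \<in> Y" using x by (auto simp: Y_def)
      from perp[OF this]
      have "c \<bullet> (F *v x 0) + (LINT t|?M. r2 t \<bullet> (F *v \<xi> t - A *v x t) + r3 t \<bullet> (- (H *v x t))) = 0"
        unfolding state_defect_def \<rho>tr[OF state_defect_sqint(2,3)[OF x]] .
      moreover have "r2 t \<bullet> (F *v \<xi> t - A *v x t) + r3 t \<bullet> (- (H *v x t)) = (transpose F *v r2 t) \<bullet> \<xi> t + \<gamma> t \<bullet> x t" for t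
        by (simp add: \<gamma>_def inner_diff_right inner_diff_left inner_mult_transpose)
      ultimately show ?thesis by (simp add: inner_mult_transpose)
    qed
    obtain G where G: "primitive T G \<gamma>" "AE t in ?M. transpose F *v r2 t = G t" "G 0 = transpose F *v c" "G T = 0"
      using dubois_reymond[OF T sqint_matrix[OF r(2)] \<gamma> van] by blast
    have "z \<bullet> c + (LINT t|?M. r2 (T - t) \<bullet> w (T - t) + (- r3 (T - t)) \<bullet> U (T - t)) = 0"
    proof (rule orth)
      show "sqint ?M (\<lambda>t. r2 (T - t))" "sqint ?M (\<lambda>t. - r3 (T - t))"
        by (rule sqint_reflect[OF r(2)] sqint_uminus[OF sqint_reflect[OF r(3)]])+
      have "(\<lambda>t. - \<gamma> (T - t)) = (\<lambda>t. transpose A *v r2 (T - t) - transpose H *v (- r3 (T - t)))"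
        unfolding \<gamma>_def vec.neg by (simp add: fun_eq_iff)
      with primitive_reflect[OF G(1)]
      show "primitive T (\<lambda>t. G (T - t)) (\<lambda>t. transpose A *v r2 (T - t) - transpose H *v (- r3 (T - t)))" by simp
      show "AE t in ?M. transpose F *v r2 (T - t) = G (T - t)" by (rule AE_reflect[OF G(2)])
    qed (use G in auto)
    moreover have "(LINT t|?M. r2 (T - t) \<bullet> w (T - t) + (- r3 (T - t)) \<bullet> U (T - t)) = (LINT t|?M. r2 t \<bullet> w t + r3 t \<bullet> (- U t))"
      using LINT_reflect[of T "\<lambda>t. r2 t \<bullet> w t + r3 t \<bullet> (- U t)"]
        I[OF r(2) w] I[OF r(3) U] I[OF sqint_reflect[OF r(2)] sqint_reflect[OF w]] I[OF sqint_reflect[OF r(3)] sqint_reflect[OF U]]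
      by simp
    ultimately show "(\<integral>t. \<rho> t \<bullet> ?hs t \<partial>?M) = 0"
      unfolding \<rho>tr[OF w sqint_uminus[OF U]] by (simp add: inner_commute)
  qed
  then show ?thesis unfolding Y_def by blast
qed

text \<open>A zero-output solution with disturbance energy \<open>c\<close> is admissible after division by \<open>sqrt c\<close>. The
  constraint at earlier times follows from the one at \<open>T\<close>, the integrand being nonnegative.\<close>
lemma scaled_state_admissible:
  fixes F A :: "real^'n^'m" and H :: "real^'n^'p"
  assumes T: "0 < T" and pd: "sym_pos_def Q0" "sym_pos_def Q" "sym_pos_def R"
    and x: "primitive T x \<xi>"
  defines "c \<equiv> LINT t|leb T. state_defect F A H T x \<xi> t \<bullet> weight Q0 Q R (state_defect F A H T x \<xi> t)"
  assumes c: "c > 0"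
  shows "(\<lambda>t. (1 / sqrt c) *\<^sub>R x t, \<lambda>t. (1 / sqrt c) *\<^sub>R (F *v \<xi> t - A *v x t), \<lambda>t. 0, \<lambda>t. (1 / sqrt c) *\<^sub>R (- (H *v x t)))
      \<in> admissible_sols F A H Q0 Q R T"
    and "t \<in> {0..T} \<Longrightarrow> ac_rep {0..T} (\<lambda>t. F *v ((1 / sqrt c) *\<^sub>R x t)) t = (1 / sqrt c) *\<^sub>R (F *v x t)"
proof -
  let ?s = "1 / sqrt c"
  let ?f = "\<lambda>t. F *v \<xi> t - A *v x t" and ?\<eta> = "\<lambda>t. - (H *v x t)"
  have pr: "primitive T (\<lambda>t. ?s *\<^sub>R (F *v x t)) (\<lambda>t. ?s *\<^sub>R (F *v \<xi> t))"
    by (intro primitive_linear[OF bounded_linear_scaleR_right] primitive_linear[OF matrix_vector_mul_bounded_linear x])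
  have "(\<lambda>t. ?s *\<^sub>R (F *v \<xi> t)) = (\<lambda>t. A *v (?s *\<^sub>R x t) + ?s *\<^sub>R ?f t)"
    by (simp add: matrix_vector_mult_scaleR algebra_simps)
  with pr have pr': "primitive T (\<lambda>t. ?s *\<^sub>R (F *v x t)) (\<lambda>t. A *v (?s *\<^sub>R x t) + ?s *\<^sub>R ?f t)" by simp
  have ae: "AE t in leb T. F *v (?s *\<^sub>R x t) = ?s *\<^sub>R (F *v x t)"
    by (simp add: matrix_vector_mult_scaleR)
  note rep = ac_rep_eq[OF T is_ac_rep_primitive[OF pr' ae]]
  then show "t \<in> {0..T} \<Longrightarrow> ac_rep {0..T} (\<lambda>t. F *v ((1 / sqrt c) *\<^sub>R x t)) t = (1 / sqrt c) *\<^sub>R (F *v x t)" .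
  note sq = state_defect_sqint[OF x]
  have "dae_sol F A H T (\<lambda>t. ?s *\<^sub>R x t) (\<lambda>t. ?s *\<^sub>R ?f t) (\<lambda>t. 0) (\<lambda>t. ?s *\<^sub>R ?\<eta> t)"
    unfolding dae_sol_iff[OF T]
  proof (intro conjI)
    show "\<exists>a. primitive T a (\<lambda>t. A *v (?s *\<^sub>R x t) + ?s *\<^sub>R ?f t) \<and> (AE t in leb T. F *v (?s *\<^sub>R x t) = a t)"
      using pr' ae by blast
    show "AE t in leb T. 0 = H *v (?s *\<^sub>R x t) + ?s *\<^sub>R ?\<eta> t"
      by (simp add: matrix_vector_mult_scaleR)
  qed (rule sqint_scaleR sq(1,2,3) sqint_const finite_measure_Icc)+
  moreover have "ac_rep {0..T} (\<lambda>t. F *v (?s *\<^sub>R x t)) 0 \<bullet> (Q0 *v ac_rep {0..T} (\<lambda>t. F *v (?s *\<^sub>R x t)) 0) +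
        (LINT t|lebesgue_on {0..\<tau>}. (?s *\<^sub>R ?f t) \<bullet> (Q *v (?s *\<^sub>R ?f t)) + (?s *\<^sub>R ?\<eta> t) \<bullet> (R *v (?s *\<^sub>R ?\<eta> t))) \<le> 1"
    if \<tau>: "\<tau> \<in> {0..T}" for \<tau>
  proof -
    let ?k = "\<lambda>t. ?f t \<bullet> (Q *v ?f t) + ?\<eta> t \<bullet> (R *v ?\<eta> t)"
    have sub: "{0..\<tau>} \<subseteq> {0..T}" using \<tau> by auto
    have kint: "integrable (leb T) ?k"
      by (rule Bochner_Integration.integrable_add[OF sqint_inner_integrable[OF sq(2) sqint_matrix[OF sq(2)]]
        sqint_inner_integrable[OF sq(3) sqint_matrix[OF sq(3)]]])
    have kint': "integrable (lebesgue_on {0..\<tau>}) ?k" by (rule integrable_subinterval[OF kint sub])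
    have kpos: "0 \<le> ?k t" for t using sym_pos_def_nonneg[OF pd(2)] sym_pos_def_nonneg[OF pd(3)] by (meson add_nonneg_nonneg)
    have sc: "(?s *\<^sub>R ?f t) \<bullet> (Q *v (?s *\<^sub>R ?f t)) + (?s *\<^sub>R ?\<eta> t) \<bullet> (R *v (?s *\<^sub>R ?\<eta> t)) = (1 / c) * ?k t" for t
      using c unfolding matrix_vector_mult_scaleR
      by (simp add: algebra_simps add_divide_distrib power2_eq_square)
    have "(LINT t|lebesgue_on {0..\<tau>}. ?k t) \<le> (LINT t|leb T. ?k t)"
    proof -
      have "integral {0..\<tau>} ?k \<le> integral {0..T} ?k"
        by (rule integral_subset_le[OF sub integrable_on_lebesgue_on[OF kint'] integrable_on_lebesgue_on[OF kint]])
           (use kpos in auto)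
      moreover have "(LINT t|lebesgue_on {0..\<tau>}. ?k t) = integral {0..\<tau>} ?k"
        by (rule lebesgue_integral_eq_integral[OF kint']) simp
      moreover have "(LINT t|leb T. ?k t) = integral {0..T} ?k"
        by (rule lebesgue_integral_eq_integral[OF kint]) simp
      ultimately show ?thesis by linarith
    qed
    then have "(F *v x 0) \<bullet> (Q0 *v (F *v x 0)) + (LINT t|lebesgue_on {0..\<tau>}. ?k t) \<le> c"
      unfolding c_def state_defect_def
        LINT_triple_weight[OF T state_defect_sqint(2)[OF x] state_defect_sqint(3)[OF x]
          state_defect_sqint(2)[OF x] state_defect_sqint(3)[OF x]] by simp
    then have "(1 / c) * ((F *v x 0) \<bullet> (Q0 *v (F *v x 0)) + (LINT t|lebesgue_on {0..\<tau>}. ?k t)) \<le> 1"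
      using c by (simp add: field_simps)
    moreover have "(LINT t|lebesgue_on {0..\<tau>}. (?s *\<^sub>R ?f t) \<bullet> (Q *v (?s *\<^sub>R ?f t)) + (?s *\<^sub>R ?\<eta> t) \<bullet> (R *v (?s *\<^sub>R ?\<eta> t)))
      = (1 / c) * (LINT t|lebesgue_on {0..\<tau>}. ?k t)"
      unfolding sc by simp
    moreover have "(?s *\<^sub>R (F *v x 0)) \<bullet> (Q0 *v (?s *\<^sub>R (F *v x 0))) = (1 / c) * ((F *v x 0) \<bullet> (Q0 *v (F *v x 0)))"
      using c unfolding matrix_vector_mult_scaleR by (simp add: power2_eq_square)
    ultimately show ?thesis using rep[of 0] T by (simp add: distrib_left)
  qed
  ultimately show "(\<lambda>t. ?s *\<^sub>R x t, \<lambda>t. ?s *\<^sub>R ?f t, \<lambda>t. 0, \<lambda>t. ?s *\<^sub>R ?\<eta> t) \<in> admissible_sols F A H Q0 Q R T"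
    by (simp add: admissible_sols_def)
qed

text \<open>Every observer \<open>V\<close> has worst-case squared error at least \<open>J\<close>. Solutions with zero output are indistinguishable
  from the zero solution, so their error does not depend on \<open>V\<close> and may be computed with \<open>U\<close>; as their
  disturbance approaches the extremal one, the squared error of the normalised solution approaches \<open>J\<close>.\<close>
lemma worst_error_ge:
  fixes F A :: "real^'n^'m" and H :: "real^'n^'p"
  assumes T: "0 < T" and pd: "sym_pos_def Q0" "sym_pos_def Q" "sym_pos_def R"
    and w: "sqint (leb T) w" and U: "sqint (leb T) U"
    and J: "J = z \<bullet> (Q0 *v z) + (LINT t|leb T. w t \<bullet> (matrix_inv Q *v w t) + U t \<bullet> (matrix_inv R *v U t))"
    and err: "\<And>x f y \<eta>. dae_sol F A H T x f y \<eta> \<Longrightarrow>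
      l \<bullet> ac_rep {0..T} (\<lambda>t. F *v x t) T - observer_out U T y
      = ac_rep {0..T} (\<lambda>t. F *v x t) 0 \<bullet> (Q0 *v z) + (LINT t|leb T. f t \<bullet> w t - \<eta> t \<bullet> U t)"
    and orth: "\<And>q u b c. \<lbrakk>sqint (leb T) q; sqint (leb T) u;
        primitive T b (\<lambda>t. transpose A *v q t - transpose H *v u t);
        AE t in leb T. transpose F *v q t = b t; b 0 = 0; b T = transpose F *v c\<rbrakk> \<Longrightarrow>
        z \<bullet> c + (LINT t|leb T. q t \<bullet> (matrix_inv Q *v w (T - t)) + u t \<bullet> (matrix_inv R *v U (T - t))) = 0"
  shows "ereal J \<le> worst_error F A H Q0 Q R V l T"
  unfolding worst_error_def le_SUP_iff
proof (intro allI impI)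
  fix y0 assume y0: "y0 < ereal J"
  let ?M = "leb T" and ?W = "weight Q0 Q R"
  let ?hs = "triple T z (\<lambda>t. matrix_inv Q *v w t) (\<lambda>t. - (matrix_inv R *v U t))"
  have sq': "sqint ?M (\<lambda>t. matrix_inv Q *v w t)" "sqint ?M (\<lambda>t. matrix_inv R *v U t)"
    by (rule sqint_matrix[OF w] sqint_matrix[OF U])+
  note hs = triple_sqint[OF sq'(1) sqint_uminus[OF sq'(2)], of z]
  have Jhs: "(LINT t|?M. ?hs t \<bullet> ?W (?hs t)) = J"
    unfolding LINT_triple_weight[OF T sq'(1) sqint_uminus[OF sq'(2)] sq'(1) sqint_uminus[OF sq'(2)]] J vec.neg
    by (simp add: sym_pos_def_inv_vec pd inner_commute)
  have Jnn: "J \<ge> 0" unfolding Jhs[symmetric] by (intro integral_nonneg_AE AE_I2 weight_sym_pos[OF pd])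
  define c where "c = (if y0 = -\<infinity> then -1 else real_of_ereal y0)"
  have cJ: "c < J" "y0 \<le> ereal c" using y0 Jnn by (cases y0; simp add: c_def)+
  obtain K where K: "K > 0" "\<And>h. norm (?W h) \<le> norm h * K"
    using bounded_linear.pos_bounded[OF bounded_linear_weight] by metis
  show "\<exists>i\<in>admissible_sols F A H Q0 Q R T. y0 <
      (case i of (x, f, y, \<eta>) \<Rightarrow> ereal ((l \<bullet> ac_rep {0..T} (\<lambda>t. F *v x t) T - observer_out V T y)\<^sup>2))"
  proof (cases "J = 0")
    case True
    have pr0: "primitive T (\<lambda>t. 0 :: real^'m) (\<lambda>t. 0)"
      by (intro primitiveI sqint_const finite_measure_Icc) simp
    have rep: "ac_rep {0..T} (\<lambda>t. 0 :: real^'m) t = 0" if "t \<in> {0..T}" for t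
      by (rule ac_rep_eq[OF T is_ac_rep_primitive[OF pr0] that]) simp
    have "dae_sol F A H T (\<lambda>t. 0) (\<lambda>t. 0) (\<lambda>t. 0) (\<lambda>t. 0)"
      unfolding dae_sol_iff[OF T] using pr0 by (auto intro: sqint_const finite_measure_Icc exI[of _ "\<lambda>t. 0"])
    then have "(\<lambda>t. 0, \<lambda>t. 0, \<lambda>t. 0, \<lambda>t. 0) \<in> admissible_sols F A H Q0 Q R T"
      using rep[of 0] T by (simp add: admissible_sols_def)
    moreover have "y0 < ereal ((l \<bullet> ac_rep {0..T} (\<lambda>t. F *v (\<lambda>t. 0) t) T - observer_out V T (\<lambda>t. 0))\<^sup>2)"
      using y0 True by (intro less_le_trans[OF y0]) simp
    ultimately show ?thesis by (intro bexI[of _ "(\<lambda>t. 0, \<lambda>t. 0, \<lambda>t. 0, \<lambda>t. 0)"]) auto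
  next
    case False
    then have Jp: "J > 0" using Jnn by simp
    \<comment> \<open>The first bound keeps the energy \<open>C\<close> above \<open>J / 2\<close>, and the second brings the quotient \<open>Er\<^sup>2 / C\<close> above \<open>c\<close>.\<close>
    define \<delta> where "\<delta> = min (J / 16) ((J - c) / 4)"
    have \<delta>: "\<delta> > 0" using Jp cJ by (simp add: \<delta>_def)
    have "\<delta> / K > 0" using \<delta> K by simp
    have "\<exists>x \<xi>. primitive T x \<xi> \<and>
      (LINT t|?M. (norm (?hs t - state_defect F A H T x \<xi> t))\<^sup>2) < \<delta> / K"
      by (rule state_defect_approx[OF T sq'(1) sq'(2) _ \<open>\<delta> / K > 0\<close>]) (rule orth)
    then obtain x \<xi> where x: "primitive T x \<xi>"
      and app: "(LINT t|?M. (norm (?hs t - state_defect F A H T x \<xi> t))\<^sup>2) < \<delta> / K"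
      by blast
    let ?g = "state_defect F A H T x \<xi>"
    let ?d = "\<lambda>t. ?hs t - ?g t"
    note g = state_defect_sqint(4)[OF x, of F A H]
    note sq = state_defect_sqint[OF x]
    note d = sqint_diff[OF hs g]
    note I = sqint_inner_integrable sqint_bounded_linear[OF bounded_linear_weight, of _ _ Q0 Q R]
    define D where "D = (LINT t|?M. ?d t \<bullet> ?W (?d t))"
    define X where "X = (LINT t|?M. ?hs t \<bullet> ?W (?d t))"
    define C where "C = (LINT t|?M. ?g t \<bullet> ?W (?g t))"
    define Er where "Er = (LINT t|?M. ?g t \<bullet> ?W (?hs t))"
    have D\<delta>: "D < \<delta>"
    proof -
      have "D \<le> (LINT t|?M. K * (norm (?d t))\<^sup>2)"
        unfolding D_def
      proof (rule integral_mono)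
        show "integrable ?M (\<lambda>t. ?d t \<bullet> ?W (?d t))" by (rule I(1)[OF d I(2)[OF d]])
        show "integrable ?M (\<lambda>t. K * (norm (?d t))\<^sup>2)" using d by (simp add: sqint_def)
        fix t
        have "?d t \<bullet> ?W (?d t) \<le> norm (?d t) * norm (?W (?d t))" by (rule norm_cauchy_schwarz)
        also have "\<dots> \<le> norm (?d t) * (norm (?d t) * K)" by (intro mult_left_mono K) simp
        finally show "?d t \<bullet> ?W (?d t) \<le> K * (norm (?d t))\<^sup>2" by (simp add: power2_eq_square ac_simps)
      qed
      also have "\<dots> = K * (LINT t|?M. (norm (?d t))\<^sup>2)" by simp
      also have "\<dots> < K * (\<delta> / K)" using app K(1) by (rule mult_strict_left_mono)
      finally show ?thesis using K by simp
    qed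
    have XD: "X\<^sup>2 \<le> J * D"
      using quadratic_form_Cauchy_Schwarz[OF bounded_linear_weight weight_sym_pos[OF pd] hs d]
      unfolding X_def D_def Jhs .
    have Wd: "?W (a - b) = ?W a - ?W b" for a b by (rule linear_diff[OF bounded_linear.linear[OF bounded_linear_weight]])
    note sym = weight_sym_pos(1)[OF pd]
    have ErX: "Er = J - X"
    proof -
      have "?g t \<bullet> ?W (?hs t) = ?hs t \<bullet> ?W (?hs t) - ?hs t \<bullet> ?W (?d t)" for t
        using sym[of "?g t" "?hs t"] by (simp add: Wd inner_diff_right)
      then show ?thesis
        unfolding Er_def X_def Jhs[symmetric] using I(1)[OF hs I(2)[OF hs]] I(1)[OF hs I(2)[OF d]] by simp
    qed
    have CX: "C = J - 2 * X + D"
    proof -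
      have "?g t \<bullet> ?W (?g t) = ?hs t \<bullet> ?W (?hs t) - 2 * (?hs t \<bullet> ?W (?d t)) + ?d t \<bullet> ?W (?d t)" for t
        using sym[of "?g t" "?hs t"] by (simp add: Wd inner_diff_right inner_diff_left)
      then show ?thesis
        unfolding C_def X_def D_def Jhs[symmetric]
        using I(1)[OF hs I(2)[OF hs]] I(1)[OF hs I(2)[OF d]] I(1)[OF d I(2)[OF d]] by simp
    qed
    have Dnn: "D \<ge> 0" unfolding D_def by (intro integral_nonneg_AE AE_I2 weight_sym_pos[OF pd])
    have "X\<^sup>2 \<le> (J / 4)\<^sup>2"
    proof -
      have "J * D \<le> J * (J / 16)" using D\<delta> Jp by (intro mult_left_mono) (auto simp: \<delta>_def)
      then show ?thesis using XD by (simp add: power2_eq_square)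
    qed
    then have "\<bar>X\<bar> \<le> J / 4" using Jp by (metis abs_le_square_iff abs_of_pos divide_pos_pos zero_less_numeral)
    then have CJ: "C \<ge> J / 2" using CX Dnn by linarith
    have Cp: "C > 0" using CJ Jp by linarith
    have "c * C < Er\<^sup>2"
    proof -
      have "Er\<^sup>2 = J * C + X\<^sup>2 - J * D" unfolding ErX CX by (simp add: power2_eq_square algebra_simps)
      moreover have "J * D < (J - c) * C"
      proof -
        have "J * D < J * ((J - c) / 2)" using D\<delta> Jp cJ by (intro mult_strict_left_mono) (auto simp: \<delta>_def)
        also have "\<dots> = (J - c) * (J / 2)" by simp
        also have "\<dots> \<le> (J - c) * C" using cJ CJ by (intro mult_left_mono) auto
        finally show ?thesis .
      qed
      ultimately show ?thesis by (simp add: algebra_simps) (smt (verit) zero_le_power2)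
    qed
    then have fin: "c < (1 / sqrt C * Er)\<^sup>2" using Cp by (simp add: power_mult_distrib power_divide field_simps)
    have Cp': "0 < (LINT t|?M. state_defect F A H T x \<xi> t \<bullet> ?W (state_defect F A H T x \<xi> t))"
      using Cp unfolding C_def .
    note adm = scaled_state_admissible[OF T pd x Cp', folded C_def]
    let ?s = "1 / sqrt C"
    let ?x = "\<lambda>t. ?s *\<^sub>R x t"
    let ?f = "\<lambda>t. ?s *\<^sub>R (F *v \<xi> t - A *v x t)"
    let ?\<eta> = "\<lambda>t. ?s *\<^sub>R (- (H *v x t))"
    have sol: "dae_sol F A H T ?x ?f (\<lambda>t. 0) ?\<eta>" using adm(1) unfolding admissible_sols_def by blast
    have "l \<bullet> ac_rep {0..T} (\<lambda>t. F *v ?x t) T - observer_out V T (\<lambda>t. 0)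
        = l \<bullet> ac_rep {0..T} (\<lambda>t. F *v ?x t) T - observer_out U T (\<lambda>t. 0)"
      by (simp add: observer_out_def)
    also have "\<dots> = ?s * ((F *v x 0) \<bullet> (Q0 *v z)) + (LINT t|?M. ?s * ((F *v \<xi> t - A *v x t) \<bullet> w t + (- (H *v x t)) \<bullet> (- U t)))"
      unfolding err[OF sol] using adm(2)[of 0] T by (simp add: algebra_simps)
    also have "\<dots> = ?s * Er"
      unfolding Er_def state_defect_def
        LINT_triple_weight[OF T sq(2,3) sq'(1) sqint_uminus[OF sq'(2)]] vec.neg integral_mult_right_zero
      by (simp only: sym_pos_def_inv_vec pd distrib_left)
    finally have val: "l \<bullet> ac_rep {0..T} (\<lambda>t. F *v ?x t) T - observer_out V T (\<lambda>t. 0) = ?s * Er" .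
    show ?thesis
      using adm(1) cJ(2) fin val by (intro bexI[of _ "(?x, ?f, \<lambda>t. 0, ?\<eta>)"]) (auto intro: le_less_trans simp del: ereal_power)
  qed
qed

section \<open>The Riccati equation of the associated system\<close>

lemma sum_UNIV_Plus: "(\<Sum>i\<in>UNIV. f (i :: 'm::finite + 'p::finite)) = (\<Sum>i\<in>UNIV. f (Inl i)) + (\<Sum>i\<in>UNIV. f (Inr i))"
  by (simp add: UNIV_Plus_UNIV[symmetric] sum.Plus del: UNIV_Plus_UNIV)

lemma stack_eq_iff:
  "stack q u = Ca *v p + Da *v g \<longleftrightarrow>
   q = upper_rows Ca *v p + upper_rows Da *v g \<and> u = lower_rows Ca *v p + lower_rows Da *v g"
proof -
  have "stack q u = Ca *v p + Da *v g \<longleftrightarrow>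
      (\<forall>i. stack q u $ Inl i = (Ca *v p + Da *v g) $ Inl i) \<and> (\<forall>i. stack q u $ Inr i = (Ca *v p + Da *v g) $ Inr i)"
    unfolding vec_eq_iff by (metis sum.exhaust)
  also have "\<dots> \<longleftrightarrow> q = upper_rows Ca *v p + upper_rows Da *v g \<and> u = lower_rows Ca *v p + lower_rows Da *v g"
    by (simp add: vec_eq_iff stack_def upper_rows_def lower_rows_def matrix_vector_mult_def)
  finally show ?thesis .
qed

lemma stack_block_diag:
  "stack q u \<bullet> (block_diag M N *v stack q' u') = q \<bullet> (M *v q') + u \<bullet> (N *v u')"
  by (simp add: inner_vec_def matrix_vector_mult_def sum_UNIV_Plus stack_def block_diag_def)

lemma transpose_block_diag:
  "transpose (block_diag M N) = block_diag (transpose M) (transpose N)"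
  by (auto simp: transpose_def block_diag_def vec_eq_iff split: sum.split)

lemma block_diag_pos:
  fixes M :: "real^'m^'m" and N :: "real^'p^'p"
  assumes "sym_pos_def M" "sym_pos_def N" "h \<noteq> 0"
  shows "h \<bullet> (block_diag M N *v h) > 0"
proof -
  define q where "q = (\<chi> i. h $ Inl i)"
  define u where "u = (\<chi> i. h $ Inr i)"
  have h: "h = stack q u" by (auto simp: vec_eq_iff stack_def q_def u_def split: sum.split)
  have "stack 0 0 = (0 :: real^('m + 'p))" by (auto simp: stack_def vec_eq_iff split: sum.split)
  then have "q \<noteq> 0 \<or> u \<noteq> 0" using assms(3) unfolding h by metis
  then show ?thesis
    unfolding h stack_block_diag
    using assms(1,2) sym_pos_def_nonneg[OF assms(1), of q] sym_pos_def_nonneg[OF assms(2), of u]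
    by (auto simp: sym_pos_def_def add_pos_nonneg add_nonneg_pos)
qed

text \<open>Gronwall's lemma for the squared norm; it gives uniqueness for linear differential equations.\<close>
lemma derivative_bound_imp_zero:
  fixes f :: "real \<Rightarrow> 'b::euclidean_space"
  assumes d: "\<And>t. t \<in> {0..T} \<Longrightarrow> (f has_vector_derivative f' t) (at t within {0..T})"
    and bound: "\<And>t. t \<in> {0..T} \<Longrightarrow> norm (f' t) \<le> C * norm (f t)" and "f 0 = 0" and t: "t \<in> {0..T}"
  shows "f t = 0"
proof -
  define \<phi> where "\<phi> s = exp (- (2 * C * s)) * (f s \<bullet> f s)" for s
  define \<phi>' where "\<phi>' s = exp (- (2 * C * s)) * (2 * (f s \<bullet> f' s) - 2 * C * (f s \<bullet> f s))" for s
  have d\<phi>: "(\<phi> has_vector_derivative \<phi>' s) (at s within {0..t})" if "s \<in> {0..t}" for s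
  proof -
    have "(f has_vector_derivative f' s) (at s within {0..t})"
      using that t by (intro has_vector_derivative_within_subset[OF d]) auto
    then have 1: "((\<lambda>s. f s \<bullet> f s) has_real_derivative f s \<bullet> f' s + f' s \<bullet> f s) (at s within {0..t})"
      unfolding has_real_derivative_iff_has_vector_derivative
      by (intro bounded_bilinear.has_vector_derivative[OF bounded_bilinear_inner])
    show ?thesis
      unfolding \<phi>_def \<phi>'_def has_real_derivative_iff_has_vector_derivative[symmetric]
      by (rule derivative_eq_intros 1 refl)+ (simp add: inner_commute algebra_simps)
  qed
  have "\<phi>' s \<le> 0" if "s \<in> {0..t}" for s
  proof -
    have "f s \<bullet> f' s \<le> norm (f s) * norm (f' s)" by (rule norm_cauchy_schwarz)
    also have "\<dots> \<le> norm (f s) * (C * norm (f s))" using that t by (intro mult_left_mono bound) auto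
    also have "\<dots> = C * (f s \<bullet> f s)" by (simp add: power2_norm_eq_inner[symmetric] power2_eq_square)
    finally show ?thesis by (simp add: \<phi>'_def mult_le_0_iff)
  qed
  moreover have "(\<phi>' has_integral \<phi> t - \<phi> 0) {0..t}"
    using t by (intro fundamental_theorem_of_calculus d\<phi>) auto
  ultimately have "\<phi> t - \<phi> 0 \<le> 0"
    using has_integral_le[of \<phi>' "\<phi> t - \<phi> 0" "{0..t}" "\<lambda>s. 0" 0] by (metis has_integral_0)
  then have "f t \<bullet> f t \<le> 0" using \<open>f 0 = 0\<close> by (simp add: \<phi>_def mult_le_0_iff)
  then show ?thesis by (metis inner_gt_zero_iff not_le)
qed

text \<open>With the gain \<open>K\<close> regarded as given, the skew part of \<open>P\<close> satisfies a homogeneous linear equation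
  with zero initial value.\<close>
lemma riccati_symmetric:
  fixes P :: "real \<Rightarrow> real^'h^'h" and K :: "real \<Rightarrow> real^'h^'k" and E :: "real^'k^'k" and W :: "real^'h^'h"
  assumes P: "\<And>t. t \<in> {0..T} \<Longrightarrow> (P has_vector_derivative
        (transpose A ** P t + P t ** A - transpose (K t) ** E ** K t + W)) (at t within {0..T})"
    and E: "transpose E = E" and W: "transpose W = W" and P0: "transpose (P 0) = P 0"
    and t: "t \<in> {0..T}"
  shows "transpose (P t) = P t"
proof -
  let ?D = "\<lambda>t. P t - transpose (P t)"
  have lin: "linear (\<lambda>D::real^'h^'h. transpose A ** D + D ** A)"
    by (intro linear_compose_add bounded_linear.linear
        bounded_bilinear.bounded_linear_right[OF bilinear_matrix_mult]
        bounded_bilinear.bounded_linear_left[OF bilinear_matrix_mult])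
  obtain C where C: "\<And>D::real^'h^'h. norm (transpose A ** D + D ** A) \<le> C * norm D"
    using linear_bounded[OF lin] by blast
  have "(?D has_vector_derivative transpose A ** ?D s + ?D s ** A) (at s within {0..T})" if "s \<in> {0..T}" for s
  proof -
    let ?P' = "transpose A ** P s + P s ** A - transpose (K s) ** E ** K s + W"
    have "transpose ?P' = transpose (P s) ** A + transpose A ** transpose (P s) - transpose (K s) ** E ** K s + W"
      by (simp add: linear_add[OF bounded_linear.linear[OF bounded_linear_transpose]]
          linear_diff[OF bounded_linear.linear[OF bounded_linear_transpose]] matrix_transpose_mul E W matrix_mul_assoc)
    then have "?P' - transpose ?P' = transpose A ** ?D s + ?D s ** A"
      by (simp add: matrix_mult_diff_left matrix_mult_diff_right)
    moreover have "(?D has_vector_derivative ?P' - transpose ?P') (at s within {0..T})"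
      by (intro has_vector_derivative_diff P that
          bounded_linear.has_vector_derivative[OF bounded_linear_transpose])
    ultimately show ?thesis by simp
  qed
  from derivative_bound_imp_zero[OF this C _ t] P0 show ?thesis by simp
qed

lemma riccati_pointwise:
  fixes P :: "real^'h^'h" and A :: "real^'h^'h" and B :: "real^'k^'h" and C :: "real^'h^'y" and D :: "real^'k^'y" and K :: "real^'h^'k"
  assumes P: "transpose P = P" and S: "transpose S = S"
    and key: "(transpose D ** S ** D) ** K = transpose B ** P + transpose D ** S ** C"
  shows "p \<bullet> (P *v ((A - B ** K) *v v)
        - (transpose A ** P + P ** A - transpose K ** (transpose D ** S ** D) ** K + transpose C ** S ** C) *v v)
      + (A *v p + B *v g) \<bullet> (P *v v) + (C *v p + D *v g) \<bullet> (S *v ((C - D ** K) *v v)) = 0"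
proof -
  have Pc: "x \<bullet> (P *v y) = y \<bullet> (P *v x)" for x y by (metis P inner_commute inner_mult_transpose)
  have Sc: "x \<bullet> (S *v y) = y \<bullet> (S *v x)" for x y by (metis S inner_commute inner_mult_transpose)
  have key': "(D *v x) \<bullet> (S *v (D *v (K *v y))) = (B *v x) \<bullet> (P *v y) + (D *v x) \<bullet> (S *v (C *v y))" for x y
  proof -
    have "x \<bullet> (((transpose D ** S ** D) ** K) *v y) = x \<bullet> ((transpose B ** P + transpose D ** S ** C) *v y)"
      by (simp only: key)
    then show ?thesis
      by (simp add: matrix_vector_mult_add_rdistrib inner_add_right inner_transpose_mult flip: matrix_vector_mul_assoc)
  qed
  show ?thesis
    using key'[of g v] key'[of "K *v v" p] Pc[of "B *v (K *v v)" p] Sc[of "D *v (K *v v)" "C *v p"]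
      Sc[of "D *v (K *v v)" "D *v (K *v p)"]
    by (simp add: matrix_vector_mult_add_rdistrib matrix_vector_mult_diff_rdistrib matrix_vector_mult_diff_distrib
        inner_add_right inner_add_left inner_diff_right inner_diff_left inner_transpose_mult
        flip: matrix_vector_mul_assoc)
qed

text \<open>The bilinear form of completing the square: the optimal closed-loop trajectory \<open>v\<close> is paired with an
  arbitrary trajectory \<open>p\<close> through \<open>p(t)^T P(T - t) v(t)\<close>. For \<open>p = v\<close> the identity gives the optimal cost, and
  for \<open>p 0 = 0\<close> it is the orthogonality that characterises the optimum.\<close>
lemma riccati_pairing:
  fixes P :: "real \<Rightarrow> real^'h^'h" and A :: "real^'h^'h" and B :: "real^'k^'h" and C :: "real^'h^'y" and D :: "real^'k^'y"
    and K :: "real \<Rightarrow> real^'h^'k"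
  assumes T: "0 < T"
    and P: "\<And>t. t \<in> {0..T} \<Longrightarrow> (P has_vector_derivative
        (transpose A ** P t + P t ** A - transpose (K t) ** (transpose D ** S ** D) ** K t + transpose C ** S ** C)) (at t within {0..T})"
    and sym: "\<And>t. t \<in> {0..T} \<Longrightarrow> transpose (P t) = P t" and S: "transpose S = S"
    and K: "continuous_on {0..T} K"
    and key: "\<And>t. t \<in> {0..T} \<Longrightarrow> (transpose D ** S ** D) ** K t = transpose B ** P t + transpose D ** S ** C"
    and v: "\<And>s. s \<in> {0..T} \<Longrightarrow> (v has_vector_derivative ((A - B ** K (T - s)) *v v s)) (at s within {0..T})"
    and p: "primitive T p (\<lambda>t. A *v p t + B *v g t)" and g: "sqint (leb T) g"
  shows "p T \<bullet> (P 0 *v v T) + (LINT t|leb T. (C *v p t + D *v g t) \<bullet> (S *v ((C - D ** K (T - t)) *v v t)))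
    = p 0 \<bullet> (P T *v v 0)"
proof -
  note cont = bounded_bilinear.continuous_on[OF bilinear_matrix_mult]
    bounded_bilinear.continuous_on[OF bilinear_matrix_vector]
    bounded_linear.continuous_on[OF bounded_linear_transpose]
  define P' where "P' t = transpose A ** P t + P t ** A - transpose (K t) ** (transpose D ** S ** D) ** K t + transpose C ** S ** C" for t
  have cP: "continuous_on {0..T} P" by (rule continuous_on_vector_derivative[OF P])
  have cP': "continuous_on {0..T} P'"
    unfolding P'_def by (intro continuous_intros cont cP K)
  have prP: "primitive T P P'" using P cP' by (intro C1_primitive) (auto simp: P'_def)
  have cv: "continuous_on {0..T} v" by (rule continuous_on_vector_derivative[OF v])
  have cKr: "continuous_on {0..T} (\<lambda>s. K (T - s))"
    by (rule continuous_on_compose2[OF K]) (auto intro!: continuous_intros)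
  have prv: "primitive T v (\<lambda>s. (A - B ** K (T - s)) *v v s)"
    by (intro C1_primitive v continuous_intros cont cKr cv)
  note prm = primitive_bilinear[OF bilinear_matrix_vector primitive_reflect[OF prP] prv]
  note prW = primitive_bilinear[OF bounded_bilinear_inner p prm]
  have "p T \<bullet> (P (T - T) *v v T) - p 0 \<bullet> (P (T - 0) *v v 0)
    = (LINT t|leb T. p t \<bullet> (P (T - t) *v ((A - B ** K (T - t)) *v v t) + (- P' (T - t)) *v v t)
          + (A *v p t + B *v g t) \<bullet> (P (T - t) *v v t))"
    using primitive_LINT[OF prW] T by simp
  also have "\<dots> = (LINT t|leb T. - ((C *v p t + D *v g t) \<bullet> (S *v ((C - D ** K (T - t)) *v v t))))"
  proof (rule Bochner_Integration.integral_cong[OF refl])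
    fix t assume "t \<in> space (leb T)"
    then have t: "T - t \<in> {0..T}" by auto
    have "(- P' (T - t)) *v v t = - (P' (T - t) *v v t)"
      by (simp add: matrix_vector_mult_def vec_eq_iff sum_negf)
    then show "p t \<bullet> (P (T - t) *v ((A - B ** K (T - t)) *v v t) + (- P' (T - t)) *v v t)
          + (A *v p t + B *v g t) \<bullet> (P (T - t) *v v t) = - ((C *v p t + D *v g t) \<bullet> (S *v ((C - D ** K (T - t)) *v v t)))"
      using riccati_pointwise[OF sym[OF t] S key[OF t], of "p t" A "v t" "g t"] unfolding P'_def by simp
  qed
  finally show ?thesis by simp
qed

text \<open>The observer in state-space form: \<open>r(t)^T v(T - t)\<close> is differentiated, and the terms with \<open>G\<close> cancel.\<close>
lemma observer_state_output:
  fixes G :: "real \<Rightarrow> real^'h^'h" and L :: "real \<Rightarrow> real^'h^'p"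
  assumes T: "0 < T" and G: "continuous_on {0..T} G" and L: "continuous_on {0..T} L"
    and v: "\<And>s. s \<in> {0..T} \<Longrightarrow> (v has_vector_derivative (G (T - s) *v v s)) (at s within {0..T})"
    and y: "sqint (leb T) y"
    and r: "AC_on {0..T} r" "r 0 = 0" "AE t in leb T.
       (r has_vector_derivative (transpose (G t) *v r t + transpose (L t) *v y t)) (at t within {0..T})"
  shows "(LINT t|leb T. y t \<bullet> (L t *v v (T - t))) = v 0 \<bullet> r T"
proof -
  note cont = bounded_bilinear.continuous_on[OF bilinear_matrix_vector]
    bounded_linear.continuous_on[OF bounded_linear_transpose]
  have sq: "sqint (leb T) (\<lambda>t. transpose (G t) *v r t + transpose (L t) *v y t)"
    by (rule sqint_add[OF sqint_continuous_on sqint_continuous_bilinear[OF bilinear_matrix_vector _ y]])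
       (intro cont G L AC_on_continuous_on r)+
  have prr: "primitive T r (\<lambda>t. transpose (G t) *v r t + transpose (L t) *v y t)"
    by (rule AC_on_primitive[OF r(1) sq r(3)])
  have cv: "continuous_on {0..T} v" by (rule continuous_on_vector_derivative[OF v])
  have cGr: "continuous_on {0..T} (\<lambda>s. G (T - s))"
    by (rule continuous_on_compose2[OF G]) (auto intro!: continuous_intros)
  have "primitive T v (\<lambda>s. G (T - s) *v v s)"
    by (intro C1_primitive v cont cGr cv)
  note prv = primitive_reflect[OF this]
  have "r T \<bullet> v (T - T) - r 0 \<bullet> v (T - 0) = (LINT t|leb T. r t \<bullet> (- (G (T - (T - t)) *v v (T - t)))
     + (transpose (G t) *v r t + transpose (L t) *v y t) \<bullet> v (T - t))"
    using primitive_LINT[OF primitive_bilinear[OF bounded_bilinear_inner prr prv]] T by simp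
  also have "\<dots> = (LINT t|leb T. y t \<bullet> (L t *v v (T - t)))"
    by (intro Bochner_Integration.integral_cong refl) (simp add: inner_add_left inner_mult_transpose)
  finally show ?thesis using r(2) by (simp add: inner_commute)
qed

section \<open>The minimax observer\<close>

theorem theorem3:
  fixes F A :: "real^'n^'m"
    and H :: "real^'n^'p"
    and Q0 Q :: "real^'m^'m"
    and R :: "real^'p^'p"
    and l :: "real^'m"
    and t1 :: real
    and Aa :: "real^'h^'h"
    and Ba :: "real^'k^'h"
    and Ca :: "real^'h^('m + 'p)"
    and Da :: "real^'k^('m + 'p)"
    and M :: "real^'n^'h"
    and S :: "real^('m + 'p)^('m + 'p)"
    and P :: "real \<Rightarrow> real^'h^'h"
    and K :: "real \<Rightarrow> real^'h^'k"
    and v :: "real \<Rightarrow> real^'h"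
    and ustar :: "real \<Rightarrow> real^'p"
  assumes "sym_pos_def Q0" and "sym_pos_def Q" and "sym_pos_def R"
    and "0 < t1"
    and "associated_lti F A H Aa Ba Ca Da"
    and "M = state_map F Ca"
    and "S = block_diag (matrix_inv Q) (matrix_inv R)"
    and "\<forall>t\<in>{0..t1}. (P has_vector_derivative
           (transpose Aa ** P t + P t ** Aa
            - transpose (K t) ** (transpose Da ** S ** Da) ** K t
            + transpose Ca ** S ** Ca)) (at t within {0..t1})"
    and "P 0 = transpose (upper_rows Ca) ** Q0_bar F Q0 ** upper_rows Ca"
    and "\<forall>t\<in>{0..t1}. K t =
           (if Da \<noteq> 0
            then matrix_inv (transpose Da ** S ** Da) **
                   (transpose Ba ** P t + transpose Da ** S ** Ca)
            else 0)"
    and "\<forall>s\<in>{0..t1}. (v has_vector_derivative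
           ((Aa - Ba ** K (t1 - s)) *v v s)) (at s within {0..t1})"
    and "v 0 = M *v (transpose F *v l)"
    and "\<forall>s\<in>{0..t1}. ustar s = (lower_rows Ca - lower_rows Da ** K (t1 - s)) *v v s"
    and "impulse_observable l F A H"
  shows "minimax_observer F A H Q0 Q R (\<lambda>s. ustar (t1 - s)) l t1 \<and>
    worst_error F A H Q0 Q R (\<lambda>s. ustar (t1 - s)) l t1 =
      ereal (l \<bullet> ((F ** transpose M ** P t1 ** M ** transpose F) *v l)) \<and>
    (\<forall>y. L2loc {0..t1} y \<longrightarrow>
      (let is_state = (\<lambda>r :: real \<Rightarrow> real^'h.
             AC_on {0..t1} r \<and> r 0 = 0 \<and>
             (AE t in lebesgue_on {0..t1}. (r has_vector_derivative
                (transpose (Aa - Ba ** K t) *v r t +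
                 transpose (lower_rows Ca - lower_rows Da ** K t) *v y t)) (at t within {0..t1})))
       in (\<exists>r. is_state r) \<and>
          (\<forall>r. is_state r \<longrightarrow>
             observer_out (\<lambda>s. ustar (t1 - s)) t1 y = l \<bullet> ((F ** transpose M) *v r t1))))"
proof -
  note pd = assms(1-3) and T = assms(4) and assoc = assms(5)
  let ?M = "lebesgue_on {0..t1}" and ?Cs = "upper_rows Ca" and ?Ds = "upper_rows Da" and ?Cu = "lower_rows Ca" and ?Du = "lower_rows Da"
  have D01: "(CARD('k) = 1 \<and> Da = 0 \<and> Ba = 0) \<or> rank Da = CARD('k)"
    and FDs: "transpose F ** ?Ds = 0" and rankG: "rank (transpose F ** ?Cs) = CARD('h)"
    and lti: "\<And>I q u. I \<in> time_intervals \<Longrightarrow> (q, u) \<in> dual_sols I F A H \<longleftrightarrow>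
        (\<exists>p g. AC_on I p \<and> L2loc I g \<and>
           (AE t in lebesgue_on I.
              (p has_vector_derivative (Aa *v p t + Ba *v g t)) (at t within I)) \<and>
           (AE t in lebesgue_on I. stack (q t) (u t) = Ca *v p t + Da *v g t))"
    using assoc unfolding associated_lti_def by blast+
  have interval: "{0..\<tau>} \<in> time_intervals" if "0 < \<tau>" for \<tau>
    using that unfolding time_intervals_def by blast
  have Mstate: "M *v (transpose F *v (?Cs *v p)) = p" for p
    unfolding assms(6) state_map_def using pinv_left_inverse[OF rankG, of p] by (simp add: matrix_vector_mul_assoc)
  have FCD: "transpose F *v (?Cs *v p + ?Ds *v g) = transpose F *v (?Cs *v p)" for p g
    using FDs by (simp add: matrix_vector_right_distrib matrix_vector_mul_assoc)
  have Spd: "sym_pos_def (matrix_inv Q)" "sym_pos_def (matrix_inv R)" using pd sym_pos_def_matrix_inv by auto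
  have S: "transpose S = S"
    unfolding assms(7) transpose_block_diag by (simp add: sym_pos_def_transpose[OF Spd(1)] sym_pos_def_transpose[OF Spd(2)])
  define E where "E = transpose Da ** S ** Da"
  have Esym: "transpose E = E" unfolding E_def by (simp add: matrix_transpose_mul S matrix_mul_assoc)
  \<comment> \<open>The defining equation of the gain, multiplied by \<open>E\<close>. For \<open>Da = 0\<close> full column rank is impossible,
    so \<open>Ba = 0\<close> and both sides vanish.\<close>
  have key: "E ** K t = transpose Ba ** P t + transpose Da ** S ** Ca" if t: "t \<in> {0..t1}" for t
  proof (cases "Da = 0")
    case True
    have "rank (0 :: real^'k^('m+'p)) \<noteq> CARD('k)" by simp
    then have "Ba = 0" using D01 True by auto
    then show ?thesis using True assms(10) t
      unfolding E_def by (auto simp: matrix_matrix_mult_def transpose_def vec_eq_iff)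
  next
    case False
    have "x = 0" if Ex: "E *v x = 0" for x
    proof (rule ccontr)
      assume "x \<noteq> 0"
      moreover have "inj ((*v) Da)" using D01 False full_rank_injective by auto
      ultimately have "Da *v x \<noteq> 0" by (metis injD matrix_vector_mult_0_right)
      from block_diag_pos[OF Spd this] have "x \<bullet> (E *v x) > 0"
        unfolding E_def assms(7) by (simp add: inner_transpose_mult flip: matrix_vector_mul_assoc)
      with Ex show False by simp
    qed
    from matrix_inv_works(1)[OF this]
    have "E ** (matrix_inv E ** X) = X" for X :: "real^'h^'k" by (simp add: matrix_mul_assoc)
    then show ?thesis using False assms(10) t unfolding E_def by simp
  qed
  have dP: "(P has_vector_derivative (transpose Aa ** P t + P t ** Aa - transpose (K t) ** E ** K t
      + transpose Ca ** S ** Ca)) (at t within {0..t1})" if "t \<in> {0..t1}" for t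
    using assms(8) that unfolding E_def by blast
  define Em where "Em = (pinv (transpose F) - M_opt F Q0) ** transpose F"
  note Q0b = Q0_bar_optimal[where F = F, OF pd(1), folded Em_def]
  note S0 = sym_pos_def_matrix_inv[OF pd(1)]
  have P0: "x \<bullet> (P 0 *v y) = (Em *v (?Cs *v x)) \<bullet> (matrix_inv Q0 *v (Em *v (?Cs *v y)))" for x y
    unfolding assms(9) using Q0b(3)[of "?Cs *v x" "?Cs *v y"]
    by (simp add: inner_transpose_mult flip: matrix_vector_mul_assoc)
  have P0sym: "transpose (P 0) = P 0"
    by (rule transpose_eqI)
       (metis P0 inner_commute sym_pos_def_inner_commute[OF S0])
  have Psym: "transpose (P t) = P t" if "t \<in> {0..t1}" for t
    by (rule riccati_symmetric[OF dP Esym _ P0sym that])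
       (simp_all add: matrix_transpose_mul S matrix_mul_assoc)
  note cont = bounded_bilinear.continuous_on[OF bilinear_matrix_mult]
    bounded_bilinear.continuous_on[OF bilinear_matrix_vector]
  have cP: "continuous_on {0..t1} P" by (rule continuous_on_vector_derivative[OF dP])
  have cK: "continuous_on {0..t1} K"
  proof -
    have "continuous_on {0..t1} (\<lambda>t. if Da \<noteq> 0
            then matrix_inv (transpose Da ** S ** Da) ** (transpose Ba ** P t + transpose Da ** S ** Ca) else 0)"
      by (cases "Da = 0") (auto intro!: continuous_intros cont cP)
    then show ?thesis by (rule continuous_on_eq) (use assms(10) in auto)
  qed
  have cKr: "continuous_on {0..t1} (\<lambda>s. K (t1 - s))"
    by (rule continuous_on_compose2[OF cK]) (auto intro!: continuous_intros)
  have dv: "(v has_vector_derivative ((Aa - Ba ** K (t1 - s)) *v v s)) (at s within {0..t1})" if "s \<in> {0..t1}" for s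
    using assms(11) that by blast
  have cv: "continuous_on {0..t1} v" by (rule continuous_on_vector_derivative[OF dv])
  have pairing: "p t1 \<bullet> (P 0 *v v t1) + (LINT t|?M. (Ca *v p t + Da *v g t) \<bullet> (S *v ((Ca - Da ** K (t1 - t)) *v v t)))
      = p 0 \<bullet> (P t1 *v v 0)"
    if "primitive t1 p (\<lambda>t. Aa *v p t + Ba *v g t)" "sqint ?M g" for p g
    by (rule riccati_pairing[OF T dP[unfolded E_def] Psym S cK key[unfolded E_def] dv that])
  \<comment> \<open>The optimal dual solution is the output of the associated system under the feedback \<open>g = - K v\<close>.\<close>
  define gs where "gs t = - (K (t1 - t) *v v t)" for t
  define qs where "qs t = (?Cs - ?Ds ** K (t1 - t)) *v v t" for t
  have gsq: "sqint ?M gs" unfolding gs_def by (intro sqint_continuous_on continuous_intros cont cKr cv)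
  have qsq: "sqint ?M qs" unfolding qs_def by (intro sqint_continuous_on continuous_intros cont cKr cv)
  have usq: "sqint ?M ustar"
  proof (rule sqint_cong)
    show "sqint ?M (\<lambda>s. (?Cu - ?Du ** K (t1 - s)) *v v s)"
      by (intro sqint_continuous_on continuous_intros cont cKr cv)
  qed (use assms(13) in auto)
  have CDK: "Ca *v v t + Da *v gs t = (Ca - Da ** K (t1 - t)) *v v t" for t
    by (simp add: gs_def matrix_vector_mult_diff_rdistrib matrix_vector_mul_assoc vec.neg)
  have stack_star: "stack (qs t) (ustar t) = Ca *v v t + Da *v gs t" if "t \<in> {0..t1}" for t
    unfolding stack_eq_iff using assms(13) that
    by (simp add: gs_def qs_def matrix_vector_mult_diff_rdistrib matrix_vector_mul_assoc vec.neg)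
  have dv': "(Aa - Ba ** K (t1 - t)) *v v t = Aa *v v t + Ba *v gs t" for t
    by (simp add: gs_def matrix_vector_mult_diff_rdistrib matrix_vector_mul_assoc vec.neg)
  have prv: "primitive t1 v (\<lambda>t. Aa *v v t + Ba *v gs t)"
    unfolding dv'[symmetric] by (intro C1_primitive dv continuous_intros cont cKr cv)
  have "(qs, ustar) \<in> dual_sols {0..t1} F A H"
    unfolding lti[OF interval[OF T]]
  proof (intro exI conjI)
    show "AC_on {0..t1} v" by (rule primitive_AC[OF prv])
    show "L2loc {0..t1} gs" using gsq by (simp add: L2loc_Icc_iff)
    show "AE t in ?M. (v has_vector_derivative (Aa *v v t + Ba *v gs t)) (at t within {0..t1})"
      by (rule primitive_has_derivative_AE[OF prv])
    show "AE t in ?M. stack (qs t) (ustar t) = Ca *v v t + Da *v gs t"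
      by (rule AE_I2) (simp add: stack_star)
  qed
  then obtain bs where bs: "primitive t1 bs (\<lambda>t. transpose A *v qs t - transpose H *v ustar t)"
      "AE t in ?M. transpose F *v qs t = bs t"
    unfolding dual_sols_iff[OF T] by blast
  have Fq: "transpose F *v qs t = transpose F *v (?Cs *v v t)" for t
    using FCD[of "v t" "gs t"]
    by (simp add: gs_def qs_def matrix_vector_mult_diff_rdistrib matrix_vector_mul_assoc vec.neg)
  have bs_eq: "bs t = transpose F *v (?Cs *v v t)" if "t \<in> {0..t1}" for t
  proof (rule continuous_on_AE_eq[OF T primitive_continuous_on[OF bs(1)] _ _ that])
    show "continuous_on {0..t1} (\<lambda>t. transpose F *v (?Cs *v v t))"
      by (intro continuous_intros cont cv)
    show "AE t in ?M. bs t = transpose F *v (?Cs *v v t)"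
      using bs(2) by eventually_elim (simp add: Fq)
  qed
  \<comment> \<open>Impulse observability makes \<open>F^T l\<close> the initial value of some dual solution, hence
    of the form \<open>F^T Cs p\<close>, and then the state map recovers \<open>p\<close>.\<close>
  have v0: "transpose F *v (?Cs *v v 0) = transpose F *v l"
  proof -
    obtain \<tau> q u where \<tau>: "0 < \<tau>" and qu: "(q, u) \<in> dual_sols_from l {0..\<tau>} F A H"
      using assms(14) unfolding impulse_observable_def by fast
    then have sol: "(q, u) \<in> dual_sols {0..\<tau>} F A H"
      and init: "ac_rep {0..\<tau>} (\<lambda>t. transpose F *v q t) 0 = transpose F *v l"
      by (auto simp: dual_sols_from_def)
    obtain p g where p: "AC_on {0..\<tau>} p" and st: "AE t in lebesgue_on {0..\<tau>}. stack (q t) (u t) = Ca *v p t + Da *v g t"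
      using sol unfolding lti[OF interval[OF \<tau>]] by blast
    have rep: "is_ac_rep {0..\<tau>} (\<lambda>t. transpose F *v q t) (ac_rep {0..\<tau>} (\<lambda>t. transpose F *v q t))"
      using sol by (intro ac_rep_is_ac_rep) (auto simp: dual_sols_def)
    have "ac_rep {0..\<tau>} (\<lambda>t. transpose F *v q t) 0 = transpose F *v (?Cs *v p 0)"
    proof (rule continuous_on_AE_eq[OF \<tau>, where f = "ac_rep {0..\<tau>} (\<lambda>t. transpose F *v q t)"
          and g = "\<lambda>t. transpose F *v (?Cs *v p t)" and t = 0])
      show "continuous_on {0..\<tau>} (ac_rep {0..\<tau>} (\<lambda>t. transpose F *v q t))"
        using rep by (auto simp: is_ac_rep_def intro: AC_on_continuous_on)
      show "continuous_on {0..\<tau>} (\<lambda>t. transpose F *v (?Cs *v p t))"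
        by (intro continuous_intros cont AC_on_continuous_on p)
      have "AE t in lebesgue_on {0..\<tau>}. transpose F *v q t = ac_rep {0..\<tau>} (\<lambda>t. transpose F *v q t) t"
        using rep by (simp add: is_ac_rep_def)
      then show "AE t in lebesgue_on {0..\<tau>}. ac_rep {0..\<tau>} (\<lambda>t. transpose F *v q t) t = transpose F *v (?Cs *v p t)"
        using st by eventually_elim (metis FCD stack_eq_iff)
    qed (use \<tau> in auto)
    then have "transpose F *v l = transpose F *v (?Cs *v p 0)" using init by simp
    then show ?thesis unfolding assms(12) by (simp add: Mstate)
  qed
  \<comment> \<open>The worst initial value of \<open>F x\<close>, up to scaling.\<close>
  define z where "z = matrix_inv Q0 *v (Em *v (?Cs *v v t1))"
  have Q0z: "Q0 *v z = Em *v (?Cs *v v t1)" unfolding z_def by (rule sym_pos_def_inv_vec[OF pd(1)])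
  have zr: "z \<in> range (\<lambda>y. F *v y)" unfolding z_def by (rule Q0b(2))
  have rangeE: "a \<bullet> (Em *v x) = a \<bullet> x" if aF: "a \<in> range (\<lambda>y. F *v y)" for a x
  proof -
    obtain y where a: "a = F *v y" using aF by blast
    have "(F *v y) \<bullet> (Em *v x) = y \<bullet> ((transpose F ** Em) *v x)"
      by (simp add: inner_transpose_mult flip: matrix_vector_mul_assoc)
    then show ?thesis by (simp add: a Q0b(1) inner_transpose_mult)
  qed
  define w where "w t = qs (t1 - t)" for t
  define U where "U t = ustar (t1 - t)" for t
  have wsq: "sqint ?M w" unfolding w_def by (rule sqint_reflect[OF qsq])
  have Usq: "sqint ?M U" unfolding U_def by (rule sqint_reflect[OF usq])
  define J where "J = v 0 \<bullet> (P t1 *v v 0)"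
  have Sform: "(Ca *v p + Da *v g) \<bullet> (S *v ((Ca - Da ** K (t1 - t)) *v v t))
      = q \<bullet> (matrix_inv Q *v qs t) + u \<bullet> (matrix_inv R *v ustar t)"
    if "t \<in> {0..t1}" "stack q u = Ca *v p + Da *v g" for p g t q u
    unfolding CDK[symmetric] stack_star[OF that(1), symmetric] that(2)[symmetric] assms(7) stack_block_diag ..
  note I = sqint_inner_integrable
  have J: "J = z \<bullet> (Q0 *v z) + (LINT t|?M. w t \<bullet> (matrix_inv Q *v w t) + U t \<bullet> (matrix_inv R *v U t))"
  proof -
    let ?f = "\<lambda>t. qs t \<bullet> (matrix_inv Q *v qs t) + ustar t \<bullet> (matrix_inv R *v ustar t)"
    have "(LINT t|?M. w t \<bullet> (matrix_inv Q *v w t) + U t \<bullet> (matrix_inv R *v U t)) = (LINT t|?M. ?f (t1 - t))"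
      by (simp add: w_def U_def)
    also have "\<dots> = (LINT t|?M. ?f t)"
    proof (rule LINT_reflect)
      show "integrable ?M ?f"
        by (rule Bochner_Integration.integrable_add[OF I[OF qsq sqint_matrix[OF qsq]] I[OF usq sqint_matrix[OF usq]]])
      show "integrable ?M (\<lambda>t. ?f (t1 - t))"
        using Bochner_Integration.integrable_add[OF I[OF wsq sqint_matrix[OF wsq]] I[OF Usq sqint_matrix[OF Usq]],
            of "matrix_inv Q" "matrix_inv R"] by (simp add: w_def U_def)
    qed
    also have "\<dots> = (LINT t|?M. (Ca *v v t + Da *v gs t) \<bullet> (S *v ((Ca - Da ** K (t1 - t)) *v v t)))"
      by (intro Bochner_Integration.integral_cong refl, subst Sform[OF _ stack_star]) auto
    finally have "(LINT t|?M. w t \<bullet> (matrix_inv Q *v w t) + U t \<bullet> (matrix_inv R *v U t)) = \<dots>" .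
    moreover have "v t1 \<bullet> (P 0 *v v t1) = z \<bullet> (Q0 *v z)"
      unfolding P0 Q0z unfolding z_def by (rule inner_commute)
    ultimately show ?thesis using pairing[OF prv gsq] by (simp add: J_def)
  qed
  \<comment> \<open>The estimation error is the weighted inner product with the extremal disturbance.\<close>
  have err: "l \<bullet> ac_rep {0..t1} (\<lambda>t. F *v x t) t1 - observer_out U t1 y
      = ac_rep {0..t1} (\<lambda>t. F *v x t) 0 \<bullet> (Q0 *v z) + (LINT t|?M. f t \<bullet> w t - \<eta> t \<bullet> U t)"
    if sol: "dae_sol F A H t1 x f y \<eta>" for x f y \<eta>
  proof -
    obtain a where sq: "sqint ?M x" "sqint ?M f" "sqint ?M y" "sqint ?M \<eta>"
      and a: "primitive t1 a (\<lambda>t. A *v x t + f t)" "AE t in ?M. F *v x t = a t"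
      and y: "AE t in ?M. y t = H *v x t + \<eta> t"
      using sol unfolding dae_sol_iff[OF T] by blast
    have rep: "ac_rep {0..t1} (\<lambda>t. F *v x t) t = a t" if "t \<in> {0..t1}" for t
      by (rule ac_rep_eq[OF T is_ac_rep_primitive[OF a] that])
    note ar = primitive_range(1)[OF T a]
    have "a t1 \<bullet> (pinv (transpose F) *v bs 0) - a 0 \<bullet> (pinv (transpose F) *v bs t1)
        = (LINT t|?M. f t \<bullet> w t + (H *v x t) \<bullet> U t)"
      using primal_dual_identity[OF T sq(1,2) a qsq usq bs] unfolding w_def U_def .
    moreover have "a t1 \<bullet> (pinv (transpose F) *v bs 0) = l \<bullet> a t1"
      using range_inner_pinv[OF ar, of t1 l] T by (simp add: bs_eq v0 inner_commute)
    moreover have "a 0 \<bullet> (pinv (transpose F) *v bs t1) = a 0 \<bullet> (Q0 *v z)"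
      unfolding Q0z using rangeE[OF ar, of 0] range_inner_pinv[OF ar, of 0] T by (simp add: bs_eq)
    moreover have "observer_out U t1 y = (LINT t|?M. (H *v x t) \<bullet> U t + \<eta> t \<bullet> U t)"
      unfolding observer_out_def
      using y sqint_measurable[OF sq(3)] sqint_measurable[OF Usq] sqint_measurable[OF sq(4)] sqint_measurable[OF sqint_matrix[OF sq(1), of H]]
      by (intro integral_cong_AE) (auto simp: inner_add_left)
    ultimately show ?thesis
      using rep[of t1] rep[of 0] T I[OF sq(2) wsq] I[OF sqint_matrix[OF sq(1), of H] Usq] I[OF sq(4) Usq] by simp
  qed
  \<comment> \<open>First-order optimality: the extremal disturbance is orthogonal to the dual solutions starting at 0.\<close>
  have orth: "z \<bullet> c + (LINT t|?M. q t \<bullet> (matrix_inv Q *v w (t1 - t)) + u t \<bullet> (matrix_inv R *v U (t1 - t))) = 0"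
    if q: "sqint ?M q" and u: "sqint ?M u" and b: "primitive t1 b (\<lambda>t. transpose A *v q t - transpose H *v u t)"
      "AE t in ?M. transpose F *v q t = b t" and b0: "b 0 = 0" and bT: "b t1 = transpose F *v c" for q u b c
  proof -
    have "(q, u) \<in> dual_sols {0..t1} F A H"
      unfolding dual_sols_iff[OF T] using q u b by blast
    then obtain p g where p: "AC_on {0..t1} p" and g: "sqint ?M g"
      and dp: "AE t in ?M. (p has_vector_derivative (Aa *v p t + Ba *v g t)) (at t within {0..t1})"
      and st: "AE t in ?M. stack (q t) (u t) = Ca *v p t + Da *v g t"
      unfolding lti[OF interval[OF T]] L2loc_Icc_iff by blast
    have psq: "sqint ?M p" by (rule sqint_continuous_on[OF AC_on_continuous_on[OF p]])
    have prp: "primitive t1 p (\<lambda>t. Aa *v p t + Ba *v g t)"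
      by (rule AC_on_primitive[OF p sqint_add[OF sqint_matrix[OF psq] sqint_matrix[OF g]] dp])
    have b_eq: "b t = transpose F *v (?Cs *v p t)" if "t \<in> {0..t1}" for t
    proof (rule continuous_on_AE_eq[OF T primitive_continuous_on[OF b(1)] _ _ that])
      show "continuous_on {0..t1} (\<lambda>t. transpose F *v (?Cs *v p t))"
        by (intro continuous_intros cont AC_on_continuous_on p)
      show "AE t in ?M. b t = transpose F *v (?Cs *v p t)"
        using b(2) st by eventually_elim (metis FCD stack_eq_iff)
    qed
    have p0: "p 0 = 0" using Mstate[of "p 0"] b_eq[of 0] b0 T by simp
    have "p t1 \<bullet> (P 0 *v v t1) = z \<bullet> c"
    proof -
      have "p t1 \<bullet> (P 0 *v v t1) = z \<bullet> (Em *v (?Cs *v p t1))" unfolding P0 z_def by (rule inner_commute)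
      also have "\<dots> = z \<bullet> (?Cs *v p t1)" by (rule rangeE[OF zr])
      also have "\<dots> = z \<bullet> (pinv (transpose F) *v (transpose F *v (?Cs *v p t1)))"
        by (rule range_inner_pinv[OF zr, symmetric])
      also have "\<dots> = z \<bullet> (pinv (transpose F) *v (transpose F *v c))" using b_eq[of t1] bT T by simp
      also have "\<dots> = z \<bullet> c" by (rule range_inner_pinv[OF zr])
      finally show ?thesis .
    qed
    moreover have "(LINT t|?M. (Ca *v p t + Da *v g t) \<bullet> (S *v ((Ca - Da ** K (t1 - t)) *v v t)))
        = (LINT t|?M. q t \<bullet> (matrix_inv Q *v w (t1 - t)) + u t \<bullet> (matrix_inv R *v U (t1 - t)))"
    proof (rule integral_cong_AE)
      have cS: "sqint ?M (\<lambda>t. S *v ((Ca - Da ** K (t1 - t)) *v v t))"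
        by (intro sqint_continuous_on continuous_intros cont cKr cv)
      show "(\<lambda>t. (Ca *v p t + Da *v g t) \<bullet> (S *v ((Ca - Da ** K (t1 - t)) *v v t))) \<in> borel_measurable ?M"
        using I[OF sqint_add[OF sqint_matrix[OF psq] sqint_matrix[OF g]] cS, of Ca Da] by (rule borel_measurable_integrable)
      show "(\<lambda>t. q t \<bullet> (matrix_inv Q *v w (t1 - t)) + u t \<bullet> (matrix_inv R *v U (t1 - t))) \<in> borel_measurable ?M"
        using Bochner_Integration.integrable_add[OF I[OF q sqint_matrix[OF qsq]] I[OF u sqint_matrix[OF usq]],
            of "matrix_inv Q" "matrix_inv R"] by (simp add: w_def U_def borel_measurable_integrable)
      have "AE t in ?M. t \<in> {0..t1}" by (intro AE_I2) simp
      then show "AE t in ?M. (Ca *v p t + Da *v g t) \<bullet> (S *v ((Ca - Da ** K (t1 - t)) *v v t))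
          = q t \<bullet> (matrix_inv Q *v w (t1 - t)) + u t \<bullet> (matrix_inv R *v U (t1 - t))"
        using st by eventually_elim (simp add: Sform w_def U_def)
    qed
    ultimately show ?thesis using pairing[OF prp g] p0 by simp
  qed
  have ge: "ereal J \<le> worst_error F A H Q0 Q R V l t1" for V
    by (rule worst_error_ge[OF T pd wsq Usq J err orth])
  have le: "worst_error F A H Q0 Q R U l t1 \<le> ereal J"
    by (rule worst_error_le[OF T pd wsq Usq J err])
  have val: "worst_error F A H Q0 Q R U l t1 = ereal J" using ge[of U] le by simp
  have mini: "minimax_observer F A H Q0 Q R U l t1"
    unfolding minimax_observer_def val
  proof (intro conjI antisym)
    show "L2loc {0..t1} U" using Usq by (simp add: L2loc_Icc_iff)
    then show "(INF U \<in> {U. L2loc {0..t1} U}. worst_error F A H Q0 Q R U l t1) \<le> ereal J"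
      using le by (intro INF_lower2[of U]) auto
    show "ereal J \<le> (INF U \<in> {U. L2loc {0..t1} U}. worst_error F A H Q0 Q R U l t1)"
      by (intro INF_greatest ge)
  qed simp
  have Jval: "J = l \<bullet> ((F ** transpose M ** P t1 ** M ** transpose F) *v l)"
    unfolding J_def assms(12)
    by (simp add: inner_mult_transpose matrix_transpose_mul flip: matrix_vector_mul_assoc)
  define G where "G t = Aa - Ba ** K t" for t
  define L where "L t = ?Cu - ?Du ** K t" for t
  have cG: "continuous_on {0..t1} G" "continuous_on {0..t1} L"
    unfolding G_def L_def by (intro continuous_intros cont cK)+
  define is_state where "is_state y r \<longleftrightarrow> AC_on {0..t1} r \<and> r 0 = 0 \<and> (AE t in ?M. (r has_vector_derivative
      (transpose (G t) *v r t + transpose (L t) *v y t)) (at t within {0..t1}))" for y :: "real \<Rightarrow> real^'p" and r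
  have state: "(\<exists>r. is_state y r) \<and> (\<forall>r. is_state y r \<longrightarrow> observer_out U t1 y = l \<bullet> ((F ** transpose M) *v r t1))"
    if y: "L2loc {0..t1} y" for y
  proof
    have ysq: "sqint ?M y" using y by (simp add: L2loc_Icc_iff)
    have cGt: "continuous_on {0..t1} (\<lambda>t. transpose (G t))" "continuous_on {0..t1} (\<lambda>t. transpose (L t))"
      by (intro bounded_linear.continuous_on[OF bounded_linear_transpose] cG)+
    have hsq: "sqint ?M (\<lambda>t. transpose (L t) *v y t)"
      by (rule sqint_continuous_bilinear[OF bilinear_matrix_vector cGt(2) ysq])
    obtain r where r: "r 0 = 0" "primitive t1 r (\<lambda>t. transpose (G t) *v r t + transpose (L t) *v y t)"
      using linear_ode_exists[OF T cGt(1) hsq] .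
    then show "\<exists>r. is_state y r"
      unfolding is_state_def using primitive_AC primitive_has_derivative_AE by blast
    show "\<forall>r. is_state y r \<longrightarrow>
         observer_out U t1 y = l \<bullet> ((F ** transpose M) *v r t1)"
    proof (intro allI impI)
      fix r assume "is_state y r"
      then have r: "AC_on {0..t1} r" "r 0 = 0" "AE t in ?M. (r has_vector_derivative
                (transpose (G t) *v r t + transpose (L t) *v y t)) (at t within {0..t1})"
        unfolding is_state_def by blast+
      have "observer_out U t1 y = (LINT t|?M. y t \<bullet> (L t *v v (t1 - t)))"
        unfolding observer_out_def U_def L_def using assms(13)
        by (intro Bochner_Integration.integral_cong refl) simp
      also have "\<dots> = v 0 \<bullet> r t1"
        by (rule observer_state_output[OF T cG _ ysq r]) (use dv in \<open>simp add: G_def\<close>)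
      also have "\<dots> = l \<bullet> ((F ** transpose M) *v r t1)"
        unfolding assms(12) by (simp add: inner_mult_transpose matrix_transpose_mul flip: matrix_vector_mul_assoc)
      finally show "observer_out U t1 y = l \<bullet> ((F ** transpose M) *v r t1)" .
    qed
  qed
  have Ueq: "(\<lambda>s. ustar (t1 - s)) = U" by (simp add: U_def fun_eq_iff)
  show ?thesis
    unfolding Ueq using mini val Jval state by (simp add: is_state_def G_def L_def)
qed

end
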